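(* The map $\hat\eta:\hat U_q\to\hat\Gamma$ is a surjection.
   Context: Let $q$ be transcendental over $\mathbb{Q}$, $\Bbbk$ a field containing $\mathbb{Q}(q)$, and $\mathcal{A}=\mathbb{Q}[q,q^{-1}]_{(q-1)}$ (localization at the prime ideal $(q-1)$). $q$-differential operators over a base ring: let $k$ be a commutative ring, $q\in k$ a unit, and $S$ a commutative $\mathbb{Z}$-graded $k$-algebra, with bicharacter $\beta(n,m)=q^{nm}$. A $k$-linear endomorphism $\varphi$ of $S$ is homogeneous of degree $d$ if $\varphi(S_b)\subseteq S_{b+d}$ for all $b$; $\mathrm{grHom}_k(S,S)$ is the set of finite sums of homogeneous endomorphisms, an $S$-bimodule via composition with multiplication operators. For $a\in\mathbb Z$ put $\widetilde\sigma_a(\psi)=q^{ad}\psi$ for $\psi$ homogeneous of degree $d$ (extended linearly) and $[\varphi,\psi]_a=\varphi\psi-\widetilde\sigma_a(\psi)\varphi$. $D^0$ is the smallest $S$-sub-bimodule containing all homogeneous $\varphi$ for which some $a\in\mathbb{Z}$ satisfies $[\varphi,s]_a=0$ for all $s\in S$; $D^{l+1}$ is the smallest $S$-sub-bimodule containing all homogeneous $\varphi$ for which some $a$ satisfies $[\varphi,s]_a\in D^l$ for all $s\in S$; the ring of $q$-differential operators is $\bigcup_l D^l$. For $n\ge1$ let $B_n=\mathcal{A}/(q-1)^n$, and let $D_{q,\mathcal{A}}(B_n[x])$, $D_{q,\mathcal{A}}(B_n[x^{-1}])$, $D_{q,\mathcal{A}}(B_n[x,x^{-1}])$ be the rings of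 $B_n$-linear $q$-differential operators for the grading $\deg x=1$, $\deg x^{-1}=-1$. Every operator in the first two rings extends canonically to one in the third, giving ring homomorphisms into it. Put $\Gamma_{q,n}=\ker\big(D_{q,\mathcal{A}}(B_n[x])\oplus D_{q,\mathcal{A}}(B_n[x^{-1}])\to D_{q,\mathcal{A}}(B_n[x,x^{-1}])\big)$, $(\varphi_1,\varphi_2)\mapsto\varphi_1-\varphi_2$. The $\Gamma_{q,n}$ form an inverse system (reduction mod $(q-1)^{n-1}$) with inverse limit $\hat\Gamma$. $U_q$ is the $\Bbbk$-algebra generated by $E,F,K,K^{-1}$ with relations $KK^{-1}=1=K^{-1}K$, $KEK^{-1}=q^2E$, $KFK^{-1}=q^{-2}F$, $EF-FE=\frac{K-K^{-1}}{q-q^{-1}}$. Let $[i]=\frac{q^i-q^{-i}}{q-q^{-1}}$, $[m]!=\prod_{1\le i\le m}[i]$, $E^{(m)}=E^m/[m]!$, $F^{(m)}=F^m/[m]!$. $U_{q,\mathcal{A}}$ is the $\mathcal{A}$-subalgebra of $U_q$ generated by $K,K^{-1}$ and $E^{(m)},F^{(m)}$ for integers $m\ge0$; $U_{q,n}=U_{q,\mathcal{A}}/(q-1)^n$; $\hat U_q=\varprojlim_n U_{q,n}$. Put $y=x^{-1}$. Let $\sigma(x^m)=q^mx^m$ and $\partial^{\beta^2}(x^m)=\frac{q^{2m}-1}{q^2-1}x^{m-1}$ on $\Bbbk[x]$, and $\sigma_y(y^m)=q^{-m}y^m$ and $\partial_y^{\beta^2}(y^m)=\frac{1-q^{-2m}}{1-q^{-2}}y^{m-1}$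 on $\Bbbk[y]$. There are algebra homomorphisms $\alpha$ and $\gamma$ from $U_q$ to the rings of $q$-differential operators on $\Bbbk[x]$ and on $\Bbbk[y]$ ($\deg y=-1$), given by $\alpha(K^{\pm1})=\sigma^{\pm2}$, $\alpha(F)=q^{-1}\sigma^{-2}\partial^{\beta^2}$, $\alpha(E)=-q^2x^2\partial^{\beta^2}$; $\gamma(K^{\pm1})=\sigma_y^{\pm2}$, $\gamma(F)=-q^{-3}\sigma_y^{-2}y^2\partial_y^{\beta^2}$, $\gamma(E)=\partial_y^{\beta^2}$. The actions of $U_{q,\mathcal{A}}$ via $\alpha,\gamma$ preserve $\mathcal{A}[x]$ and $\mathcal{A}[y]$. Reducing mod $(q-1)^n$ gives $\alpha_n,\gamma_n$ and a homomorphism $\eta_n=(\alpha_n,\gamma_n):U_{q,n}\to\Gamma_{q,n}$; $\hat\eta:\hat U_q\to\hat\Gamma$ is the inverse limit of the $\eta_n$. *)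

theory Defs
  imports
    "HOL-Algebra.QuotRing"
    "HOL-Algebra.Module"
    "HOL-Algebra.Generated_Rings"
    "HOL-Algebra.Chinese_Remainder"
    "HOL-Computational_Algebra.Polynomial"
    "HOL-Library.FuncSet"
begin

section \<open>General constructions\<close>

text \<open>The map that \<open>h\<close> induces along the surjection \<open>p\<close> with domain \<open>A\<close>: its value at \<open>b\<close> is the
  common value of \<open>h\<close> on the fibre of \<open>b\<close>.  It is only meaningful if \<open>h\<close> is constant on fibres.\<close>

definition descend :: "('a \<Rightarrow> 'b) \<Rightarrow> 'a set \<Rightarrow> ('a \<Rightarrow> 'c) \<Rightarrow> 'b \<Rightarrow> 'c"
  where "descend p A h b = the_elem (h ` {a \<in> A. p a = b})"

text \<open>The underlying set of the inverse limit of \<open>X 1 \<leftarrow> X 2 \<leftarrow> \<dots>\<close> with transition maps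
  \<open>t n\<close> from \<open>X (Suc n)\<close> to \<open>X n\<close>.\<close>

definition inv_lim :: "(nat \<Rightarrow> 'a set) \<Rightarrow> (nat \<Rightarrow> 'a \<Rightarrow> 'a) \<Rightarrow> (nat \<Rightarrow> 'a) set"
  where "inv_lim X t = {s \<in> \<Pi>\<^sub>E n \<in> {1..}. X n. \<forall>n\<ge>1. t n (s (Suc n)) = s n}"

definition field_ring :: "'k::field ring"
  where "field_ring = \<lparr>carrier = UNIV, monoid.mult = (*), one = 1, zero = 0, add = (+)\<rparr>"

lemma field_ring_cring: "cring (field_ring :: 'k::field ring)"
  by (unfold_locales) (auto simp: field_ring_def algebra_simps Units_def intro: exI[of _ "- x" for x])


section \<open>Graded algebras and their \<open>q\<close>-differential operators\<close>

locale graded_algebra = algebra R S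
  for R :: "('r, 'm) ring_scheme" (structure) and S :: "('r, 's, 'n) module_scheme" (structure) +
  fixes G :: "int \<Rightarrow> 's set"
  assumes grade_submodule: "submodule (G d) R S"
    and grade_decomp: "s \<in> carrier S \<Longrightarrow>
      \<exists>!c. (\<forall>d. c d \<in> G d) \<and> finite {d. c d \<noteq> \<zero>\<^bsub>S\<^esub>} \<and>
           s = (\<Oplus>\<^bsub>S\<^esub>d\<in>{d. c d \<noteq> \<zero>\<^bsub>S\<^esub>}. c d)"
    and grade_one: "\<one>\<^bsub>S\<^esub> \<in> G 0"
    and grade_mult: "a \<in> G i \<Longrightarrow> b \<in> G j \<Longrightarrow> a \<otimes>\<^bsub>S\<^esub> b \<in> G (i + j)"

text \<open>Endomorphisms are extensional functions on the carrier, so that equality of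
  endomorphisms is equality in HOL.\<close>

definition lin_end :: "('r, 'm) ring_scheme \<Rightarrow> ('r, 's, 'n) module_scheme \<Rightarrow> ('r, 's \<Rightarrow> 's) module"
  where "lin_end R S = \<lparr>
    carrier = {\<phi> \<in> carrier S \<rightarrow>\<^sub>E carrier S.
      (\<forall>s\<in>carrier S. \<forall>t\<in>carrier S. \<phi> (s \<oplus>\<^bsub>S\<^esub> t) = \<phi> s \<oplus>\<^bsub>S\<^esub> \<phi> t) \<and>
      (\<forall>c\<in>carrier R. \<forall>s\<in>carrier S. \<phi> (c \<odot>\<^bsub>S\<^esub> s) = c \<odot>\<^bsub>S\<^esub> \<phi> s)},
    monoid.mult = compose (carrier S),
    one = (\<lambda>s\<in>carrier S. s),
    zero = (\<lambda>s\<in>carrier S. \<zero>\<^bsub>S\<^esub>),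
    add = (\<lambda>\<phi> \<psi>. \<lambda>s\<in>carrier S. \<phi> s \<oplus>\<^bsub>S\<^esub> \<psi> s),
    module.smult = (\<lambda>c \<phi>. \<lambda>s\<in>carrier S. c \<odot>\<^bsub>S\<^esub> \<phi> s)\<rparr>"

lemma (in module) lin_end_ring: "ring (lin_end R M)"
proof -
  let ?E = "lin_end R M"
  have neg: "\<exists>g\<in>carrier ?E. g \<oplus>\<^bsub>?E\<^esub> f = \<zero>\<^bsub>?E\<^esub>" if "f \<in> carrier ?E" for f
    using that
    by (intro bexI[of _ "\<lambda>s\<in>carrier M. \<ominus>\<^bsub>M\<^esub> f s"])
       (auto simp: lin_end_def M.l_neg M.minus_add smult_r_minus PiE_iff fun_eq_iff)
  have ac: "(a \<oplus>\<^bsub>M\<^esub> b) \<oplus>\<^bsub>M\<^esub> (c \<oplus>\<^bsub>M\<^esub> d) = (a \<oplus>\<^bsub>M\<^esub> c) \<oplus>\<^bsub>M\<^esub> (b \<oplus>\<^bsub>M\<^esub> d)"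
    if "a \<in> carrier M" "b \<in> carrier M" "c \<in> carrier M" "d \<in> carrier M" for a b c d
    using that by (simp add: M.a_ac)
  have eqI: "f = g" if "f \<in> extensional (carrier M)" "g \<in> extensional (carrier M)"
    "\<And>x. x \<in> carrier M \<Longrightarrow> f x = g x" for f g :: "'c \<Rightarrow> 'c"
    using that by (rule extensionalityI)
  show ?thesis
  proof (intro ringI abelian_groupI monoidI)
    fix f g h
    show "\<exists>y\<in>carrier ?E. y \<oplus>\<^bsub>?E\<^esub> f = \<zero>\<^bsub>?E\<^esub>" if "f \<in> carrier ?E" using neg that .
    show "f \<oplus>\<^bsub>?E\<^esub> g \<in> carrier ?E" if "f \<in> carrier ?E" "g \<in> carrier ?E"
      using that by (auto simp: lin_end_def PiE_iff ac smult_r_distr)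
  qed (auto simp: lin_end_def PiE_iff compose_def M.a_ac fun_eq_iff extensional_def)
qed

definition mult_op :: "('s, 'n) ring_scheme \<Rightarrow> 's \<Rightarrow> 's \<Rightarrow> 's"
  where "mult_op S s = (\<lambda>t\<in>carrier S. s \<otimes>\<^bsub>S\<^esub> t)"

definition homog :: "('r, 'm) ring_scheme \<Rightarrow> ('r, 's, 'n) module_scheme \<Rightarrow> (int \<Rightarrow> 's set)
    \<Rightarrow> int \<Rightarrow> ('s \<Rightarrow> 's) set"
  where "homog R S G d = {\<phi> \<in> carrier (lin_end R S). \<forall>b. \<phi> ` G b \<subseteq> G (b + d)}"

definition gr_hom :: "('r, 'm) ring_scheme \<Rightarrow> ('r, 's, 'n) module_scheme \<Rightarrow> (int \<Rightarrow> 's set)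
    \<Rightarrow> ('s \<Rightarrow> 's) set"
  where "gr_hom R S G = {(\<Oplus>\<^bsub>lin_end R S\<^esub>d\<in>J. c d) | J c. finite J \<and> (\<forall>d\<in>J. c d \<in> homog R S G d)}"

text \<open>The family of homogeneous components of an element \<open>x\<close> of \<open>M\<close>, where \<open>H d\<close> is the set of
  elements of \<open>M\<close> that are homogeneous of degree \<open>d\<close>.\<close>

definition components :: "('a, 'm) ring_scheme \<Rightarrow> (int \<Rightarrow> 'a set) \<Rightarrow> 'a \<Rightarrow> int \<Rightarrow> 'a"
  where "components M H x = (THE c. (\<forall>d. c d \<in> H d) \<and> finite {d. c d \<noteq> \<zero>\<^bsub>M\<^esub>} \<and>
    x = (\<Oplus>\<^bsub>M\<^esub>d\<in>{d. c d \<noteq> \<zero>\<^bsub>M\<^esub>}. c d))"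

definition sigma_tw :: "('r, 'm) ring_scheme \<Rightarrow> ('r, 's, 'n) module_scheme \<Rightarrow> (int \<Rightarrow> 's set)
    \<Rightarrow> 'r \<Rightarrow> int \<Rightarrow> ('s \<Rightarrow> 's) \<Rightarrow> 's \<Rightarrow> 's"
  where "sigma_tw R S G q a \<psi> =
    (let c = components (lin_end R S) (homog R S G) \<psi>
     in \<Oplus>\<^bsub>lin_end R S\<^esub>d\<in>{d. c d \<noteq> \<zero>\<^bsub>lin_end R S\<^esub>}. (q [^]\<^bsub>R\<^esub> (a * d)) \<odot>\<^bsub>lin_end R S\<^esub> c d)"

definition q_bracket :: "('r, 'm) ring_scheme \<Rightarrow> ('r, 's, 'n) module_scheme \<Rightarrow> (int \<Rightarrow> 's set)
    \<Rightarrow> 'r \<Rightarrow> int \<Rightarrow> ('s \<Rightarrow> 's) \<Rightarrow> ('s \<Rightarrow> 's) \<Rightarrow> 's \<Rightarrow> 's"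
  where "q_bracket R S G q a \<phi> \<psi> =
    (\<phi> \<otimes>\<^bsub>lin_end R S\<^esub> \<psi>) \<ominus>\<^bsub>lin_end R S\<^esub> (sigma_tw R S G q a \<psi> \<otimes>\<^bsub>lin_end R S\<^esub> \<phi>)"

definition sub_bimodule :: "('r, 'm) ring_scheme \<Rightarrow> ('r, 's, 'n) module_scheme \<Rightarrow> (int \<Rightarrow> 's set)
    \<Rightarrow> ('s \<Rightarrow> 's) set \<Rightarrow> bool"
  where "sub_bimodule R S G M \<longleftrightarrow>
    M \<subseteq> gr_hom R S G \<and> additive_subgroup M (lin_end R S) \<and>
    (\<forall>s\<in>carrier S. \<forall>\<phi>\<in>M. mult_op S s \<otimes>\<^bsub>lin_end R S\<^esub> \<phi> \<in> M \<and> \<phi> \<otimes>\<^bsub>lin_end R S\<^esub> mult_op S s \<in> M)"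

primrec q_diff_ops_level :: "('r, 'm) ring_scheme \<Rightarrow> ('r, 's, 'n) module_scheme \<Rightarrow> (int \<Rightarrow> 's set)
    \<Rightarrow> 'r \<Rightarrow> nat \<Rightarrow> ('s \<Rightarrow> 's) set"
  where
    "q_diff_ops_level R S G q 0 = sub_bimodule R S G hull
      {\<phi>. (\<exists>d. \<phi> \<in> homog R S G d) \<and>
          (\<exists>a. \<forall>s\<in>carrier S. q_bracket R S G q a \<phi> (mult_op S s) = \<zero>\<^bsub>lin_end R S\<^esub>)}"
  | "q_diff_ops_level R S G q (Suc l) = sub_bimodule R S G hull
      {\<phi>. (\<exists>d. \<phi> \<in> homog R S G d) \<and>
          (\<exists>a. \<forall>s\<in>carrier S. q_bracket R S G q a \<phi> (mult_op S s) \<in> q_diff_ops_level R S G q l)}"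

definition q_diff_ops :: "('r, 'm) ring_scheme \<Rightarrow> ('r, 's, 'n) module_scheme \<Rightarrow> (int \<Rightarrow> 's set)
    \<Rightarrow> 'r \<Rightarrow> ('r, 's \<Rightarrow> 's) module"
  where "q_diff_ops R S G q = (lin_end R S)\<lparr>carrier := \<Union>l. q_diff_ops_level R S G q l\<rparr>"


section \<open>Polynomials and Laurent polynomials\<close>

text \<open>\<open>laurent R I\<close> is the ring of Laurent polynomials over \<open>R\<close> with exponents of \<open>x\<close> in \<open>I\<close>; an
  element is its coefficient function.  Thus \<open>R[x]\<close>, \<open>R[x\<inverse>]\<close> and \<open>R[x,x\<inverse>]\<close> are
  \<open>laurent R {0..}\<close>, \<open>laurent R {..0}\<close> and \<open>laurent R UNIV\<close>.  The degree is always the exponent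
  of \<open>x\<close>, so \<open>x\<inverse>\<close> has degree \<open>-1\<close>.\<close>

definition mon :: "('r, 'm) ring_scheme \<Rightarrow> 'r \<Rightarrow> int \<Rightarrow> int \<Rightarrow> 'r"
  where "mon R c j = (\<lambda>i. if i = j then c else \<zero>\<^bsub>R\<^esub>)"

definition laurent :: "('r, 'm) ring_scheme \<Rightarrow> int set \<Rightarrow> ('r, int \<Rightarrow> 'r) module"
  where "laurent R I = \<lparr>
    carrier = {f. (\<forall>j. f j \<in> carrier R) \<and> finite {j. f j \<noteq> \<zero>\<^bsub>R\<^esub>} \<and> (\<forall>j. j \<notin> I \<longrightarrow> f j = \<zero>\<^bsub>R\<^esub>)},
    monoid.mult = (\<lambda>f g j. \<Oplus>\<^bsub>R\<^esub>i\<in>{i. f i \<noteq> \<zero>\<^bsub>R\<^esub>}. f i \<otimes>\<^bsub>R\<^esub> g (j - i)),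
    one = mon R \<one>\<^bsub>R\<^esub> 0,
    zero = (\<lambda>_. \<zero>\<^bsub>R\<^esub>),
    add = (\<lambda>f g j. f j \<oplus>\<^bsub>R\<^esub> g j),
    module.smult = (\<lambda>c f j. c \<otimes>\<^bsub>R\<^esub> f j)\<rparr>"

definition laurent_grade :: "('r, 'm) ring_scheme \<Rightarrow> int set \<Rightarrow> int \<Rightarrow> (int \<Rightarrow> 'r) set"
  where "laurent_grade R I d = {f \<in> carrier (laurent R I). \<forall>j. j \<noteq> d \<longrightarrow> f j = \<zero>\<^bsub>R\<^esub>}"

lemma (in abelian_monoid) finsum_swap:
  assumes "finite A" "finite B" "\<And>a b. a \<in> A \<Longrightarrow> b \<in> B \<Longrightarrow> f a b \<in> carrier G"
  shows "(\<Oplus>a\<in>A. \<Oplus>b\<in>B. f a b) = (\<Oplus>b\<in>B. \<Oplus>a\<in>A. f a b)"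
  using assms(1,3)
proof (induction A)
  case empty
  then show ?case by (simp add: finsum_zero)
next
  case (insert x F)
  have "(\<Oplus>a\<in>insert x F. \<Oplus>b\<in>B. f a b) = (\<Oplus>b\<in>B. f x b) \<oplus> (\<Oplus>a\<in>F. \<Oplus>b\<in>B. f a b)"
    using insert by (subst finsum_insert) (auto intro!: finsum_closed)
  also have "\<dots> = (\<Oplus>b\<in>B. f x b) \<oplus> (\<Oplus>b\<in>B. \<Oplus>a\<in>F. f a b)"
    using insert by auto
  also have "\<dots> = (\<Oplus>b\<in>B. f x b \<oplus> (\<Oplus>a\<in>F. f a b))"
    using insert by (subst finsum_addf) (auto intro!: finsum_closed)
  also have "\<dots> = (\<Oplus>b\<in>B. \<Oplus>a\<in>insert x F. f a b)"
    using insert by (intro finsum_cong') (auto intro!: finsum_closed)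
  finally show ?case .
qed

context cring
begin

lemma laurent_mult_eq:
  assumes "f \<in> carrier (laurent R I)" "g \<in> carrier (laurent R I)" "finite F" "{i. f i \<noteq> \<zero>} \<subseteq> F"
  shows "(f \<otimes>\<^bsub>laurent R I\<^esub> g) j = (\<Oplus>i\<in>F. f i \<otimes> g (j - i))"
  using assms unfolding laurent_def
  by (auto intro!: add.finprod_mono_neutral_cong_left)

lemma laurent_mult_closed:
  assumes I: "\<And>i j. i \<in> I \<Longrightarrow> j \<in> I \<Longrightarrow> i + j \<in> I"
    and f: "f \<in> carrier (laurent R I)" and g: "g \<in> carrier (laurent R I)"
  shows "f \<otimes>\<^bsub>laurent R I\<^esub> g \<in> carrier (laurent R I)"
proof -
  have fin: "finite {i. f i \<noteq> \<zero>}" "finite {i. g i \<noteq> \<zero>}"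
    and car: "\<And>i. f i \<in> carrier R" "\<And>i. g i \<in> carrier R"
    and supp: "\<And>i. i \<notin> I \<Longrightarrow> f i = \<zero>" "\<And>i. i \<notin> I \<Longrightarrow> g i = \<zero>"
    using f g by (auto simp: laurent_def)
  have eq: "(f \<otimes>\<^bsub>laurent R I\<^esub> g) j = (\<Oplus>i\<in>{i. f i \<noteq> \<zero>}. f i \<otimes> g (j - i))" for j
    using laurent_mult_eq[OF f g fin(1)] by simp
  have ex: "\<exists>i. f i \<noteq> \<zero> \<and> g (j - i) \<noteq> \<zero>" if "(f \<otimes>\<^bsub>laurent R I\<^esub> g) j \<noteq> \<zero>" for j
  proof (rule ccontr)
    assume "\<not> ?thesis"
    then have "(\<Oplus>i\<in>{i. f i \<noteq> \<zero>}. f i \<otimes> g (j - i)) = \<zero>"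
      using car by (intro add.finprod_one_eqI) auto
    with that eq show False by simp
  qed
  have "{j. (f \<otimes>\<^bsub>laurent R I\<^esub> g) j \<noteq> \<zero>} \<subseteq> (\<lambda>(a, b). a + b) ` ({i. f i \<noteq> \<zero>} \<times> {i. g i \<noteq> \<zero>})"
  proof
    fix j assume "j \<in> {j. (f \<otimes>\<^bsub>laurent R I\<^esub> g) j \<noteq> \<zero>}"
    then obtain i where "f i \<noteq> \<zero>" "g (j - i) \<noteq> \<zero>" using ex by auto
    then show "j \<in> (\<lambda>(a, b). a + b) ` ({i. f i \<noteq> \<zero>} \<times> {i. g i \<noteq> \<zero>})"
      by (intro image_eqI[of _ _ "(i, j - i)"]) auto
  qed
  then have "finite {j. (f \<otimes>\<^bsub>laurent R I\<^esub> g) j \<noteq> \<zero>}"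
    using fin by (meson finite_SigmaI finite_imageI finite_subset)
  moreover have "(f \<otimes>\<^bsub>laurent R I\<^esub> g) j = \<zero>" if "j \<notin> I" for j
  proof (rule ccontr)
    assume "(f \<otimes>\<^bsub>laurent R I\<^esub> g) j \<noteq> \<zero>"
    then obtain i where "f i \<noteq> \<zero>" "g (j - i) \<noteq> \<zero>" using ex by auto
    then have "i + (j - i) \<in> I" using supp I by blast
    with that show False by simp
  qed
  moreover have "(f \<otimes>\<^bsub>laurent R I\<^esub> g) j \<in> carrier R" for j
    unfolding eq using car by (auto intro!: finsum_closed)
  ultimately show ?thesis by (simp add: laurent_def)
qed

lemma laurent_graded_algebra:
  assumes I0: "0 \<in> I" and I: "\<And>i j. i \<in> I \<Longrightarrow> j \<in> I \<Longrightarrow> i + j \<in> I"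
  shows "graded_algebra R (laurent R I) (laurent_grade R I)"
proof -
  let ?S = "laurent R I"
  have clo: "f \<otimes>\<^bsub>?S\<^esub> g \<in> carrier ?S" if "f \<in> carrier ?S" "g \<in> carrier ?S" for f g
    using laurent_mult_closed that I by blast
  have D: "\<And>i. f i \<in> carrier R" "finite {i. f i \<noteq> \<zero>}" "\<And>i. i \<notin> I \<Longrightarrow> f i = \<zero>"
    if "f \<in> carrier ?S" for f
    using that by (auto simp: laurent_def)
  have addc: "f \<oplus>\<^bsub>?S\<^esub> g \<in> carrier ?S" if "f \<in> carrier ?S" "g \<in> carrier ?S" for f g
  proof -
    have "{j. f j \<oplus> g j \<noteq> \<zero>} \<subseteq> {j. f j \<noteq> \<zero>} \<union> {j. g j \<noteq> \<zero>}" by auto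
    then have "finite {j. f j \<oplus> g j \<noteq> \<zero>}" using D[OF that(1)] D[OF that(2)] finite_subset by blast
    then show ?thesis using D[OF that(1)] D[OF that(2)] by (auto simp: laurent_def)
  qed
  have smc: "c \<odot>\<^bsub>?S\<^esub> f \<in> carrier ?S" if "c \<in> carrier R" "f \<in> carrier ?S" for c f
  proof -
    have "{j. c \<otimes> f j \<noteq> \<zero>} \<subseteq> {j. f j \<noteq> \<zero>}" using that by auto
    then have "finite {j. c \<otimes> f j \<noteq> \<zero>}" using D[OF that(2)] finite_subset by blast
    then show ?thesis using that D[OF that(2)] by (auto simp: laurent_def)
  qed
  have monc: "mon R c j \<in> carrier ?S" if "c \<in> carrier R" "j \<in> I" for c j
  proof -
    have "{i. mon R c j i \<noteq> \<zero>} \<subseteq> {j}" by (auto simp: mon_def)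
    then show ?thesis using that finite_subset by (auto simp: laurent_def mon_def)
  qed
  have comm: "f \<otimes>\<^bsub>?S\<^esub> g = g \<otimes>\<^bsub>?S\<^esub> f" if f: "f \<in> carrier ?S" and g: "g \<in> carrier ?S" for f g
  proof
    fix j
    let ?F = "{i. f i \<noteq> \<zero>} \<union> (\<lambda>i. j - i) ` {i. g i \<noteq> \<zero>}"
    let ?G = "(\<lambda>i. j - i) ` ?F"
    have fin: "finite ?F" using D[OF f] D[OF g] by simp
    have "(f \<otimes>\<^bsub>?S\<^esub> g) j = (\<Oplus>i\<in>?F. f i \<otimes> g (j - i))"
      by (rule laurent_mult_eq[OF f g fin]) auto
    also have "\<dots> = (\<Oplus>i\<in>?F. g (j - i) \<otimes> f (j - (j - i)))"
      using D(1)[OF f] D(1)[OF g] by (intro finsum_cong') (auto simp: m_comm)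
    also have "\<dots> = (\<Oplus>i\<in>?G. g i \<otimes> f (j - i))"
      using D(1)[OF f] D(1)[OF g] by (subst finsum_reindex) (auto simp: inj_on_def)
    also have "\<dots> = (g \<otimes>\<^bsub>?S\<^esub> f) j"
      using fin by (intro laurent_mult_eq[OF g f, symmetric]) (force simp: image_iff)+
    finally show "(f \<otimes>\<^bsub>?S\<^esub> g) j = (g \<otimes>\<^bsub>?S\<^esub> f) j" .
  qed
  have assoc: "f \<otimes>\<^bsub>?S\<^esub> g \<otimes>\<^bsub>?S\<^esub> h = f \<otimes>\<^bsub>?S\<^esub> (g \<otimes>\<^bsub>?S\<^esub> h)"
    if f: "f \<in> carrier ?S" and g: "g \<in> carrier ?S" and h: "h \<in> carrier ?S" for f g h
  proof
    fix j
    let ?A = "{i. f i \<noteq> \<zero>}" and ?B = "{i. g i \<noteq> \<zero>}"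
    let ?P = "(\<lambda>(a, b). a + b) ` (?A \<times> ?B) \<union> {i. (f \<otimes>\<^bsub>?S\<^esub> g) i \<noteq> \<zero>}"
    note fg = clo[OF f g] and gh = clo[OF g h]
    note car[simp] = D(1)[OF f] D(1)[OF g] D(1)[OF h] D(1)[OF fg] D(1)[OF gh]
    have fin[simp]: "finite ?A" "finite ?B" "finite {i. (f \<otimes>\<^bsub>?S\<^esub> g) i \<noteq> \<zero>}"
      by (rule D(2)[OF f], rule D(2)[OF g], rule D(2)[OF fg])
    have finP[simp]: "finite ?P" by (simp only: fin finite_Un finite_imageI finite_SigmaI)
    have "(f \<otimes>\<^bsub>?S\<^esub> g \<otimes>\<^bsub>?S\<^esub> h) j = (\<Oplus>i\<in>?P. (f \<otimes>\<^bsub>?S\<^esub> g) i \<otimes> h (j - i))"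
      by (rule laurent_mult_eq[OF fg h finP]) auto
    also have "\<dots> = (\<Oplus>i\<in>?P. (\<Oplus>a\<in>?A. f a \<otimes> g (i - a)) \<otimes> h (j - i))"
      using laurent_mult_eq[OF f g fin(1)] by simp
    also have "\<dots> = (\<Oplus>i\<in>?P. \<Oplus>a\<in>?A. f a \<otimes> g (i - a) \<otimes> h (j - i))"
      by (intro finsum_cong') (auto simp: finsum_ldistr intro!: finsum_closed)
    also have "\<dots> = (\<Oplus>a\<in>?A. \<Oplus>i\<in>?P. f a \<otimes> g (i - a) \<otimes> h (j - i))"
      by (rule finsum_swap) auto
    also have "\<dots> = (\<Oplus>a\<in>?A. f a \<otimes> (g \<otimes>\<^bsub>?S\<^esub> h) (j - a))"
    proof (intro finsum_cong')
      fix a assume a: "a \<in> ?A"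
      have "(\<Oplus>i\<in>?P. f a \<otimes> g (i - a) \<otimes> h (j - i)) = (\<Oplus>i\<in>(\<lambda>b. a + b) ` ?B. f a \<otimes> g (i - a) \<otimes> h (j - i))"
      proof (rule add.finprod_mono_neutral_cong_right)
        show "(\<lambda>b. a + b) ` ?B \<subseteq> ?P" using a by auto
        fix i assume "i \<in> ?P - (\<lambda>b. a + b) ` ?B"
        then have "g (i - a) = \<zero>" by (force simp: image_iff)
        then show "f a \<otimes> g (i - a) \<otimes> h (j - i) = \<zero>" by simp
      qed auto
      also have "\<dots> = (\<Oplus>b\<in>?B. f a \<otimes> g b \<otimes> h (j - (a + b)))"
        by (subst finsum_reindex) auto
      also have "\<dots> = (\<Oplus>b\<in>?B. f a \<otimes> (g b \<otimes> h (j - a - b)))"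
        by (intro finsum_cong') (auto simp: m_assoc algebra_simps)
      also have "\<dots> = f a \<otimes> (\<Oplus>b\<in>?B. g b \<otimes> h (j - a - b))"
        by (subst finsum_rdistr) auto
      also have "\<dots> = f a \<otimes> (g \<otimes>\<^bsub>?S\<^esub> h) (j - a)"
        using laurent_mult_eq[OF g h fin(2)] by simp
      finally show "(\<Oplus>i\<in>?P. f a \<otimes> g (i - a) \<otimes> h (j - i)) = f a \<otimes> (g \<otimes>\<^bsub>?S\<^esub> h) (j - a)" .
    qed auto
    also have "\<dots> = (f \<otimes>\<^bsub>?S\<^esub> (g \<otimes>\<^bsub>?S\<^esub> h)) j"
      using laurent_mult_eq[OF f gh fin(1)] by simp
    finally show "(f \<otimes>\<^bsub>?S\<^esub> g \<otimes>\<^bsub>?S\<^esub> h) j = (f \<otimes>\<^bsub>?S\<^esub> (g \<otimes>\<^bsub>?S\<^esub> h)) j" .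
  qed
  have one: "\<one>\<^bsub>?S\<^esub> \<otimes>\<^bsub>?S\<^esub> f = f" if f: "f \<in> carrier ?S" for f
  proof
    fix j
    have o: "\<one>\<^bsub>?S\<^esub> \<in> carrier ?S" using monc[OF one_closed I0] by (simp add: laurent_def)
    have "(\<one>\<^bsub>?S\<^esub> \<otimes>\<^bsub>?S\<^esub> f) j = (\<Oplus>i\<in>{0}. \<one>\<^bsub>?S\<^esub> i \<otimes> f (j - i))"
      by (rule laurent_mult_eq[OF o f]) (auto simp: laurent_def mon_def)
    also have "\<dots> = f j" using D(1)[OF f] by (simp add: laurent_def mon_def)
    finally show "(\<one>\<^bsub>?S\<^esub> \<otimes>\<^bsub>?S\<^esub> f) j = f j" .
  qed
  have smassoc: "c \<odot>\<^bsub>?S\<^esub> f \<otimes>\<^bsub>?S\<^esub> g = c \<odot>\<^bsub>?S\<^esub> (f \<otimes>\<^bsub>?S\<^esub> g)"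
    if c: "c \<in> carrier R" and f: "f \<in> carrier ?S" and g: "g \<in> carrier ?S" for c f g
  proof
    fix j
    note fin = D(2)[OF f] and car[simp] = D(1)[OF f] D(1)[OF g]
    have "(c \<odot>\<^bsub>?S\<^esub> f \<otimes>\<^bsub>?S\<^esub> g) j = (\<Oplus>i\<in>{i. f i \<noteq> \<zero>}. (c \<odot>\<^bsub>?S\<^esub> f) i \<otimes> g (j - i))"
      using c by (intro laurent_mult_eq[OF smc[OF c f] g fin]) (auto simp: laurent_def)
    also have "\<dots> = (\<Oplus>i\<in>{i. f i \<noteq> \<zero>}. c \<otimes> (f i \<otimes> g (j - i)))"
      using c by (intro finsum_cong') (auto simp: laurent_def m_assoc)
    also have "\<dots> = c \<otimes> (\<Oplus>i\<in>{i. f i \<noteq> \<zero>}. f i \<otimes> g (j - i))"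
      using c fin by (subst finsum_rdistr) auto
    also have "\<dots> = (c \<odot>\<^bsub>?S\<^esub> (f \<otimes>\<^bsub>?S\<^esub> g)) j"
      by (simp add: laurent_def)
    finally show "(c \<odot>\<^bsub>?S\<^esub> f \<otimes>\<^bsub>?S\<^esub> g) j = (c \<odot>\<^bsub>?S\<^esub> (f \<otimes>\<^bsub>?S\<^esub> g)) j" .
  qed
  have ldist: "(f \<oplus>\<^bsub>?S\<^esub> g) \<otimes>\<^bsub>?S\<^esub> h = f \<otimes>\<^bsub>?S\<^esub> h \<oplus>\<^bsub>?S\<^esub> g \<otimes>\<^bsub>?S\<^esub> h"
    if f: "f \<in> carrier ?S" and g: "g \<in> carrier ?S" and h: "h \<in> carrier ?S" for f g h
  proof
    fix j
    let ?F = "{i. f i \<noteq> \<zero>} \<union> {i. g i \<noteq> \<zero>}"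
    have fin: "finite ?F" using D(2)[OF f] D(2)[OF g] by simp
    note car[simp] = D(1)[OF f] D(1)[OF g] D(1)[OF h]
    have "((f \<oplus>\<^bsub>?S\<^esub> g) \<otimes>\<^bsub>?S\<^esub> h) j = (\<Oplus>i\<in>?F. (f \<oplus>\<^bsub>?S\<^esub> g) i \<otimes> h (j - i))"
      by (rule laurent_mult_eq[OF addc[OF f g] h fin]) (auto simp: laurent_def)
    also have "\<dots> = (\<Oplus>i\<in>?F. f i \<otimes> h (j - i) \<oplus> g i \<otimes> h (j - i))"
      by (intro finsum_cong') (auto simp: laurent_def l_distr)
    also have "\<dots> = (\<Oplus>i\<in>?F. f i \<otimes> h (j - i)) \<oplus> (\<Oplus>i\<in>?F. g i \<otimes> h (j - i))"
      by (rule finsum_addf) auto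
    also have "\<dots> = (f \<otimes>\<^bsub>?S\<^esub> h) j \<oplus> (g \<otimes>\<^bsub>?S\<^esub> h) j"
      using laurent_mult_eq[OF f h fin] laurent_mult_eq[OF g h fin] by auto
    finally show "((f \<oplus>\<^bsub>?S\<^esub> g) \<otimes>\<^bsub>?S\<^esub> h) j = (f \<otimes>\<^bsub>?S\<^esub> h \<oplus>\<^bsub>?S\<^esub> g \<otimes>\<^bsub>?S\<^esub> h) j"
      by (simp add: laurent_def)
  qed
  have neg: "\<exists>g\<in>carrier ?S. g \<oplus>\<^bsub>?S\<^esub> f = \<zero>\<^bsub>?S\<^esub>" if f: "f \<in> carrier ?S" for f
  proof (intro bexI)
    have "(\<ominus> f j \<noteq> \<zero>) = (f j \<noteq> \<zero>)" for j using D(1)[OF f] by (metis minus_minus minus_zero)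
    then show "(\<lambda>j. \<ominus> f j) \<in> carrier ?S" using D[OF f] by (auto simp: laurent_def)
    show "(\<lambda>j. \<ominus> f j) \<oplus>\<^bsub>?S\<^esub> f = \<zero>\<^bsub>?S\<^esub>"
      using D(1)[OF f] by (auto simp: laurent_def l_neg)
  qed
  have ab: "abelian_group ?S"
    using addc neg by (intro abelian_groupI) (auto simp: laurent_def a_ac)
  have cr: "cring ?S"
    using ab clo assoc one comm ldist monc[OF one_closed I0]
    by (intro cringI comm_monoidI) (auto simp: laurent_def)
  have alg: "algebra R ?S"
    using smc smassoc
    by (intro algebraI cr is_cring) (auto simp: laurent_def l_distr r_distr m_assoc)
  interpret S: algebra R ?S by (rule alg)
  have sumapp: "(\<Oplus>\<^bsub>?S\<^esub>d\<in>J. c d) j = (\<Oplus>d\<in>J. c d j)"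
    if "finite J" "\<And>d. d \<in> J \<Longrightarrow> c d \<in> carrier ?S" for J :: "int set" and c j
    using that
  proof (induction J)
    case empty then show ?case unfolding S.M.finsum_empty by (simp add: laurent_def)
  next
    case (insert x F)
    then have "c \<in> F \<rightarrow> carrier ?S" "c x \<in> carrier ?S" "(\<lambda>d. c d j) \<in> insert x F \<rightarrow> carrier R"
      using D(1) by auto
    with insert have "(\<Oplus>\<^bsub>?S\<^esub>d\<in>insert x F. c d) = c x \<oplus>\<^bsub>?S\<^esub> (\<Oplus>\<^bsub>?S\<^esub>d\<in>F. c d)"
      by (subst S.M.finsum_insert) auto
    then have "(\<Oplus>\<^bsub>?S\<^esub>d\<in>insert x F. c d) j = c x j \<oplus> (\<Oplus>\<^bsub>?S\<^esub>d\<in>F. c d) j"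
      by (simp add: laurent_def)
    also have "\<dots> = (\<Oplus>d\<in>insert x F. c d j)"
      using insert D(1) by (subst finsum_insert) auto
    finally show ?case .
  qed
  have gc: "f \<in> carrier ?S" if "f \<in> laurent_grade R I d" for f d
    using that by (simp add: laurent_grade_def)
  have zero_S: "\<zero>\<^bsub>?S\<^esub> = (\<lambda>_. \<zero>)" by (simp add: laurent_def)
  have comp_eq: "s j = c j j"
    if c: "\<And>d. c d \<in> laurent_grade R I d" and fin: "finite {d. c d \<noteq> \<zero>\<^bsub>?S\<^esub>}"
      and s: "s = (\<Oplus>\<^bsub>?S\<^esub>d\<in>{d. c d \<noteq> \<zero>\<^bsub>?S\<^esub>}. c d)" for c s j
  proof -
    have "s j = (\<Oplus>d\<in>{d. c d \<noteq> \<zero>\<^bsub>?S\<^esub>}. c d j)"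
      unfolding s by (rule sumapp[OF fin gc[OF c]])
    also have "\<dots> = (\<Oplus>d\<in>{d. c d \<noteq> \<zero>\<^bsub>?S\<^esub>}. if j = d then c d d else \<zero>)"
      using c D(1)[OF gc[OF c]] by (intro finsum_cong') (auto simp: laurent_grade_def)
    also have "\<dots> = c j j"
    proof (cases "c j = \<zero>\<^bsub>?S\<^esub>")
      case True
      then have "(\<Oplus>d\<in>{d. c d \<noteq> \<zero>\<^bsub>?S\<^esub>}. if j = d then c d d else \<zero>) = \<zero>"
        by (intro add.finprod_one_eqI) auto
      then show ?thesis using True by (simp add: zero_S)
    next
      case False
      then show ?thesis using fin D(1)[OF gc[OF c]] by (subst finsum_singleton) auto
    qed
    finally show ?thesis .
  qed
  show ?thesis
  proof (intro graded_algebra.intro[OF alg] graded_algebra_axioms.intro)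
    fix i j :: int
    have app: "(a \<oplus>\<^bsub>?S\<^esub> b) k = a k \<oplus> b k" "(c \<odot>\<^bsub>?S\<^esub> a) k = c \<otimes> a k"
      "\<one>\<^bsub>?S\<^esub> k = (if k = 0 then \<one> else \<zero>)" for a b c k
      by (simp_all add: laurent_def mon_def)
    have gz: "a k = \<zero>" if "a \<in> laurent_grade R I d" "k \<noteq> d" for a d k
      using that by (simp add: laurent_grade_def)
    have gI: "a \<in> laurent_grade R I d" if "a \<in> carrier ?S" "\<And>k. k \<noteq> d \<Longrightarrow> a k = \<zero>" for a d
      using that by (simp add: laurent_grade_def)
    show "submodule (laurent_grade R I d) R ?S" for d
    proof (rule S.submoduleI)
      show "laurent_grade R I d \<subseteq> carrier ?S" using gc by blast
      show "\<zero>\<^bsub>?S\<^esub> \<in> laurent_grade R I d" by (rule gI[OF S.M.zero_closed]) (simp add: zero_S)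
    next
      fix a assume a: "a \<in> laurent_grade R I d"
      have ia: "\<ominus>\<^bsub>?S\<^esub> a \<in> carrier ?S" and "a \<oplus>\<^bsub>?S\<^esub> \<ominus>\<^bsub>?S\<^esub> a = \<zero>\<^bsub>?S\<^esub>"
        using gc[OF a] S.M.r_neg by auto
      then have "(a \<oplus>\<^bsub>?S\<^esub> \<ominus>\<^bsub>?S\<^esub> a) k = \<zero>\<^bsub>?S\<^esub> k" for k by simp
      then have z: "a k \<oplus> (\<ominus>\<^bsub>?S\<^esub> a) k = \<zero>" for k unfolding app zero_S .
      show "\<ominus>\<^bsub>?S\<^esub> a \<in> laurent_grade R I d"
      proof (rule gI[OF ia])
        fix k assume "k \<noteq> d"
        then have "\<zero> \<oplus> (\<ominus>\<^bsub>?S\<^esub> a) k = \<zero>" using z[of k] gz[OF a] by simp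
        then show "(\<ominus>\<^bsub>?S\<^esub> a) k = \<zero>" using D(1)[OF ia] by (simp only: l_zero)
      qed
    next
      fix c a assume c: "c \<in> carrier R" and a: "a \<in> laurent_grade R I d"
      show "c \<odot>\<^bsub>?S\<^esub> a \<in> laurent_grade R I d"
        by (rule gI[OF smc[OF c gc[OF a]]]) (simp add: app gz[OF a] c)
    next
      fix a b assume a: "a \<in> laurent_grade R I d" and b: "b \<in> laurent_grade R I d"
      show "a \<oplus>\<^bsub>?S\<^esub> b \<in> laurent_grade R I d"
        by (rule gI[OF addc[OF gc[OF a] gc[OF b]]]) (simp add: app gz[OF a] gz[OF b])
    qed
    show "\<one>\<^bsub>?S\<^esub> \<in> laurent_grade R I 0"
      by (rule gI) (simp_all add: app)
    show "a \<otimes>\<^bsub>?S\<^esub> b \<in> laurent_grade R I (i + j)"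
      if a: "a \<in> laurent_grade R I i" and b: "b \<in> laurent_grade R I j" for a b
    proof -
      have "(a \<otimes>\<^bsub>?S\<^esub> b) k = \<zero>" if "k \<noteq> i + j" for k
      proof -
        have "(a \<otimes>\<^bsub>?S\<^esub> b) k = (\<Oplus>m\<in>{i}. a m \<otimes> b (k - m))"
          using a by (intro laurent_mult_eq[OF gc[OF a] gc[OF b]]) (auto simp: laurent_grade_def)
        also have "\<dots> = \<zero>"
          using that b D(1)[OF gc[OF a]] by (simp add: laurent_grade_def)
        finally show ?thesis .
      qed
      then show ?thesis using clo[OF gc[OF a] gc[OF b]] by (simp add: laurent_grade_def)
    qed
    fix s assume s: "s \<in> carrier ?S"
    define c where "c d = mon R (s d) d" for d
    have cg: "c d \<in> laurent_grade R I d" for d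
    proof (cases "d \<in> I")
      case True
      then show ?thesis using monc[OF D(1)[OF s]] by (simp add: laurent_grade_def c_def mon_def)
    next
      case False
      then have "c d = \<zero>\<^bsub>?S\<^esub>" using D(3)[OF s] by (auto simp: c_def mon_def zero_S)
      then show ?thesis using S.M.zero_closed by (simp add: laurent_grade_def zero_S)
    qed
    have cz: "{d. c d \<noteq> \<zero>\<^bsub>?S\<^esub>} = {d. s d \<noteq> \<zero>}"
      by (auto simp: c_def mon_def zero_S fun_eq_iff)
    show "\<exists>!c. (\<forall>d. c d \<in> laurent_grade R I d) \<and> finite {d. c d \<noteq> \<zero>\<^bsub>?S\<^esub>} \<and>
           s = (\<Oplus>\<^bsub>?S\<^esub>d\<in>{d. c d \<noteq> \<zero>\<^bsub>?S\<^esub>}. c d)"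
    proof (intro ex1I[of _ c] conjI allI)
      show "finite {d. c d \<noteq> \<zero>\<^bsub>?S\<^esub>}" using cz D(2)[OF s] by simp
      then have "(\<Oplus>\<^bsub>?S\<^esub>d\<in>{d. c d \<noteq> \<zero>\<^bsub>?S\<^esub>}. c d) j = c j j" for j
        by (rule comp_eq[OF cg _ refl])
      then show "s = (\<Oplus>\<^bsub>?S\<^esub>d\<in>{d. c d \<noteq> \<zero>\<^bsub>?S\<^esub>}. c d)"
        by (intro ext) (simp only: c_def mon_def if_True simp_thms)
      fix c' assume c': "(\<forall>d. c' d \<in> laurent_grade R I d) \<and> finite {d. c' d \<noteq> \<zero>\<^bsub>?S\<^esub>} \<and>
           s = (\<Oplus>\<^bsub>?S\<^esub>d\<in>{d. c' d \<noteq> \<zero>\<^bsub>?S\<^esub>}. c' d)"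
      then have c'g: "c' d \<in> laurent_grade R I d" for d by blast
      have "s d = c' d d" for d by (rule comp_eq[OF c'g]) (use c' in blast)+
      then have "c' d i = c d i" for d i using gz[OF c'g] by (simp add: c_def mon_def)
      then show "c' = c" by (intro ext)
    qed (rule cg)
  qed
qed

end

abbreviation laurent_q_diff_ops :: "('r, 'm) ring_scheme \<Rightarrow> int set \<Rightarrow> 'r
    \<Rightarrow> ('r, (int \<Rightarrow> 'r) \<Rightarrow> int \<Rightarrow> 'r) module"
  where "laurent_q_diff_ops R I q \<equiv> q_diff_ops R (laurent R I) (laurent_grade R I) q"


section \<open>The rings \<open>\<A>\<close> and \<open>\<A>/(q-1)\<^sup>n\<close>\<close>

definition rat_laurent :: "'k::field_char_0 \<Rightarrow> 'k set"
  where "rat_laurent q = {poly p q / q ^ m | p m. \<forall>i. coeff p i \<in> \<rat>}"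

definition loc_ring :: "'k::field_char_0 \<Rightarrow> 'k ring"
  where "loc_ring q = field_ring\<lparr>carrier :=
    {a / b | a b. a \<in> rat_laurent q \<and> b \<in> rat_laurent q \<and> b \<notin> {(q - 1) * c | c. c \<in> rat_laurent q}}\<rparr>"

definition loc_ideal :: "'k::field_char_0 \<Rightarrow> nat \<Rightarrow> 'k set"
  where "loc_ideal q n = PIdl\<^bsub>loc_ring q\<^esub> ((q - 1) ^ n)"

definition loc_quot :: "'k::field_char_0 \<Rightarrow> nat \<Rightarrow> 'k set ring"
  where "loc_quot q n = loc_ring q Quot loc_ideal q n"

definition q_mod :: "'k::field_char_0 \<Rightarrow> nat \<Rightarrow> 'k set"
  where "q_mod q n = loc_ideal q n +>\<^bsub>loc_ring q\<^esub> q"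

lemma sum_in_Rats: "(\<And>i. i \<in> A \<Longrightarrow> f i \<in> \<rat>) \<Longrightarrow> sum f A \<in> \<rat>"
  by (induction A rule: infinite_finite_induct) auto

lemma rat_laurent_closed:
  assumes "a \<in> rat_laurent q" "b \<in> rat_laurent q" and q: "q \<noteq> 0"
  shows "a + b \<in> rat_laurent q" "a * b \<in> rat_laurent q" "- a \<in> rat_laurent q"
proof -
  obtain p m where a: "a = poly p q / q ^ m" "\<forall>i. coeff p i \<in> \<rat>"
    using assms by (auto simp: rat_laurent_def)
  obtain r l where b: "b = poly r q / q ^ l" "\<forall>i. coeff r i \<in> \<rat>"
    using assms by (auto simp: rat_laurent_def)
  have "a + b = poly (monom 1 l * p + monom 1 m * r) q / q ^ (m + l)"
    unfolding a(1) b(1) using q by (simp add: poly_monom field_simps power_add)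
  moreover have "\<forall>i. coeff (monom 1 l * p + monom 1 m * r) i \<in> \<rat>"
    using a b by (simp add: coeff_monom_mult)
  ultimately show "a + b \<in> rat_laurent q" unfolding rat_laurent_def by blast
  have "a * b = poly (p * r) q / q ^ (m + l)"
    using a b by (simp add: power_add)
  moreover have "\<forall>i. coeff (p * r) i \<in> \<rat>"
    using a b by (auto simp: coeff_mult intro!: sum_in_Rats)
  ultimately show "a * b \<in> rat_laurent q" unfolding rat_laurent_def by blast
  have "- a = poly (- p) q / q ^ m" "\<forall>i. coeff (- p) i \<in> \<rat>" using a by auto
  then show "- a \<in> rat_laurent q" unfolding rat_laurent_def by blast
qed

lemma transcendental_poly_zero:
  fixes q :: "'k::field_char_0"
  assumes "\<not> algebraic q" "\<forall>i. coeff p i \<in> \<rat>" "poly p q = 0" shows "p = 0"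
  using assms by (auto simp: algebraic_altdef)

lemma in_ideal_iff:
  fixes q :: "'k::field_char_0"
  assumes q: "\<not> algebraic q" and p: "\<forall>i. coeff p i \<in> \<rat>"
  shows "poly p q / q ^ m \<in> {(q - 1) * c | c. c \<in> rat_laurent q} \<longleftrightarrow> poly p 1 = 0"
proof
  have q0: "q \<noteq> 0" using q by auto
  assume "poly p q / q ^ m \<in> {(q - 1) * c | c. c \<in> rat_laurent q}"
  then obtain r l where r: "poly p q / q ^ m = (q - 1) * (poly r q / q ^ l)" "\<forall>i. coeff r i \<in> \<rat>"
    by (auto simp: rat_laurent_def)
  let ?s = "monom 1 l * p - monom 1 m * ([:-1, 1:] * r)"
  have "poly ?s q = 0" using r(1) q0 by (simp add: poly_monom field_simps)
  moreover have "\<forall>i. coeff ?s i \<in> \<rat>"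
    using p r(2) by (auto simp: coeff_pCons coeff_monom_mult split: nat.split)
  ultimately have "?s = 0" using q transcendental_poly_zero by blast
  then have "poly ?s 1 = 0" by simp
  then show "poly p 1 = 0" by (simp add: poly_monom)
next
  assume "poly p 1 = 0"
  have "\<forall>i. coeff (synthetic_div p 1) i \<in> \<rat>"
  proof -
    have "(\<forall>i. coeff p i \<in> \<rat>) \<Longrightarrow> (\<forall>i. coeff (synthetic_div p 1) i \<in> \<rat>) \<and> poly p 1 \<in> \<rat>" for p :: "'k poly"
    proof (induction p)
      case (pCons a p)
      have "a \<in> \<rat>" using pCons.prems by (metis coeff_pCons_0)
      moreover have "\<forall>i. coeff p i \<in> \<rat>" using pCons.prems by (metis coeff_pCons_Suc)
      ultimately show ?case using pCons.IH by (auto simp: coeff_pCons split: nat.split)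
    qed simp
    then show ?thesis using p by blast
  qed
  moreover have "poly p q = (q - 1) * poly (synthetic_div p 1) q"
    using synthetic_div_correct'[of 1 p] \<open>poly p 1 = 0\<close>
    by (metis (no_types, lifting) add.right_neutral poly_mult pCons_0_0 poly_pCons poly_0 mult_zero_right mult.right_neutral add.commute diff_conv_add_uminus)
  ultimately show "poly p q / q ^ m \<in> {(q - 1) * c | c. c \<in> rat_laurent q}"
    unfolding rat_laurent_def by (auto intro!: exI[of _ "poly (synthetic_div p 1) q / q ^ m"])
qed

lemma loc_ring_cring:
  fixes q :: "'k::field_char_0"
  assumes q: "\<not> algebraic q"
  shows "cring (loc_ring q)"
proof -
  let ?L = "rat_laurent q" and ?P = "{(q - 1) * c | c. c \<in> rat_laurent q}"
  have q0: "q \<noteq> 0" using q by auto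
  note cl = rat_laurent_closed[OF _ _ q0]
  have cst: "c \<in> ?L" if "c \<in> \<rat>" for c
  proof -
    have "c = poly [:c:] q / q ^ 0" "\<forall>i. coeff [:c:] i \<in> \<rat>"
      using that by (auto simp: coeff_pCons split: nat.split)
    then show ?thesis unfolding rat_laurent_def by blast
  qed
  have prime: "b * d \<in> ?L - ?P" if bL: "b \<in> ?L - ?P" and dL: "d \<in> ?L - ?P" for b d
  proof -
    obtain p m where b: "b = poly p q / q ^ m" "\<forall>i. coeff p i \<in> \<rat>"
      using bL unfolding rat_laurent_def by blast
    obtain r l where d: "d = poly r q / q ^ l" "\<forall>i. coeff r i \<in> \<rat>"
      using dL unfolding rat_laurent_def by blast
    have "poly p 1 \<noteq> 0" "poly r 1 \<noteq> 0"
      using in_ideal_iff[OF q b(2)] in_ideal_iff[OF q d(2)] bL dL b(1) d(1) by blast+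
    then have nz: "poly (p * r) 1 \<noteq> 0" by simp
    have eq: "b * d = poly (p * r) q / q ^ (m + l)" using b(1) d(1) by (simp add: power_add)
    have rat: "\<forall>i. coeff (p * r) i \<in> \<rat>" using b(2) d(2) by (auto simp: coeff_mult intro!: sum_in_Rats)
    have "b * d \<notin> ?P" unfolding eq in_ideal_iff[OF q rat] by (rule nz)
    moreover have "b * d \<in> ?L" using bL dL by (intro cl(2)) simp_all
    ultimately show ?thesis by (rule DiffI[rotated])
  qed
  have one: "1 \<in> ?L - ?P"
  proof
    show "1 \<in> ?L" by (rule cst) simp
    have rat: "\<forall>i. coeff (1 :: 'k poly) i \<in> \<rat>"
      by (simp add: one_pCons coeff_pCons split: nat.split)
    have "poly (1 :: 'k poly) q / q ^ 0 \<notin> ?P" unfolding in_ideal_iff[OF q rat] by simp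
    then show "1 \<notin> ?P" by (simp only: poly_1 power_0 div_by_1) simp
  qed
  have nz: "b \<noteq> 0" if b: "b \<in> ?L - ?P" for b
  proof
    assume "b = (0::'k)"
    then have "b = (q - 1) * 0" by simp
    moreover have "0 \<in> ?L" by (rule cst) simp
    ultimately show False using b by blast
  qed
  have carr: "carrier (loc_ring q) = {a / b | a b. a \<in> ?L \<and> b \<in> ?L - ?P}"
    by (auto simp: loc_ring_def)
  have memI: "x \<in> carrier (loc_ring q)" if "x = a / b" "a \<in> ?L" "b \<in> ?L - ?P" for x a b
    unfolding carr using that by blast
  interpret F: cring "field_ring :: 'k ring" by (rule field_ring_cring)
  have ops: "x \<oplus>\<^bsub>field_ring\<^esub> y = x + y" "x \<otimes>\<^bsub>field_ring\<^esub> y = x * y" "\<one>\<^bsub>field_ring\<^esub> = (1::'k)"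
    for x y :: 'k by (simp_all add: field_ring_def)
  have "subring (carrier (loc_ring q)) (field_ring :: 'k ring)"
  proof (rule F.subringI)
    show "carrier (loc_ring q) \<subseteq> carrier field_ring" by (simp add: field_ring_def)
    show "\<one>\<^bsub>field_ring\<^esub> \<in> carrier (loc_ring q)"
      unfolding ops by (rule memI[OF _ _ one]) (use one in auto)
    fix h1 h2 :: 'k assume "h1 \<in> carrier (loc_ring q)"
    then obtain a b where h1: "h1 = a / b" "a \<in> ?L" "b \<in> ?L - ?P" by (auto simp: carr)
    have "\<ominus>\<^bsub>field_ring\<^esub> h1 = - h1"
      by (rule F.minus_equality) (auto simp: field_ring_def)
    then show "\<ominus>\<^bsub>field_ring\<^esub> h1 \<in> carrier (loc_ring q)"
      using memI[OF _ cl(3)[OF h1(2) h1(2)] h1(3)] h1(1) by simp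
    assume "h2 \<in> carrier (loc_ring q)"
    then obtain c d where h2: "h2 = c / d" "c \<in> ?L" "d \<in> ?L - ?P" by (auto simp: carr)
    show "h1 \<otimes>\<^bsub>field_ring\<^esub> h2 \<in> carrier (loc_ring q)"
      unfolding ops by (rule memI[OF _ cl(2)[OF h1(2) h2(2)] prime[OF h1(3) h2(3)]]) (simp add: h1(1) h2(1))
    have eq: "h1 + h2 = (a * d + c * b) / (b * d)"
      using nz[OF h1(3)] nz[OF h2(3)] by (simp add: h1(1) h2(1) field_simps)
    have "a * d + c * b \<in> ?L" using h1(2,3) h2(2,3) by (intro cl(1,2)) simp_all
    then show "h1 \<oplus>\<^bsub>field_ring\<^esub> h2 \<in> carrier (loc_ring q)"
      unfolding ops by (rule memI[OF eq _ prime[OF h1(3) h2(3)]])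
  qed
  then have "subcring (carrier (loc_ring q)) (field_ring :: 'k ring)"
    by (rule F.subcringI')
  then have "cring (field_ring\<lparr>carrier := carrier (loc_ring q)\<rparr>)"
    using F.subcring_iff F.ring_axioms by (simp add: field_ring_def)
  then show ?thesis by (simp add: loc_ring_def)
qed

lemma loc_quot_cring:
  fixes q :: "'k::field_char_0"
  assumes q: "\<not> algebraic q"
  shows "cring (loc_quot q n)"
proof -
  interpret A: cring "loc_ring q" by (rule loc_ring_cring[OF q])
  have q0: "q \<noteq> 0" using q by auto
  have "\<forall>i. coeff [:-1, 1::'k:] i \<in> \<rat>" "\<forall>i. coeff (1::'k poly) i \<in> \<rat>"
    by (auto simp: coeff_pCons one_pCons split: nat.split)
  then have "poly [:-1, 1:] q / q ^ 0 \<in> rat_laurent q" "poly 1 q / q ^ 0 \<in> rat_laurent q"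
    unfolding rat_laurent_def by blast+
  then have L: "q - 1 \<in> rat_laurent q" "1 \<in> rat_laurent q" by simp_all
  have "(q - 1) ^ n \<in> rat_laurent q"
    by (induction n) (auto simp: L intro!: rat_laurent_closed(2)[OF _ _ q0])
  moreover have "poly (1::'k poly) q / q ^ 0 \<notin> {(q - 1) * c | c. c \<in> rat_laurent q}"
    unfolding in_ideal_iff[OF q \<open>\<forall>i. coeff (1::'k poly) i \<in> \<rat>\<close>] by simp
  then have "(1::'k) \<notin> {(q - 1) * c | c. c \<in> rat_laurent q}" by (simp only: poly_1 power_0 div_by_1) simp
  moreover have "(q - 1) ^ n = (q - 1) ^ n / 1" by simp
  moreover have "carrier (loc_ring q) = {a / b | a b. a \<in> rat_laurent q \<and> b \<in> rat_laurent q \<and>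
      b \<notin> {(q - 1) * c | c. c \<in> rat_laurent q}}"
    by (simp add: loc_ring_def)
  ultimately have "(q - 1) ^ n \<in> carrier (loc_ring q)"
    using L(2) by blast
  then have "ideal (loc_ideal q n) (loc_ring q)"
    unfolding loc_ideal_def by (rule A.cgenideal_ideal)
  then show ?thesis
    unfolding loc_quot_def by (rule ideal.quotient_is_cring) (rule A.cring_axioms)
qed


section \<open>Operators over \<open>\<A>/(q-1)\<^sup>n\<close> and the inverse limit of the \<open>\<Gamma>\<^sub>q\<^sub>,\<^sub>n\<close>\<close>

abbreviation D_n :: "'k::field_char_0 \<Rightarrow> nat \<Rightarrow> int set
    \<Rightarrow> ('k set, (int \<Rightarrow> 'k set) \<Rightarrow> int \<Rightarrow> 'k set) module"
  where "D_n q n I \<equiv> laurent_q_diff_ops (loc_quot q n) I (q_mod q n)"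

text \<open>The canonical extension of an operator to \<open>B\<^sub>n[x,x\<inverse>]\<close> is the unique \<open>q\<close>-differential operator
  there that restricts to it.\<close>

definition extend_op :: "'k::field_char_0 \<Rightarrow> nat \<Rightarrow> int set
    \<Rightarrow> ((int \<Rightarrow> 'k set) \<Rightarrow> int \<Rightarrow> 'k set) \<Rightarrow> (int \<Rightarrow> 'k set) \<Rightarrow> int \<Rightarrow> 'k set"
  where "extend_op q n I \<phi> = (THE \<psi>. \<psi> \<in> carrier (D_n q n UNIV) \<and>
    (\<forall>f\<in>carrier (laurent (loc_quot q n) I). \<psi> f = \<phi> f))"

definition Gamma_n :: "'k::field_char_0 \<Rightarrow> nat
    \<Rightarrow> (((int \<Rightarrow> 'k set) \<Rightarrow> int \<Rightarrow> 'k set) \<times> ((int \<Rightarrow> 'k set) \<Rightarrow> int \<Rightarrow> 'k set)) set"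
  where "Gamma_n q n = a_kernel (RDirProd (D_n q n {0..}) (D_n q n {..0})) (D_n q n UNIV)
    (\<lambda>(\<phi>\<^sub>1, \<phi>\<^sub>2). extend_op q n {0..} \<phi>\<^sub>1 \<ominus>\<^bsub>D_n q n UNIV\<^esub> extend_op q n {..0} \<phi>\<^sub>2)"

text \<open>The residue map \<open>\<A>/(q-1)\<^sup>n\<^sup>+\<^sup>1 \<rightarrow> \<A>/(q-1)\<^sup>n\<close> sends a coset \<open>X\<close> to \<open>(q-1)\<^sup>n\<A> + X\<close>; the map
  on polynomials applies it to every coefficient.\<close>

definition red_poly :: "'k::field_char_0 \<Rightarrow> nat \<Rightarrow> (int \<Rightarrow> 'k set) \<Rightarrow> int \<Rightarrow> 'k set"
  where "red_poly q n f = (\<lambda>j. set_add (loc_ring q) (loc_ideal q n) (f j))"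

definition red_op :: "'k::field_char_0 \<Rightarrow> nat \<Rightarrow> int set
    \<Rightarrow> ((int \<Rightarrow> 'k set) \<Rightarrow> int \<Rightarrow> 'k set) \<Rightarrow> (int \<Rightarrow> 'k set) \<Rightarrow> int \<Rightarrow> 'k set"
  where "red_op q n I \<phi> = (\<lambda>g\<in>carrier (laurent (loc_quot q n) I).
    descend (red_poly q n) (carrier (laurent (loc_quot q (Suc n)) I)) (\<lambda>f. red_poly q n (\<phi> f)) g)"

definition Gamma_hat :: "'k::field_char_0
    \<Rightarrow> (nat \<Rightarrow> ((int \<Rightarrow> 'k set) \<Rightarrow> int \<Rightarrow> 'k set) \<times> ((int \<Rightarrow> 'k set) \<Rightarrow> int \<Rightarrow> 'k set)) set"
  where "Gamma_hat q = inv_lim (Gamma_n q) (\<lambda>n (\<phi>\<^sub>1, \<phi>\<^sub>2). (red_op q n {0..} \<phi>\<^sub>1, red_op q n {..0} \<phi>\<^sub>2))"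


section \<open>The algebra \<open>U\<^sub>q\<close>\<close>

datatype gen = Gen_E | Gen_F | Gen_K | Gen_Kinv

text \<open>The free \<open>k\<close>-algebra on \<open>gen\<close>: finitely supported coefficient functions on words.\<close>

definition free_alg :: "(gen list \<Rightarrow> 'k::field) ring"
  where "free_alg = \<lparr>
    carrier = {f. finite {w. f w \<noteq> 0}},
    monoid.mult = (\<lambda>f g w. \<Sum>i\<le>length w. f (take i w) * g (drop i w)),
    one = (\<lambda>w. if w = [] then 1 else 0),
    zero = (\<lambda>_. 0),
    add = (\<lambda>f g w. f w + g w)\<rparr>"

lemma free_alg_ring: "ring (free_alg :: (gen list \<Rightarrow> 'k::field) ring)"
proof -
  let ?R = "free_alg :: (gen list \<Rightarrow> 'k) ring"
  have mult_closed: "(\<lambda>w. \<Sum>i\<le>length w. f (take i w) * g (drop i w)) \<in> carrier ?R"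
    if "f \<in> carrier ?R" "g \<in> carrier ?R" for f g
  proof -
    have fin: "finite ((\<lambda>(u, v). u @ v) ` ({w. f w \<noteq> 0} \<times> {w. g w \<noteq> 0}))"
      using that by (simp add: free_alg_def)
    have "{w. (\<Sum>i\<le>length w. f (take i w) * g (drop i w)) \<noteq> 0}
        \<subseteq> (\<lambda>(u, v). u @ v) ` ({w. f w \<noteq> 0} \<times> {w. g w \<noteq> 0})"
    proof
      fix w assume "w \<in> {w. (\<Sum>i\<le>length w. f (take i w) * g (drop i w)) \<noteq> 0}"
      then obtain i where "f (take i w) * g (drop i w) \<noteq> 0"
        by (metis (mono_tags, lifting) mem_Collect_eq sum.neutral)
      then show "w \<in> (\<lambda>(u, v). u @ v) ` ({w. f w \<noteq> 0} \<times> {w. g w \<noteq> 0})"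
        by (intro image_eqI[of _ _ "(take i w, drop i w)"]) auto
    qed
    then show ?thesis using fin finite_subset by (auto simp: free_alg_def)
  qed
  have assoc: "(\<Sum>i\<le>length w. (\<Sum>j\<le>length (take i w). f (take j (take i w)) * g (drop j (take i w))) * h (drop i w))
      = (\<Sum>i\<le>length w. f (take i w) * (\<Sum>j\<le>length (drop i w). g (take j (drop i w)) * h (drop j (drop i w))))"
    for f g h :: "gen list \<Rightarrow> 'k" and w
  proof -
    have "(\<Sum>i\<le>length w. (\<Sum>j\<le>length (take i w). f (take j (take i w)) * g (drop j (take i w))) * h (drop i w))
      = (\<Sum>(i,j)\<in>(SIGMA i:{..length w}. {..i}). f (take j w) * g (drop j (take i w)) * h (drop i w))"
      by (subst sum.Sigma[symmetric]) (auto simp: sum_distrib_right min_def intro!: sum.cong)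
    also have "\<dots> = (\<Sum>(i,j)\<in>(SIGMA i:{..length w}. {..length w - i}). f (take i w) * (g (take j (drop i w)) * h (drop j (drop i w))))"
      by (rule sum.reindex_bij_witness[of _ "\<lambda>(i,j). (i + j, i)" "\<lambda>(i,j). (j, i - j)"])
         (auto simp: take_drop mult.assoc)
    also have "\<dots> = (\<Sum>i\<le>length w. f (take i w) * (\<Sum>j\<le>length (drop i w). g (take j (drop i w)) * h (drop j (drop i w))))"
      by (subst sum.Sigma[symmetric]) (auto simp: sum_distrib_left intro!: sum.cong)
    finally show ?thesis .
  qed
  have neg: "\<exists>y\<in>carrier ?R. y \<oplus>\<^bsub>?R\<^esub> f = \<zero>\<^bsub>?R\<^esub>" if "f \<in> carrier ?R" for f
    using that by (intro bexI[of _ "\<lambda>w. - f w"]) (auto simp: free_alg_def)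
  have addc: "(\<lambda>w. f w + g w) \<in> carrier ?R" if "f \<in> carrier ?R" "g \<in> carrier ?R" for f g
  proof -
    have "{w. f w + g w \<noteq> 0} \<subseteq> {w. f w \<noteq> 0} \<union> {w. g w \<noteq> 0}" by auto
    with that show ?thesis by (auto simp: free_alg_def intro: finite_subset)
  qed
  show ?thesis
  proof (intro ringI abelian_groupI monoidI)
    fix f g h :: "gen list \<Rightarrow> 'k"
    show "\<exists>y\<in>carrier ?R. y \<oplus>\<^bsub>?R\<^esub> f = \<zero>\<^bsub>?R\<^esub>" if "f \<in> carrier ?R" using neg that .
    show "f \<oplus>\<^bsub>?R\<^esub> g \<in> carrier ?R" if "f \<in> carrier ?R" "g \<in> carrier ?R"
      using addc[OF that] by (simp add: free_alg_def)
    show "f \<otimes>\<^bsub>?R\<^esub> g \<in> carrier ?R" if "f \<in> carrier ?R" "g \<in> carrier ?R"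
      using mult_closed[OF that] by (simp add: free_alg_def)
    show "f \<otimes>\<^bsub>?R\<^esub> g \<otimes>\<^bsub>?R\<^esub> h = f \<otimes>\<^bsub>?R\<^esub> (g \<otimes>\<^bsub>?R\<^esub> h)"
      using assoc[where f=f and g=g and h=h] by (simp add: free_alg_def fun_eq_iff)
    show "\<one>\<^bsub>?R\<^esub> \<otimes>\<^bsub>?R\<^esub> f = f"
    proof
      fix w
      have "(\<Sum>i\<le>length w. (if take i w = [] then 1 else 0) * f (drop i w)) = (\<Sum>i\<in>{0}. f (drop i w))"
        by (rule sum.mono_neutral_cong_right) auto
      then show "(\<one>\<^bsub>?R\<^esub> \<otimes>\<^bsub>?R\<^esub> f) w = f w" by (simp add: free_alg_def)
    qed
    show "f \<otimes>\<^bsub>?R\<^esub> \<one>\<^bsub>?R\<^esub> = f"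
    proof
      fix w
      have "(\<Sum>i\<le>length w. f (take i w) * (if drop i w = [] then 1 else 0)) = (\<Sum>i\<in>{length w}. f (take i w))"
        by (rule sum.mono_neutral_cong_right) auto
      then show "(f \<otimes>\<^bsub>?R\<^esub> \<one>\<^bsub>?R\<^esub>) w = f w" by (simp add: free_alg_def)
    qed
  qed (auto simp: free_alg_def fun_eq_iff algebra_simps sum.distrib)
qed

definition fscal :: "'k::field \<Rightarrow> gen list \<Rightarrow> 'k"
  where "fscal c = (\<lambda>w. if w = [] then c else 0)"

definition fgen :: "gen \<Rightarrow> gen list \<Rightarrow> 'k::field"
  where "fgen g = (\<lambda>w. if w = [g] then 1 else 0)"

definition Uq_rels :: "'k::field \<Rightarrow> (gen list \<Rightarrow> 'k) set"
  where "Uq_rels q =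
    (let E = fgen Gen_E; F = fgen Gen_F; K = fgen Gen_K; Ki = fgen Gen_Kinv in
     {K \<otimes>\<^bsub>free_alg\<^esub> Ki \<ominus>\<^bsub>free_alg\<^esub> \<one>\<^bsub>free_alg\<^esub>,
      Ki \<otimes>\<^bsub>free_alg\<^esub> K \<ominus>\<^bsub>free_alg\<^esub> \<one>\<^bsub>free_alg\<^esub>,
      K \<otimes>\<^bsub>free_alg\<^esub> E \<otimes>\<^bsub>free_alg\<^esub> Ki \<ominus>\<^bsub>free_alg\<^esub> fscal (q ^ 2) \<otimes>\<^bsub>free_alg\<^esub> E,
      K \<otimes>\<^bsub>free_alg\<^esub> F \<otimes>\<^bsub>free_alg\<^esub> Ki \<ominus>\<^bsub>free_alg\<^esub> fscal (q powi (-2)) \<otimes>\<^bsub>free_alg\<^esub> F,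
      (E \<otimes>\<^bsub>free_alg\<^esub> F \<ominus>\<^bsub>free_alg\<^esub> F \<otimes>\<^bsub>free_alg\<^esub> E)
        \<ominus>\<^bsub>free_alg\<^esub> fscal (1 / (q - inverse q)) \<otimes>\<^bsub>free_alg\<^esub> (K \<ominus>\<^bsub>free_alg\<^esub> Ki)})"

definition Uq_ideal :: "'k::field \<Rightarrow> (gen list \<Rightarrow> 'k) set"
  where "Uq_ideal q = Idl\<^bsub>free_alg\<^esub> (Uq_rels q)"

definition Uq :: "'k::field \<Rightarrow> (gen list \<Rightarrow> 'k) set ring"
  where "Uq q = free_alg Quot Uq_ideal q"

definition Uq_proj :: "'k::field \<Rightarrow> (gen list \<Rightarrow> 'k) \<Rightarrow> (gen list \<Rightarrow> 'k) set"
  where "Uq_proj q f = Uq_ideal q +>\<^bsub>free_alg\<^esub> f"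

definition q_int :: "'k::field \<Rightarrow> nat \<Rightarrow> 'k"
  where "q_int q i = (q ^ i - inverse q ^ i) / (q - inverse q)"

definition q_fact :: "'k::field \<Rightarrow> nat \<Rightarrow> 'k"
  where "q_fact q m = (\<Prod>i=1..m. q_int q i)"

definition div_pow :: "'k::field \<Rightarrow> gen \<Rightarrow> nat \<Rightarrow> (gen list \<Rightarrow> 'k) set"
  where "div_pow q g m =
    Uq_proj q (fscal (1 / q_fact q m)) \<otimes>\<^bsub>Uq q\<^esub> (Uq_proj q (fgen g) [^]\<^bsub>Uq q\<^esub> m)"

text \<open>The \<open>\<A>\<close>-subalgebra generated by a set is the subring generated by that set and the scalars
  from \<open>\<A>\<close>.\<close>

definition UA :: "'k::field_char_0 \<Rightarrow> (gen list \<Rightarrow> 'k) set ring"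
  where "UA q = (Uq q)\<lparr>carrier := generate_ring (Uq q)
    (Uq_proj q ` fscal ` carrier (loc_ring q) \<union>
     {Uq_proj q (fgen Gen_K), Uq_proj q (fgen Gen_Kinv)} \<union>
     range (div_pow q Gen_E) \<union> range (div_pow q Gen_F))\<rparr>"

text \<open>As \<open>(q-1)\<^sup>n\<close> is a central scalar, its left multiples form the two-sided ideal
  \<open>(q-1)\<^sup>n U\<close>.\<close>

definition U_ideal :: "'k::field_char_0 \<Rightarrow> nat \<Rightarrow> (gen list \<Rightarrow> 'k) set set"
  where "U_ideal q n = PIdl\<^bsub>UA q\<^esub> (Uq_proj q (fscal ((q - 1) ^ n)))"

definition U_n :: "'k::field_char_0 \<Rightarrow> nat \<Rightarrow> (gen list \<Rightarrow> 'k) set set ring"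
  where "U_n q n = UA q Quot U_ideal q n"

definition U_hat :: "'k::field_char_0 \<Rightarrow> (nat \<Rightarrow> (gen list \<Rightarrow> 'k) set set) set"
  where "U_hat q = inv_lim (\<lambda>n. carrier (U_n q n)) (\<lambda>n. set_add (UA q) (U_ideal q n))"


section \<open>The actions on \<open>k[x]\<close> and \<open>k[y]\<close>\<close>

abbreviation kx :: "('k::field, int \<Rightarrow> 'k) module"
  where "kx \<equiv> laurent field_ring {0..}"

abbreviation ky :: "('k::field, int \<Rightarrow> 'k) module"
  where "ky \<equiv> laurent field_ring {..0}"

abbreviation End_kx :: "('k::field, (int \<Rightarrow> 'k) \<Rightarrow> int \<Rightarrow> 'k) module"
  where "End_kx \<equiv> lin_end field_ring kx"

abbreviation End_ky :: "('k::field, (int \<Rightarrow> 'k) \<Rightarrow> int \<Rightarrow> 'k) module"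
  where "End_ky \<equiv> lin_end field_ring ky"

text \<open>The linear operator that sends \<open>x\<^sup>m\<close> to \<open>b m\<close>.\<close>

definition lin_ext :: "('k::field, int \<Rightarrow> 'k) module \<Rightarrow> (int \<Rightarrow> int \<Rightarrow> 'k) \<Rightarrow> (int \<Rightarrow> 'k) \<Rightarrow> int \<Rightarrow> 'k"
  where "lin_ext S b = (\<lambda>f\<in>carrier S. \<lambda>j. \<Sum>m\<in>{m. f m \<noteq> 0}. f m * b m j)"

definition ypow :: "'k::field \<Rightarrow> int \<Rightarrow> int \<Rightarrow> 'k"
  where "ypow c m = mon field_ring c (-m)"

definition sigma_x :: "'k::field \<Rightarrow> (int \<Rightarrow> 'k) \<Rightarrow> int \<Rightarrow> 'k"
  where "sigma_x q = lin_ext kx (\<lambda>m. mon field_ring (q powi m) m)"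

definition del_x :: "'k::field \<Rightarrow> (int \<Rightarrow> 'k) \<Rightarrow> int \<Rightarrow> 'k"
  where "del_x q = lin_ext kx
    (\<lambda>m. mon field_ring ((q powi (2 * m) - 1) / (q ^ 2 - 1)) (m - 1))"

text \<open>On \<open>k[y]\<close> the basis vector with index \<open>j \<le> 0\<close> is \<open>y\<^sup>m\<close> for \<open>m = -j\<close>.\<close>

definition sigma_y :: "'k::field \<Rightarrow> (int \<Rightarrow> 'k) \<Rightarrow> int \<Rightarrow> 'k"
  where "sigma_y q = lin_ext ky (\<lambda>j. let m = -j in ypow (q powi (-m)) m)"

definition del_y :: "'k::field \<Rightarrow> (int \<Rightarrow> 'k) \<Rightarrow> int \<Rightarrow> 'k"
  where "del_y q = lin_ext ky (\<lambda>j. let m = -j in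
    ypow ((1 - q powi (-2 * m)) / (1 - q powi (-2))) (m - 1))"

fun alpha_gen :: "'k::field \<Rightarrow> gen \<Rightarrow> (int \<Rightarrow> 'k) \<Rightarrow> int \<Rightarrow> 'k"
  where
    "alpha_gen q Gen_K = sigma_x q [^]\<^bsub>End_kx\<^esub> (2::int)"
  | "alpha_gen q Gen_Kinv = sigma_x q [^]\<^bsub>End_kx\<^esub> (-2::int)"
  | "alpha_gen q Gen_F = inverse q \<odot>\<^bsub>End_kx\<^esub> (sigma_x q [^]\<^bsub>End_kx\<^esub> (-2::int) \<otimes>\<^bsub>End_kx\<^esub> del_x q)"
  | "alpha_gen q Gen_E =
      (- (q ^ 2)) \<odot>\<^bsub>End_kx\<^esub> (mult_op kx (mon field_ring 1 2) \<otimes>\<^bsub>End_kx\<^esub> del_x q)"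

fun gamma_gen :: "'k::field \<Rightarrow> gen \<Rightarrow> (int \<Rightarrow> 'k) \<Rightarrow> int \<Rightarrow> 'k"
  where
    "gamma_gen q Gen_K = sigma_y q [^]\<^bsub>End_ky\<^esub> (2::int)"
  | "gamma_gen q Gen_Kinv = sigma_y q [^]\<^bsub>End_ky\<^esub> (-2::int)"
  | "gamma_gen q Gen_F = (- (q powi (-3))) \<odot>\<^bsub>End_ky\<^esub>
      (sigma_y q [^]\<^bsub>End_ky\<^esub> (-2::int) \<otimes>\<^bsub>End_ky\<^esub> mult_op ky (ypow 1 2) \<otimes>\<^bsub>End_ky\<^esub> del_y q)"
  | "gamma_gen q Gen_E = del_y q"

text \<open>The algebra homomorphism from the free algebra to \<open>M\<close> with prescribed values \<open>\<rho>\<close> on the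
  generators.\<close>

definition free_lift :: "('k::field, 'm) module \<Rightarrow> (gen \<Rightarrow> 'm) \<Rightarrow> (gen list \<Rightarrow> 'k) \<Rightarrow> 'm"
  where "free_lift M \<rho> f =
    (\<Oplus>\<^bsub>M\<^esub>w\<in>{w. f w \<noteq> 0}. f w \<odot>\<^bsub>M\<^esub> foldr (\<lambda>g u. \<rho> g \<otimes>\<^bsub>M\<^esub> u) w \<one>\<^bsub>M\<^esub>)"

definition alpha :: "'k::field \<Rightarrow> (gen list \<Rightarrow> 'k) set \<Rightarrow> (int \<Rightarrow> 'k) \<Rightarrow> int \<Rightarrow> 'k"
  where "alpha q = descend (Uq_proj q) (carrier free_alg) (free_lift End_kx (alpha_gen q))"

definition gamma :: "'k::field \<Rightarrow> (gen list \<Rightarrow> 'k) set \<Rightarrow> (int \<Rightarrow> 'k) \<Rightarrow> int \<Rightarrow> 'k"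
  where "gamma q = descend (Uq_proj q) (carrier free_alg) (free_lift End_ky (gamma_gen q))"


section \<open>The map to the inverse limit\<close>

definition poly_mod :: "'k::field_char_0 \<Rightarrow> nat \<Rightarrow> (int \<Rightarrow> 'k) \<Rightarrow> int \<Rightarrow> 'k set"
  where "poly_mod q n f = (\<lambda>j. loc_ideal q n +>\<^bsub>loc_ring q\<^esub> f j)"

text \<open>The reduction mod \<open>(q-1)\<^sup>n\<close> of an operator on \<open>k[x]\<close> (or \<open>k[y]\<close>) that preserves \<open>\<A>[x]\<close>
  (or \<open>\<A>[y]\<close>).\<close>

definition op_mod :: "'k::field_char_0 \<Rightarrow> nat \<Rightarrow> int set
    \<Rightarrow> ((int \<Rightarrow> 'k) \<Rightarrow> int \<Rightarrow> 'k) \<Rightarrow> (int \<Rightarrow> 'k set) \<Rightarrow> int \<Rightarrow> 'k set"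
  where "op_mod q n I \<phi> = (\<lambda>g\<in>carrier (laurent (loc_quot q n) I).
    descend (poly_mod q n) (carrier (laurent (loc_ring q) I)) (\<lambda>f. poly_mod q n (\<phi> f)) g)"

definition U_mod :: "'k::field_char_0 \<Rightarrow> nat \<Rightarrow> (gen list \<Rightarrow> 'k) set \<Rightarrow> (gen list \<Rightarrow> 'k) set set"
  where "U_mod q n u = U_ideal q n +>\<^bsub>UA q\<^esub> u"

definition alpha_n :: "'k::field_char_0 \<Rightarrow> nat \<Rightarrow> (gen list \<Rightarrow> 'k) set set
    \<Rightarrow> (int \<Rightarrow> 'k set) \<Rightarrow> int \<Rightarrow> 'k set"
  where "alpha_n q n = descend (U_mod q n) (carrier (UA q)) (\<lambda>u. op_mod q n {0..} (alpha q u))"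

definition gamma_n :: "'k::field_char_0 \<Rightarrow> nat \<Rightarrow> (gen list \<Rightarrow> 'k) set set
    \<Rightarrow> (int \<Rightarrow> 'k set) \<Rightarrow> int \<Rightarrow> 'k set"
  where "gamma_n q n = descend (U_mod q n) (carrier (UA q)) (\<lambda>u. op_mod q n {..0} (gamma q u))"

definition eta_n :: "'k::field_char_0 \<Rightarrow> nat \<Rightarrow> (gen list \<Rightarrow> 'k) set set
    \<Rightarrow> ((int \<Rightarrow> 'k set) \<Rightarrow> int \<Rightarrow> 'k set) \<times> ((int \<Rightarrow> 'k set) \<Rightarrow> int \<Rightarrow> 'k set)"
  where "eta_n q n u = (alpha_n q n u, gamma_n q n u)"

definition eta_hat :: "'k::field_char_0 \<Rightarrow> (nat \<Rightarrow> (gen list \<Rightarrow> 'k) set set)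
    \<Rightarrow> nat \<Rightarrow> ((int \<Rightarrow> 'k set) \<Rightarrow> int \<Rightarrow> 'k set) \<times> ((int \<Rightarrow> 'k set) \<Rightarrow> int \<Rightarrow> 'k set)"
  where "eta_hat q s = (\<lambda>n\<in>{1..}. eta_n q n (s n))"

end

theory Submission
  imports Defs
begin

text \<open>
  A linear operator on Laurent polynomials is described by its symbol, the family \<open>P\<close> with
  \<open>x\<^sup>m \<mapsto> \<Sum>d. P d m x\<^sup>m\<^sup>+\<^sup>d\<close>.  Modulo \<open>(q-1)\<^sup>n\<close> the element \<open>q - 1\<close> is nilpotent, so
  \<open>q\<^sup>a\<^sup>m\<close> is a polynomial function of \<open>m\<close>, and the twisted commutators detect the same operators as
  the ordinary ones: the \<open>q\<close>-differential operators are those whose symbol has finitely many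
  degrees \<open>d\<close> and is a polynomial function of \<open>m\<close> in each of them (\<open>q_diff_ops_carrier\<close>).  A
  polynomial function is determined by its values on a half-line.  Hence operators on \<open>B\<^sub>n[x]\<close> and
  on \<open>B\<^sub>n[x\<inverse>]\<close> have unique extensions to \<open>B\<^sub>n[x,x\<inverse>]\<close>, and the pairs in \<open>\<Gamma>\<^sub>q\<^sub>,\<^sub>n\<close> are the pairs with
  a common symbol, which has to respect both half-lines of exponents (\<open>Gamma_n_eq\<close>).

  The maps \<open>\<alpha>\<close> and \<open>\<gamma>\<close> are restrictions of one action on Laurent polynomials, in which every generator
  shifts the exponent and multiplies by an explicit coefficient.  So the relations have to be checked
  only once, and \<open>\<eta>\<^sub>n\<close> sends an element of the integral form to the reduction of its symbol
  (\<open>eta_n_U_mod\<close>).  These symbols are polynomial modulo every power of \<open>q - 1\<close>, because the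
  coefficients of the generators are.

  Surjectivity is lifted from \<open>q = 1\<close>, one power of \<open>q - 1\<close> at a time (\<open>lift_step\<close>).  If the image of
  \<open>u\<close> agrees with a given element of \<open>\<Gamma>\<^sub>q\<^sub>,\<^sub>n\<^sub>+\<^sub>1\<close> modulo \<open>(q-1)\<^sup>n\<close>, then the two symbols differ by
  \<open>(q-1)\<^sup>n r\<close>, where \<open>r\<close> has rational values, is polynomial and respects both half-lines: it is the
  symbol of a global differential operator on the projective line over the rational numbers.  In
  degree \<open>-e \<le> 0\<close> it vanishes at \<open>0, \<dots>, e - 1\<close>, so its Newton expansion involves only the binomial
  coefficients of \<open>m\<close> over \<open>i \<ge> e\<close>; at \<open>q = 1\<close> these are the symbols of \<open>F\<^sup>e\<close> times a polynomial in
  \<open>(EF - FE)/2\<close>.  Positive degrees are the mirror image with \<open>E\<close> in place of \<open>F\<close>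
  (\<open>rational_symbol_lift\<close>).  If \<open>w\<close> realizes \<open>r\<close>, then \<open>u + (q-1)\<^sup>n w\<close> has the right image
  modulo \<open>(q-1)\<^sup>n\<^sup>+\<^sup>1\<close> and is unchanged modulo \<open>(q-1)\<^sup>n\<close>, and these corrections make up a compatible
  sequence.
\<close>

section \<open>Polynomial functions on the integers\<close>

text \<open>Over a field of characteristic zero the vanishing of the \<open>k\<close>-th forward difference describes the
  polynomials of degree less than \<open>k\<close>.  In this form the notion makes sense over every ring and
  involves no denominators.\<close>

primrec poly_fun :: "('r, 'm) ring_scheme \<Rightarrow> nat \<Rightarrow> (int \<Rightarrow> 'r) \<Rightarrow> bool"
  where
    "poly_fun R 0 p \<longleftrightarrow> (\<forall>m. p m = \<zero>\<^bsub>R\<^esub>)"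
  | "poly_fun R (Suc k) p \<longleftrightarrow> poly_fun R k (\<lambda>m. p (m + 1) \<ominus>\<^bsub>R\<^esub> p m)"

context cring
begin

lemma poly_fun_zero: "poly_fun R k (\<lambda>_. \<zero>)"
  by (induction k) (simp_all add: minus_eq)

lemma poly_fun_Suc:
  assumes "poly_fun R k p" "\<And>m. p m \<in> carrier R" shows "poly_fun R (Suc k) p"
  using assms
proof (induction k arbitrary: p)
  case 0
  then show ?case by (simp add: minus_eq)
next
  case (Suc k)
  have "poly_fun R k (\<lambda>m. p (m + 1) \<ominus> p m)" using Suc.prems(1) by simp
  from Suc.IH[OF this] Suc.prems(2) show ?case by simp
qed

lemma poly_fun_mono:
  assumes "poly_fun R k p" "k \<le> l" "\<And>m. p m \<in> carrier R" shows "poly_fun R l p"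
  using assms(2,1) by (induction l rule: dec_induct) (auto intro: poly_fun_Suc assms(3) simp del: poly_fun.simps)

lemma poly_fun_add:
  assumes "poly_fun R k p" "poly_fun R k r" "\<And>m. p m \<in> carrier R" "\<And>m. r m \<in> carrier R"
  shows "poly_fun R k (\<lambda>m. p m \<oplus> r m)"
  using assms
proof (induction k arbitrary: p r)
  case 0
  then show ?case by simp
next
  case (Suc k)
  have "(\<lambda>m. (p (m+1) \<oplus> r (m+1)) \<ominus> (p m \<oplus> r m)) = (\<lambda>m. (p (m+1) \<ominus> p m) \<oplus> (r (m+1) \<ominus> r m))"
  proof
    fix m
    show "(p (m+1) \<oplus> r (m+1)) \<ominus> (p m \<oplus> r m) = (p (m+1) \<ominus> p m) \<oplus> (r (m+1) \<ominus> r m)"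
      using Suc.prems(3)[of m] Suc.prems(4)[of m] Suc.prems(3)[of "m+1"] Suc.prems(4)[of "m+1"] by algebra
  qed
  with Suc.IH[of "\<lambda>m. p (m+1) \<ominus> p m" "\<lambda>m. r (m+1) \<ominus> r m"] Suc.prems show ?case by simp
qed

lemma poly_fun_smult:
  assumes "poly_fun R k p" "c \<in> carrier R" "\<And>m. p m \<in> carrier R"
  shows "poly_fun R k (\<lambda>m. c \<otimes> p m)"
  using assms
proof (induction k arbitrary: p)
  case 0
  then show ?case by simp
next
  case (Suc k)
  have "(\<lambda>m. c \<otimes> p (m+1) \<ominus> c \<otimes> p m) = (\<lambda>m. c \<otimes> (p (m+1) \<ominus> p m))"
  proof
    fix m show "c \<otimes> p (m+1) \<ominus> c \<otimes> p m = c \<otimes> (p (m+1) \<ominus> p m)"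
      using Suc.prems(3)[of m] Suc.prems(3)[of "m+1"] Suc.prems(2) by algebra
  qed
  with Suc.IH[of "\<lambda>m. p (m+1) \<ominus> p m"] Suc.prems show ?case by simp
qed

lemma poly_fun_minus:
  assumes "poly_fun R k p" "poly_fun R k r" "\<And>m. p m \<in> carrier R" "\<And>m. r m \<in> carrier R"
  shows "poly_fun R k (\<lambda>m. p m \<ominus> r m)"
proof -
  have "(\<lambda>m. p m \<ominus> r m) = (\<lambda>m. p m \<oplus> (\<ominus> \<one>) \<otimes> r m)"
    using assms(3,4) by (intro ext) (simp add: minus_eq l_minus)
  moreover have "poly_fun R k (\<lambda>m. (\<ominus> \<one>) \<otimes> r m)"
    by (rule poly_fun_smult[OF assms(2) _ assms(4)]) simp
  ultimately show ?thesis
    using poly_fun_add[OF assms(1), of "\<lambda>m. (\<ominus> \<one>) \<otimes> r m"] assms(3,4) by simp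
qed

lemma poly_fun_shift: "poly_fun R k p \<Longrightarrow> poly_fun R k (\<lambda>m. p (m + c))"
proof (induction k arbitrary: p)
  case (Suc k)
  have eq: "(\<lambda>m. p (m + 1 + c) \<ominus> p (m + c)) = (\<lambda>m. (\<lambda>m. p (m + 1) \<ominus> p m) (m + c))"
    by (simp add: algebra_simps)
  have "poly_fun R k (\<lambda>m. p (m + 1) \<ominus> p m)" using Suc.prems by simp
  from Suc.IH[OF this] show ?case by (simp add: algebra_simps)
qed simp

lemma poly_fun_reflect:
  assumes "poly_fun R k p" "\<And>m. p m \<in> carrier R" shows "poly_fun R k (\<lambda>m. p (c - m))"
  using assms
proof (induction k arbitrary: p c)
  case (Suc k)
  let ?d = "\<lambda>m. p (m + 1) \<ominus> p m"
  have "poly_fun R k (\<lambda>m. ?d (c - 1 - m))"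
    by (rule Suc.IH) (use Suc.prems in auto)
  then have "poly_fun R k (\<lambda>m. (\<ominus> \<one>) \<otimes> ?d (c - 1 - m))"
    by (rule poly_fun_smult) (use Suc.prems in auto)
  moreover have "(\<ominus> \<one>) \<otimes> ?d (c - 1 - m) = p (c - (m + 1)) \<ominus> p (c - m)" for m
  proof -
    have e: "c - 1 - m + 1 = c - m" "c - (m + 1) = c - 1 - m" by simp_all
    show ?thesis unfolding e using Suc.prems(2)[of "c - m"] Suc.prems(2)[of "c - 1 - m"] by algebra
  qed
  ultimately show ?case by simp
qed simp

text \<open>The Leibniz rule lowers the degree of one factor at a time.\<close>

lemma poly_fun_mult:
  assumes "poly_fun R k p" "poly_fun R l r" "\<And>m. p m \<in> carrier R" "\<And>m. r m \<in> carrier R"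
  shows "poly_fun R (k + l) (\<lambda>m. p m \<otimes> r m)"
  using assms
proof (induction "k + l" arbitrary: k l p r)
  case 0
  then show ?case by simp
next
  case (Suc n)
  show ?case
  proof (cases "k = 0 \<or> l = 0")
    case True
    then have "(\<lambda>m. p m \<otimes> r m) = (\<lambda>_. \<zero>)" using Suc.prems by auto
    then show ?thesis using poly_fun_zero by metis
  next
    case False
    then obtain k' l' where kl: "k = Suc k'" "l = Suc l'" by (meson not0_implies_Suc)
    let ?dp = "\<lambda>m. p (m + 1) \<ominus> p m" and ?dr = "\<lambda>m. r (m + 1) \<ominus> r m"
    have n1: "n = k' + l" and n2: "n = k + l'" using Suc.hyps(2) kl by auto
    have 1: "poly_fun R n (\<lambda>m. ?dp m \<otimes> r (m + 1))"
      unfolding n1 by (rule Suc.hyps(1)[OF n1]) (use poly_fun_shift[OF Suc.prems(2), of 1] Suc.prems(1,3,4) kl(1) in simp_all)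
    have 2: "poly_fun R n (\<lambda>m. p m \<otimes> ?dr m)"
      unfolding n2 by (rule Suc.hyps(1)[OF n2]) (use Suc.prems kl in auto)
    have "poly_fun R n (\<lambda>m. ?dp m \<otimes> r (m + 1) \<oplus> p m \<otimes> ?dr m)"
      by (rule poly_fun_add[OF 1 2]) (use Suc.prems in auto)
    moreover have "?dp m \<otimes> r (m + 1) \<oplus> p m \<otimes> ?dr m = p (m + 1) \<otimes> r (m + 1) \<ominus> p m \<otimes> r m" for m
      using Suc.prems(3)[of m] Suc.prems(3)[of "m+1"] Suc.prems(4)[of m] Suc.prems(4)[of "m+1"] by algebra
    ultimately have "poly_fun R (Suc n) (\<lambda>m. p m \<otimes> r m)" by simp
    then show ?thesis using Suc.hyps(2) by (simp del: poly_fun.simps)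
  qed
qed

lemma poly_fun_finsum:
  assumes "finite A" "\<And>a. a \<in> A \<Longrightarrow> poly_fun R k (p a)" "\<And>a m. a \<in> A \<Longrightarrow> p a m \<in> carrier R"
  shows "poly_fun R k (\<lambda>m. \<Oplus>a\<in>A. p a m)"
  using assms
proof (induction A)
  case empty
  then show ?case by (simp add: poly_fun_zero)
next
  case (insert x F)
  have "(\<lambda>m. \<Oplus>a\<in>insert x F. p a m) = (\<lambda>m. p x m \<oplus> (\<Oplus>a\<in>F. p a m))"
    using insert by (intro ext finsum_insert) auto
  then show ?case using poly_fun_add[of k "p x" "\<lambda>m. \<Oplus>a\<in>F. p a m"] insert by auto
qed

lemma eq_minus_zeroD:
  assumes "a \<ominus> b = \<zero>" "a \<in> carrier R" "b \<in> carrier R" shows "a = b"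
proof -
  have "a = (a \<ominus> b) \<oplus> b" using assms(2,3) by algebra
  with assms show ?thesis by simp
qed

lemma const_if_diff_zero:
  assumes "\<And>m. p (m + 1) \<ominus> p m = \<zero>" "\<And>m. p m \<in> carrier R"
  shows "p m = p (n::int)"
proof -
  have s: "p (m + 1) = p m" for m using eq_minus_zeroD[OF assms(1)] assms(2) by blast
  have "p (n + int j) = p n" for n j
    using s[of "n + int j" for j] by (induction j) (simp_all add: add.assoc[symmetric] add.commute[of 1])
  from this[of "min m n" "nat (m - min m n)"] this[of "min m n" "nat (n - min m n)"]
  show ?thesis by simp
qed

text \<open>By induction the difference vanishes identically, so the function is constant.\<close>

lemma poly_fun_eventually_zero:
  assumes "poly_fun R k p" "\<And>m. p m \<in> carrier R"
    and "(\<forall>m\<ge>a. p m = \<zero>) \<or> (\<forall>m\<le>a. p m = \<zero>)"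
  shows "p m = \<zero>"
  using assms
proof (induction k arbitrary: p m a)
  case (Suc k)
  let ?d = "\<lambda>m. p (m + 1) \<ominus> p m"
  have "(\<forall>m\<ge>a. ?d m = \<zero>) \<or> (\<forall>m\<le>a - 1. ?d m = \<zero>)"
    using Suc.prems(3) by (auto simp: minus_eq)
  then obtain b where b: "(\<forall>m\<ge>b. ?d m = \<zero>) \<or> (\<forall>m\<le>b. ?d m = \<zero>)" by blast
  have "?d m = \<zero>" for m
    by (rule Suc.IH[OF _ _ b]) (use Suc.prems in auto)
  then have "p m = p a" by (rule const_if_diff_zero) (rule Suc.prems)
  then show ?case using Suc.prems(3) by auto
qed simp

lemma exists_antidifference:
  assumes "c \<in> carrier R" "\<And>m. p m \<in> carrier R"
  obtains s where "\<And>m. s m \<in> carrier R" "s 0 = c" "\<And>m. s (m + 1) \<ominus> s m = p (m::int)"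
proof -
  define s where "s m = (if m \<ge> 0 then c \<oplus> (\<Oplus>i\<in>{0..<m}. p i) else c \<ominus> (\<Oplus>i\<in>{m..<0}. p i))" for m :: int
  have car: "s m \<in> carrier R" for m unfolding s_def using assms by (auto intro!: finsum_closed minus_closed)
  have "s (m + 1) \<ominus> s m = p m" for m
  proof -
    consider "m \<ge> 0" | "m = -1" | "m < -1" by linarith
    then show ?thesis
    proof cases
      case 1
      then have "{0..<m + 1} = insert m {0..<m}" by auto
      then have "s (m + 1) = c \<oplus> (p m \<oplus> (\<Oplus>i\<in>{0..<m}. p i))" unfolding s_def using 1 assms by simp
      moreover have "(\<Oplus>i\<in>{0..<m}. p i) \<in> carrier R" using assms by auto
      ultimately show ?thesis using 1 assms(1) assms(2)[of m] unfolding s_def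
        by simp algebra
    next
      case 2
      have "{-1..<0::int} = {-1}" by auto
      with 2 assms(1) assms(2)[of "-1"] show ?thesis unfolding s_def by simp algebra
    next
      case 3
      then have "{m..<0} = insert m {m + 1..<0}" by auto
      then have "s m = c \<ominus> (p m \<oplus> (\<Oplus>i\<in>{m + 1..<0}. p i))" unfolding s_def using 3 assms by simp
      moreover have "(\<Oplus>i\<in>{m + 1..<0}. p i) \<in> carrier R" using assms by auto
      moreover have "s (m + 1) = c \<ominus> (\<Oplus>i\<in>{m + 1..<0}. p i)" unfolding s_def using 3 by simp
      ultimately show ?thesis using assms(1) assms(2)[of m] by simp algebra
    qed
  qed
  moreover have "s 0 = c" unfolding s_def using assms by simp
  ultimately show ?thesis using that car by blast
qed

text \<open>A geometric progression with ratio \<open>1 + c\<close> is a polynomial function if \<open>c\<close> is nilpotent: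
  its \<open>k\<close>-th difference is its product with \<open>c\<^sup>k\<close>.\<close>

lemma poly_fun_geometric:
  assumes "c \<in> carrier R" "\<And>m. p m \<in> carrier R" "\<And>m. p (m + 1) \<ominus> p m = c \<otimes> p m"
    and "\<And>m. c [^] k \<otimes> p m = \<zero>"
  shows "poly_fun R k p"
  using assms
proof (induction k arbitrary: p)
  case (Suc k)
  have "poly_fun R k (\<lambda>m. c \<otimes> p m)"
  proof (rule Suc.IH)
    fix m
    show "c \<otimes> p (m + 1) \<ominus> c \<otimes> p m = c \<otimes> (c \<otimes> p m)"
      using Suc.prems(1) Suc.prems(2)[of m] Suc.prems(2)[of "m+1"] Suc.prems(3)[of m, symmetric] by algebra
    show "c [^] k \<otimes> (c \<otimes> p m) = \<zero>"
      using Suc.prems by (simp add: m_assoc)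
  qed (use Suc.prems in auto)
  then show ?case using Suc.prems(3) by simp
qed simp

end

lemma poly_fun_hom:
  assumes "poly_fun R k p" "\<And>m. p m \<in> carrier R" "cring R"
    and "\<And>a b. a \<in> carrier R \<Longrightarrow> b \<in> carrier R \<Longrightarrow> h (a \<ominus>\<^bsub>R\<^esub> b) = h a \<ominus>\<^bsub>R'\<^esub> h b"
    and "h \<zero>\<^bsub>R\<^esub> = \<zero>\<^bsub>R'\<^esub>"
  shows "poly_fun R' k (\<lambda>m. h (p m))"
  using assms(1,2)
proof (induction k arbitrary: p)
  case (Suc k)
  interpret cring R by fact
  have "poly_fun R' k (\<lambda>m. h (p (m + 1) \<ominus>\<^bsub>R\<^esub> p m))" using Suc by simp
  then show ?case using assms(4) Suc.prems by simp
qed (use assms in simp)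

text \<open>The set \<open>C\<close> only has to be closed under differences and \<open>h\<close> to be additive.  The case of interest
  is that of the rational numbers with \<open>h c\<close> the residue class of \<open>(q-1)\<^sup>n c\<close>.\<close>

lemma poly_fun_inj:
  assumes "poly_fun R' k (\<lambda>m. h (p m))" "\<And>m. p m \<in> C"
    and "\<And>a b. a \<in> C \<Longrightarrow> b \<in> C \<Longrightarrow> a \<ominus>\<^bsub>R\<^esub> b \<in> C \<and> h (a \<ominus>\<^bsub>R\<^esub> b) = h a \<ominus>\<^bsub>R'\<^esub> h b"
    and "\<And>a. a \<in> C \<Longrightarrow> h a = \<zero>\<^bsub>R'\<^esub> \<Longrightarrow> a = \<zero>\<^bsub>R\<^esub>"
  shows "poly_fun R k p"
  using assms(1,2)
proof (induction k arbitrary: p)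
  case (Suc k)
  have "poly_fun R' k (\<lambda>m. h (p (m + 1) \<ominus>\<^bsub>R\<^esub> p m))" using Suc.prems assms(3) by simp
  from Suc.IH[OF this] show ?case using assms(3) Suc.prems by simp
qed (use assms in simp)

section \<open>Linear operators on Laurent polynomials\<close>

text \<open>The symbol \<open>P\<close> of an operator records in \<open>P d m\<close> the coefficient with which the operator
  sends \<open>x\<^sup>m\<close> to \<open>x\<^sup>m\<^sup>+\<^sup>d\<close>.\<close>

definition symop :: "('r, 'm) ring_scheme \<Rightarrow> int set \<Rightarrow> (int \<Rightarrow> int \<Rightarrow> 'r) \<Rightarrow> (int \<Rightarrow> 'r) \<Rightarrow> int \<Rightarrow> 'r"
  where "symop R I P =
    (\<lambda>f\<in>carrier (laurent R I). \<lambda>j. \<Oplus>\<^bsub>R\<^esub>m\<in>{m. f m \<noteq> \<zero>\<^bsub>R\<^esub>}. f m \<otimes>\<^bsub>R\<^esub> P (j - m) m)"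

locale laurent_ops = cring R for R (structure) +
  fixes I :: "int set"
  assumes ray: "I = {0..} \<or> I = {..0} \<or> I = UNIV"
begin

abbreviation "S \<equiv> laurent R I"
abbreviation "G \<equiv> laurent_grade R I"
abbreviation "E \<equiv> lin_end R S"
abbreviation "x m \<equiv> mon R \<one> m"
abbreviation "degs \<phi> \<equiv> {d. \<exists>m\<in>I. \<phi> (x m) (m + d) \<noteq> \<zero>}"

lemma zero_I: "0 \<in> I" and add_I: "i \<in> I \<Longrightarrow> j \<in> I \<Longrightarrow> i + j \<in> I"
  using ray by auto

sublocale S: graded_algebra R "laurent R I" "laurent_grade R I"
  by (rule laurent_graded_algebra[OF zero_I add_I])

sublocale E: ring "lin_end R (laurent R I)"
  by (rule S.lin_end_ring)

lemma S_carrier: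
  "f \<in> carrier S \<longleftrightarrow> (\<forall>j. f j \<in> carrier R) \<and> finite {j. f j \<noteq> \<zero>} \<and> (\<forall>j. j \<notin> I \<longrightarrow> f j = \<zero>)"
  by (simp add: laurent_def)

lemma S_coeff: "f \<in> carrier S \<Longrightarrow> f j \<in> carrier R"
  by (simp add: S_carrier)

lemma S_app:
  "(f \<oplus>\<^bsub>S\<^esub> g) j = f j \<oplus> g j" "(c \<odot>\<^bsub>S\<^esub> f) j = c \<otimes> f j" "\<zero>\<^bsub>S\<^esub> j = \<zero>" "\<one>\<^bsub>S\<^esub> = x 0"
  by (simp_all add: laurent_def)

lemma mon_closed: "c \<in> carrier R \<Longrightarrow> m \<in> I \<Longrightarrow> mon R c m \<in> carrier S"
  by (auto simp: S_carrier mon_def)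

lemma x_closed: "m \<in> I \<Longrightarrow> x m \<in> carrier S"
  by (simp add: mon_closed)

lemma mult_app:
  assumes "f \<in> carrier S" "g \<in> carrier S" "finite F" "{i. f i \<noteq> \<zero>} \<subseteq> F"
  shows "(f \<otimes>\<^bsub>S\<^esub> g) j = (\<Oplus>i\<in>F. f i \<otimes> g (j - i))"
  by (rule laurent_mult_eq[OF assms])

lemma mon_mult_app:
  assumes "c \<in> carrier R" "i \<in> I" "g \<in> carrier S"
  shows "(mon R c i \<otimes>\<^bsub>S\<^esub> g) j = c \<otimes> g (j - i)"
proof -
  have "(mon R c i \<otimes>\<^bsub>S\<^esub> g) j = (\<Oplus>k\<in>{i}. mon R c i k \<otimes> g (j - k))"
    by (rule mult_app[OF mon_closed[OF assms(1,2)] assms(3)]) (auto simp: mon_def)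
  then show ?thesis using assms S_coeff[OF assms(3)] by (simp add: mon_def)
qed

lemma E_carrier:
  "\<phi> \<in> carrier E \<longleftrightarrow> \<phi> \<in> carrier S \<rightarrow>\<^sub>E carrier S \<and>
     (\<forall>s\<in>carrier S. \<forall>t\<in>carrier S. \<phi> (s \<oplus>\<^bsub>S\<^esub> t) = \<phi> s \<oplus>\<^bsub>S\<^esub> \<phi> t) \<and>
     (\<forall>c\<in>carrier R. \<forall>s\<in>carrier S. \<phi> (c \<odot>\<^bsub>S\<^esub> s) = c \<odot>\<^bsub>S\<^esub> \<phi> s)"
  by (simp add: lin_end_def)

lemma E_maps: "\<phi> \<in> carrier E \<Longrightarrow> f \<in> carrier S \<Longrightarrow> \<phi> f \<in> carrier S"
  by (auto simp: E_carrier)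

lemma E_coeff: "\<phi> \<in> carrier E \<Longrightarrow> f \<in> carrier S \<Longrightarrow> \<phi> f j \<in> carrier R"
  using E_maps S_coeff by blast

lemma E_x_coeff: "\<phi> \<in> carrier E \<Longrightarrow> m \<in> I \<Longrightarrow> \<phi> (x m) j \<in> carrier R"
  using E_coeff x_closed by blast

lemma E_outside: "\<phi> \<in> carrier E \<Longrightarrow> m \<in> I \<Longrightarrow> j \<notin> I \<Longrightarrow> \<phi> (x m) j = \<zero>"
  using E_maps[OF _ x_closed] by (simp add: S_carrier)

lemma E_linear:
  assumes "\<phi> \<in> carrier E"
  shows "f \<in> carrier S \<Longrightarrow> g \<in> carrier S \<Longrightarrow> \<phi> (f \<oplus>\<^bsub>S\<^esub> g) = \<phi> f \<oplus>\<^bsub>S\<^esub> \<phi> g"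
    "c \<in> carrier R \<Longrightarrow> f \<in> carrier S \<Longrightarrow> \<phi> (c \<odot>\<^bsub>S\<^esub> f) = c \<odot>\<^bsub>S\<^esub> \<phi> f"
  using assms by (auto simp: E_carrier)

lemma E_app:
  assumes "f \<in> carrier S"
  shows "(\<phi> \<oplus>\<^bsub>E\<^esub> \<psi>) f j = \<phi> f j \<oplus> \<psi> f j" "(\<phi> \<otimes>\<^bsub>E\<^esub> \<psi>) f = \<phi> (\<psi> f)" "\<zero>\<^bsub>E\<^esub> f j = \<zero>"
    "\<one>\<^bsub>E\<^esub> f = f" "(c \<odot>\<^bsub>E\<^esub> \<phi>) f j = c \<otimes> \<phi> f j"
  using assms by (simp_all add: lin_end_def S_app compose_def)

lemma E_uminus_app:
  assumes "\<phi> \<in> carrier E" "f \<in> carrier S"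
  shows "(\<ominus>\<^bsub>E\<^esub> \<phi>) f j = \<ominus> \<phi> f j"
proof -
  have "(\<phi> \<oplus>\<^bsub>E\<^esub> \<ominus>\<^bsub>E\<^esub> \<phi>) f j = \<zero>\<^bsub>E\<^esub> f j" using E.r_neg[OF assms(1)] by simp
  then have "\<phi> f j \<oplus> (\<ominus>\<^bsub>E\<^esub> \<phi>) f j = \<zero>" using E_app assms by simp
  then show ?thesis using minus_unique[of "\<phi> f j" "\<phi> f j"] E_coeff[OF assms] E_coeff[OF E.a_inv_closed[OF assms(1)] assms(2)]
    by (metis a_comm minus_equality minus_minus)
qed

lemma E_minus_app:
  assumes "\<phi> \<in> carrier E" "\<psi> \<in> carrier E" "f \<in> carrier S"
  shows "(\<phi> \<ominus>\<^bsub>E\<^esub> \<psi>) f j = \<phi> f j \<ominus> \<psi> f j"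
  using assms by (simp add: minus_eq E.minus_eq E_app E_uminus_app)

lemma E_finsum_app:
  assumes "finite A" "\<And>a. a \<in> A \<Longrightarrow> c a \<in> carrier E" "f \<in> carrier S"
  shows "(\<Oplus>\<^bsub>E\<^esub>a\<in>A. c a) f j = (\<Oplus>a\<in>A. c a f j)"
  using assms(1,2)
proof (induction A)
  case (insert a A)
  have "(\<Oplus>\<^bsub>E\<^esub>a\<in>insert a A. c a) = c a \<oplus>\<^bsub>E\<^esub> (\<Oplus>\<^bsub>E\<^esub>a\<in>A. c a)"
    using insert by (intro E.finsum_insert) auto
  moreover have "(\<Oplus>a\<in>insert a A. c a f j) = c a f j \<oplus> (\<Oplus>a\<in>A. c a f j)"
    using insert E_coeff assms(3) by (intro finsum_insert) auto
  ultimately show ?case using insert assms(3) by (simp add: E_app)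
qed (simp add: E_app assms)

lemma E_expand:
  assumes \<phi>: "\<phi> \<in> carrier E" and f: "f \<in> carrier S"
    and F: "finite F" "{m. f m \<noteq> \<zero>} \<subseteq> F" "F \<subseteq> I"
  shows "\<phi> f j = (\<Oplus>m\<in>F. f m \<otimes> \<phi> (x m) j)"
proof -
  define g where "g A = (\<lambda>m. if m \<in> A then f m else \<zero>)" for A
  have gS: "g A \<in> carrier S" for A
  proof -
    have "{j. g A j \<noteq> \<zero>} \<subseteq> {j. f j \<noteq> \<zero>}" by (auto simp: g_def)
    then show ?thesis using f by (auto simp: S_carrier g_def intro: finite_subset)
  qed
  have "\<phi> (g A) j = (\<Oplus>m\<in>A. f m \<otimes> \<phi> (x m) j)" if "finite A" "A \<subseteq> I" for A
    using that
  proof (induction A)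
    case empty
    have "g {} = \<zero> \<odot>\<^bsub>S\<^esub> f" using S_coeff[OF f] by (auto simp: g_def S_app)
    then have "\<phi> (g {}) = \<zero> \<odot>\<^bsub>S\<^esub> \<phi> f" using E_linear(2)[OF \<phi> zero_closed f] by argo
    then show ?case using E_coeff[OF \<phi> f] by (simp add: S_app)
  next
    case (insert a A)
    have xa: "x a \<in> carrier S" using insert by (intro x_closed) auto
    have "g (insert a A) = f a \<odot>\<^bsub>S\<^esub> x a \<oplus>\<^bsub>S\<^esub> g A"
      using insert S_coeff[OF f] by (auto simp: g_def S_app mon_def)
    then have "\<phi> (g (insert a A)) = f a \<odot>\<^bsub>S\<^esub> \<phi> (x a) \<oplus>\<^bsub>S\<^esub> \<phi> (g A)"
      using E_linear[OF \<phi>] xa gS S_coeff[OF f] by simp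
    moreover have "(\<Oplus>m\<in>insert a A. f m \<otimes> \<phi> (x m) j) = f a \<otimes> \<phi> (x a) j \<oplus> (\<Oplus>m\<in>A. f m \<otimes> \<phi> (x m) j)"
      using insert S_coeff[OF f] E_x_coeff[OF \<phi>] by (intro finsum_insert) auto
    ultimately show ?case using insert by (simp add: S_app)
  qed
  moreover have "g F = f"
  proof
    fix m
    have "f m = \<zero>" if "m \<notin> F" using F(2) that by blast
    then show "g F m = f m" by (simp add: g_def)
  qed
  ultimately show ?thesis using F by metis
qed

lemma supp_I: "f \<in> carrier S \<Longrightarrow> {m. f m \<noteq> \<zero>} \<subseteq> I"
  by (auto simp: S_carrier)

lemma E_eqI:
  assumes "\<phi> \<in> carrier E" "\<psi> \<in> carrier E" "\<And>m j. m \<in> I \<Longrightarrow> \<phi> (x m) j = \<psi> (x m) j"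
  shows "\<phi> = \<psi>"
proof (rule extensionalityI[of _ "carrier S"])
  show "\<phi> \<in> extensional (carrier S)" "\<psi> \<in> extensional (carrier S)"
    using assms by (auto simp: E_carrier PiE_def)
  fix f assume f: "f \<in> carrier S"
  then have fin: "finite {m. f m \<noteq> \<zero>}" by (simp add: S_carrier)
  show "\<phi> f = \<psi> f"
  proof
    fix j
    have "(\<Oplus>m\<in>{m. f m \<noteq> \<zero>}. f m \<otimes> \<phi> (x m) j) = (\<Oplus>m\<in>{m. f m \<noteq> \<zero>}. f m \<otimes> \<psi> (x m) j)"
      using supp_I[OF f] assms S_coeff[OF f] E_x_coeff[OF assms(2)] by (intro finsum_cong') auto
    then show "\<phi> f j = \<psi> f j"
      using E_expand[OF _ f fin subset_refl supp_I[OF f]] assms(1,2) by simp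
  qed
qed

subsection \<open>Operators with a given symbol\<close>

text \<open>The conditions under which a symbol defines an operator with values in \<open>S\<close>.\<close>

definition presymbol :: "(int \<Rightarrow> int \<Rightarrow> 'a) \<Rightarrow> bool"
  where "presymbol P \<longleftrightarrow> (\<forall>d m. P d m \<in> carrier R) \<and> finite {d. \<exists>m\<in>I. P d m \<noteq> \<zero>} \<and>
    (\<forall>d. \<forall>m\<in>I. m + d \<notin> I \<longrightarrow> P d m = \<zero>)"

lemma symop_app:
  assumes "\<And>d m. P d m \<in> carrier R" "f \<in> carrier S" "finite F" "{m. f m \<noteq> \<zero>} \<subseteq> F"
  shows "symop R I P f j = (\<Oplus>m\<in>F. f m \<otimes> P (j - m) m)"
  unfolding symop_def using assms S_coeff[OF assms(2)]
  by (auto intro!: add.finprod_mono_neutral_cong_left)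

lemma symop_x:
  assumes "\<And>d m. P d m \<in> carrier R" "m \<in> I"
  shows "symop R I P (x m) j = P (j - m) m"
proof -
  have "symop R I P (x m) j = (\<Oplus>i\<in>{m}. x m i \<otimes> P (j - i) i)"
    by (rule symop_app[OF assms(1) x_closed[OF assms(2)]]) (auto simp: mon_def)
  then show ?thesis using assms by (simp add: mon_def)
qed

lemma symop_cong:
  assumes "\<And>d m. m \<in> I \<Longrightarrow> P d m = Q d m" "\<And>d m. m \<in> I \<Longrightarrow> Q d m \<in> carrier R"
  shows "symop R I P = symop R I Q"
  unfolding symop_def
proof (intro restrict_ext ext)
  fix f j assume f: "f \<in> carrier S"
  show "(\<Oplus>m\<in>{m. f m \<noteq> \<zero>}. f m \<otimes> P (j - m) m) = (\<Oplus>m\<in>{m. f m \<noteq> \<zero>}. f m \<otimes> Q (j - m) m)"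
    using assms supp_I[OF f] S_coeff[OF f] by (intro finsum_cong') auto
qed

lemma symop_closed:
  assumes "presymbol P"
  shows "symop R I P \<in> carrier E"
proof -
  have P: "\<And>d m. P d m \<in> carrier R" "finite {d. \<exists>m\<in>I. P d m \<noteq> \<zero>}"
    "\<And>d m. m \<in> I \<Longrightarrow> m + d \<notin> I \<Longrightarrow> P d m = \<zero>"
    using assms by (auto simp: presymbol_def)
  note app = symop_app[OF P(1)]
  have fin: "finite {m. f m \<noteq> \<zero>}" if "f \<in> carrier S" for f using that by (simp add: S_carrier)
  have maps: "symop R I P f \<in> carrier S" if f: "f \<in> carrier S" for f
  proof -
    have eq: "symop R I P f j = (\<Oplus>m\<in>{m. f m \<noteq> \<zero>}. f m \<otimes> P (j - m) m)" for j
      by (rule app[OF f fin[OF f]]) simp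
    have z: "symop R I P f j = \<zero>" if "\<And>m. f m \<noteq> \<zero> \<Longrightarrow> P (j - m) m = \<zero>" for j
      unfolding eq using that S_coeff[OF f] by (intro add.finprod_one_eqI) auto
    have "symop R I P f j \<in> carrier R" for j
      unfolding eq using S_coeff[OF f] P(1) by (auto intro!: finsum_closed)
    moreover have "{j. symop R I P f j \<noteq> \<zero>} \<subseteq> (\<lambda>(m, d). m + d) ` ({m. f m \<noteq> \<zero>} \<times> {d. \<exists>m\<in>I. P d m \<noteq> \<zero>})"
    proof
      fix j assume "j \<in> {j. symop R I P f j \<noteq> \<zero>}"
      then obtain m where m: "f m \<noteq> \<zero>" "P (j - m) m \<noteq> \<zero>" using z by blast
      then have "m \<in> I" using supp_I[OF f] by blast
      with m show "j \<in> (\<lambda>(m, d). m + d) ` ({m. f m \<noteq> \<zero>} \<times> {d. \<exists>m\<in>I. P d m \<noteq> \<zero>})"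
        by (intro image_eqI[of _ _ "(m, j - m)"]) auto
    qed
    then have "finite {j. symop R I P f j \<noteq> \<zero>}"
      using fin[OF f] P(2) by (meson finite_SigmaI finite_imageI finite_subset)
    moreover have "symop R I P f j = \<zero>" if "j \<notin> I" for j
    proof (rule z)
      fix m assume "f m \<noteq> \<zero>"
      then have "m \<in> I" using supp_I[OF f] by blast
      then show "P (j - m) m = \<zero>" using P(3) that by simp
    qed
    ultimately show ?thesis by (simp add: S_carrier)
  qed
  have add: "symop R I P (f \<oplus>\<^bsub>S\<^esub> g) = symop R I P f \<oplus>\<^bsub>S\<^esub> symop R I P g"
    if f: "f \<in> carrier S" and g: "g \<in> carrier S" for f g
  proof
    fix j
    let ?F = "{m. f m \<noteq> \<zero>} \<union> {m. g m \<noteq> \<zero>}"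
    have F: "finite ?F" using fin f g by simp
    have "symop R I P (f \<oplus>\<^bsub>S\<^esub> g) j = (\<Oplus>m\<in>?F. (f \<oplus>\<^bsub>S\<^esub> g) m \<otimes> P (j - m) m)"
      by (rule app[OF _ F]) (use f g in \<open>auto simp: S_app\<close>)
    also have "\<dots> = (\<Oplus>m\<in>?F. f m \<otimes> P (j - m) m \<oplus> g m \<otimes> P (j - m) m)"
      using S_coeff[OF f] S_coeff[OF g] P(1) by (intro finsum_cong') (auto simp: S_app l_distr)
    also have "\<dots> = (\<Oplus>m\<in>?F. f m \<otimes> P (j - m) m) \<oplus> (\<Oplus>m\<in>?F. g m \<otimes> P (j - m) m)"
      using S_coeff[OF f] S_coeff[OF g] P(1) by (intro finsum_addf) auto
    also have "\<dots> = (symop R I P f \<oplus>\<^bsub>S\<^esub> symop R I P g) j"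
      using app[OF f F] app[OF g F] by (simp add: S_app)
    finally show "symop R I P (f \<oplus>\<^bsub>S\<^esub> g) j = (symop R I P f \<oplus>\<^bsub>S\<^esub> symop R I P g) j" .
  qed
  have smult: "symop R I P (c \<odot>\<^bsub>S\<^esub> f) = c \<odot>\<^bsub>S\<^esub> symop R I P f"
    if c: "c \<in> carrier R" and f: "f \<in> carrier S" for c f
  proof
    fix j
    have "symop R I P (c \<odot>\<^bsub>S\<^esub> f) j = (\<Oplus>m\<in>{m. f m \<noteq> \<zero>}. (c \<odot>\<^bsub>S\<^esub> f) m \<otimes> P (j - m) m)"
      by (rule app[OF _ fin[OF f]]) (use c f S_coeff[OF f] in \<open>auto simp: S_app\<close>)
    also have "\<dots> = (\<Oplus>m\<in>{m. f m \<noteq> \<zero>}. c \<otimes> (f m \<otimes> P (j - m) m))"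
      using S_coeff[OF f] P(1) c by (intro finsum_cong') (auto simp: S_app m_assoc)
    also have "\<dots> = c \<otimes> (\<Oplus>m\<in>{m. f m \<noteq> \<zero>}. f m \<otimes> P (j - m) m)"
      using S_coeff[OF f] P(1) c fin[OF f] by (intro finsum_rdistr[symmetric]) auto
    also have "\<dots> = (c \<odot>\<^bsub>S\<^esub> symop R I P f) j"
      using app[OF f fin[OF f]] by (simp add: S_app)
    finally show "symop R I P (c \<odot>\<^bsub>S\<^esub> f) j = (c \<odot>\<^bsub>S\<^esub> symop R I P f) j" .
  qed
  show ?thesis
    using maps add smult by (auto simp: E_carrier symop_def)
qed

lemma E_eq_symop:
  assumes "\<phi> \<in> carrier E"
  shows "\<phi> = symop R I (\<lambda>d m. if m \<in> I then \<phi> (x m) (m + d) else \<zero>)" (is "_ = symop R I ?P")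
proof (rule extensionalityI[of _ "carrier S"])
  show "\<phi> \<in> extensional (carrier S)" using assms by (auto simp: E_carrier PiE_def)
  show "symop R I ?P \<in> extensional (carrier S)" by (simp add: symop_def)
  fix f assume f: "f \<in> carrier S"
  then have fin: "finite {m. f m \<noteq> \<zero>}" by (simp add: S_carrier)
  show "\<phi> f = symop R I ?P f"
  proof
    fix j
    have "symop R I ?P f j = (\<Oplus>m\<in>{m. f m \<noteq> \<zero>}. f m \<otimes> ?P (j - m) m)"
      by (rule symop_app[OF _ f fin]) (use E_x_coeff[OF assms] in auto)
    also have "\<dots> = (\<Oplus>m\<in>{m. f m \<noteq> \<zero>}. f m \<otimes> \<phi> (x m) j)"
      using supp_I[OF f] S_coeff[OF f] E_x_coeff[OF assms] by (intro finsum_cong') auto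
    also have "\<dots> = \<phi> f j" using E_expand[OF assms f fin subset_refl supp_I[OF f]] by simp
    finally show "\<phi> f j = symop R I ?P f j" by simp
  qed
qed

end

context laurent_ops
begin

subsection \<open>Homogeneous operators\<close>

lemma x_graded: "m \<in> I \<Longrightarrow> x m \<in> G m"
  by (simp add: laurent_grade_def x_closed) (simp add: mon_def)

lemma homog_iff:
  "\<phi> \<in> homog R S G d \<longleftrightarrow> \<phi> \<in> carrier E \<and> (\<forall>m\<in>I. \<forall>j. j \<noteq> m + d \<longrightarrow> \<phi> (x m) j = \<zero>)"
proof (intro iffI conjI ballI allI impI)
  assume h: "\<phi> \<in> homog R S G d"
  then show "\<phi> \<in> carrier E" by (simp add: homog_def)
  fix m j assume "m \<in> I" "j \<noteq> m + d"
  moreover have "\<phi> (x m) \<in> G (m + d)" using h x_graded[OF \<open>m \<in> I\<close>] by (auto simp: homog_def)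
  ultimately show "\<phi> (x m) j = \<zero>" by (simp add: laurent_grade_def)
next
  assume h: "\<phi> \<in> carrier E \<and> (\<forall>m\<in>I. \<forall>j. j \<noteq> m + d \<longrightarrow> \<phi> (x m) j = \<zero>)"
  have "\<phi> f \<in> G (b + d)" if "f \<in> G b" for f b
  proof -
    have f: "f \<in> carrier S" "\<And>j. j \<noteq> b \<Longrightarrow> f j = \<zero>" using that by (auto simp: laurent_grade_def)
    have fin: "finite {m. f m \<noteq> \<zero>}" using f(1) by (simp add: S_carrier)
    have "\<phi> f j = \<zero>" if j: "j \<noteq> b + d" for j
    proof -
      have "\<phi> f j = (\<Oplus>m\<in>{m. f m \<noteq> \<zero>}. f m \<otimes> \<phi> (x m) j)"
        using h by (intro E_expand f(1) fin supp_I) auto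
      also have "\<dots> = \<zero>"
      proof (rule add.finprod_one_eqI)
        fix m assume m: "m \<in> {m. f m \<noteq> \<zero>}"
        then have "m = b" "m \<in> I" using f(2) supp_I[OF f(1)] by auto
        then have "\<phi> (x m) j = \<zero>" using h j by blast
        then show "f m \<otimes> \<phi> (x m) j = \<zero>" using S_coeff[OF f(1)] by simp
      qed
      finally show ?thesis .
    qed
    then show ?thesis using h E_maps f(1) by (auto simp: laurent_grade_def)
  qed
  then show "\<phi> \<in> homog R S G d" using h by (auto simp: homog_def)
qed

definition banded :: "((int \<Rightarrow> 'a) \<Rightarrow> int \<Rightarrow> 'a) \<Rightarrow> bool"
  where "banded \<phi> \<longleftrightarrow> finite (degs \<phi>)"

definition band :: "((int \<Rightarrow> 'a) \<Rightarrow> int \<Rightarrow> 'a) \<Rightarrow> int \<Rightarrow> (int \<Rightarrow> 'a) \<Rightarrow> int \<Rightarrow> 'a"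
  where "band \<phi> d = symop R I (\<lambda>e m. if e = d \<and> m \<in> I then \<phi> (x m) (m + e) else \<zero>)"

lemma band_x:
  assumes "\<phi> \<in> carrier E" "m \<in> I"
  shows "band \<phi> d (x m) j = (if j = m + d then \<phi> (x m) j else \<zero>)"
  unfolding band_def using assms E_x_coeff[OF assms(1)] by (subst symop_x) auto

lemma band_homog:
  assumes "\<phi> \<in> carrier E" shows "band \<phi> d \<in> homog R S G d"
proof -
  have "{e. \<exists>m\<in>I. (if e = d \<and> m \<in> I then \<phi> (x m) (m + e) else \<zero>) \<noteq> \<zero>} \<subseteq> {d}" by auto
  then have "finite {e. \<exists>m\<in>I. (if e = d \<and> m \<in> I then \<phi> (x m) (m + e) else \<zero>) \<noteq> \<zero>}"
    by (rule finite_subset) simp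
  then have "presymbol (\<lambda>e m. if e = d \<and> m \<in> I then \<phi> (x m) (m + e) else \<zero>)"
    using E_x_coeff[OF assms] E_outside[OF assms] by (simp add: presymbol_def)
  then have "band \<phi> d \<in> carrier E" unfolding band_def by (rule symop_closed)
  then show ?thesis using band_x[OF assms] by (simp add: homog_iff)
qed

lemma band_closed: "\<phi> \<in> carrier E \<Longrightarrow> band \<phi> d \<in> carrier E"
  using band_homog by (simp add: homog_iff)

lemma finsum_diagonal:
  fixes j m :: int
  assumes "finite D" "c \<in> carrier R"
  shows "(\<Oplus>d\<in>D. if j = m + d then c else \<zero>) = (if j - m \<in> D then c else \<zero>)"
proof -
  have "(\<Oplus>d\<in>D. if j = m + d then c else \<zero>) = (\<Oplus>d\<in>D. if j - m = d then (\<lambda>_. c) d else \<zero>)"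
    using assms by (intro finsum_cong') auto
  also have "\<dots> = (if j - m \<in> D then c else \<zero>)"
  proof (cases "j - m \<in> D")
    case True
    then show ?thesis using finsum_singleton[OF True assms(1), of "\<lambda>_. c"] assms by simp
  next
    case False
    then show ?thesis using assms by (auto intro!: add.finprod_one_eqI)
  qed
  finally show ?thesis .
qed

lemma sum_of_bands:
  assumes \<phi>: "\<phi> \<in> carrier E" and D: "finite D" "degs \<phi> \<subseteq> D"
  shows "\<phi> = (\<Oplus>\<^bsub>E\<^esub>d\<in>D. band \<phi> d)"
proof (rule E_eqI[OF \<phi>])
  show "(\<Oplus>\<^bsub>E\<^esub>d\<in>D. band \<phi> d) \<in> carrier E" using band_closed[OF \<phi>] by (intro E.finsum_closed) auto
  fix m j assume m: "m \<in> I"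
  have "(\<Oplus>\<^bsub>E\<^esub>d\<in>D. band \<phi> d) (x m) j = (\<Oplus>d\<in>D. band \<phi> d (x m) j)"
    by (rule E_finsum_app[OF D(1) band_closed[OF \<phi>] x_closed[OF m]])
  also have "\<dots> = (\<Oplus>d\<in>D. if j = m + d then \<phi> (x m) j else \<zero>)"
    using band_x[OF \<phi> m] by simp
  also have "\<dots> = (if j - m \<in> D then \<phi> (x m) j else \<zero>)"
    by (rule finsum_diagonal[OF D(1) E_x_coeff[OF \<phi> m]])
  also have "\<dots> = \<phi> (x m) j"
  proof (cases "j - m \<in> D")
    case False
    then have "\<not> (\<phi> (x m) (m + (j - m)) \<noteq> \<zero>)" using D(2) m by blast
    then show ?thesis by simp
  qed simp
  finally show "\<phi> (x m) j = (\<Oplus>\<^bsub>E\<^esub>d\<in>D. band \<phi> d) (x m) j" by simp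
qed

lemma homog_sum_x:
  assumes J: "finite J" "\<And>d. d \<in> J \<Longrightarrow> c d \<in> homog R S G d" and m: "m \<in> I"
  shows "(\<Oplus>\<^bsub>E\<^esub>d\<in>J. c d) (x m) (m + e) = (if e \<in> J then c e (x m) (m + e) else \<zero>)"
proof -
  have cE: "c d \<in> carrier E" if "d \<in> J" for d using J(2)[OF that] by (simp add: homog_iff)
  have "(\<Oplus>\<^bsub>E\<^esub>d\<in>J. c d) (x m) (m + e) = (\<Oplus>d\<in>J. c d (x m) (m + e))"
    by (rule E_finsum_app[OF J(1) cE x_closed[OF m]])
  also have "\<dots> = (\<Oplus>d\<in>J. if e = d then c d (x m) (m + e) else \<zero>)"
    using E_x_coeff[OF cE m] J(2) m by (intro finsum_cong') (auto simp: homog_iff)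
  also have "\<dots> = (if e \<in> J then c e (x m) (m + e) else \<zero>)"
  proof (cases "e \<in> J")
    case True
    then show ?thesis using finsum_singleton[OF True J(1), of "\<lambda>d. c d (x m) (m + e)"] E_x_coeff[OF cE m] by simp
  next
    case False
    then show ?thesis by (auto intro!: add.finprod_one_eqI)
  qed
  finally show ?thesis .
qed

lemma gr_hom_iff: "\<phi> \<in> gr_hom R S G \<longleftrightarrow> \<phi> \<in> carrier E \<and> banded \<phi>"
proof
  assume "\<phi> \<in> gr_hom R S G"
  then obtain J c where \<phi>: "\<phi> = (\<Oplus>\<^bsub>E\<^esub>d\<in>J. c d)" and J: "finite J" "\<And>d. d \<in> J \<Longrightarrow> c d \<in> homog R S G d"
    by (auto simp: gr_hom_def)
  have "degs \<phi> \<subseteq> J" unfolding \<phi> using homog_sum_x[OF J] by auto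
  then have "banded \<phi>" unfolding banded_def using J(1) finite_subset by blast
  moreover have "\<phi> \<in> carrier E" unfolding \<phi> using J(2) by (intro E.finsum_closed) (auto simp: homog_iff)
  ultimately show "\<phi> \<in> carrier E \<and> banded \<phi>" by simp
next
  assume "\<phi> \<in> carrier E \<and> banded \<phi>"
  then show "\<phi> \<in> gr_hom R S G"
    using sum_of_bands[of \<phi> "degs \<phi>"] band_homog
    by (auto simp: gr_hom_def banded_def)
qed

text \<open>The twist in the bracket is defined through homogeneous components.  They are the diagonals of the
  matrix of \<open>\<phi>\<close>, since a homogeneous operator has entries on one diagonal only.\<close>

lemma components_eq_band:
  assumes "\<phi> \<in> carrier E" "banded \<phi>"
  shows "components E (homog R S G) \<phi> = band \<phi>"
  unfolding components_def
proof (rule the_equality)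
  let ?D = "degs \<phi>"
  have sub: "{d. band \<phi> d \<noteq> \<zero>\<^bsub>E\<^esub>} \<subseteq> ?D"
  proof
    fix d assume d: "d \<in> {d. band \<phi> d \<noteq> \<zero>\<^bsub>E\<^esub>}"
    show "d \<in> ?D"
    proof (rule ccontr)
      assume "d \<notin> ?D"
      then have "band \<phi> d = \<zero>\<^bsub>E\<^esub>"
        using band_x[OF assms(1)] x_closed by (intro E_eqI band_closed assms(1)) (auto simp: E_app)
      with d show False by simp
    qed
  qed
  have fin: "finite {d. band \<phi> d \<noteq> \<zero>\<^bsub>E\<^esub>}" using sub assms(2) finite_subset by (auto simp: banded_def)
  have "(\<Oplus>\<^bsub>E\<^esub>d\<in>{d. band \<phi> d \<noteq> \<zero>\<^bsub>E\<^esub>}. band \<phi> d) = (\<Oplus>\<^bsub>E\<^esub>d\<in>?D. band \<phi> d)"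
    using sub assms band_closed[OF assms(1)]
    by (intro E.add.finprod_mono_neutral_cong_left) (auto simp: banded_def)
  then have "\<phi> = (\<Oplus>\<^bsub>E\<^esub>d\<in>{d. band \<phi> d \<noteq> \<zero>\<^bsub>E\<^esub>}. band \<phi> d)"
    using sum_of_bands[OF assms(1), of ?D] assms(2) by (simp add: banded_def)
  then show "(\<forall>d. band \<phi> d \<in> homog R S G d) \<and> finite {d. band \<phi> d \<noteq> \<zero>\<^bsub>E\<^esub>} \<and>
      \<phi> = (\<Oplus>\<^bsub>E\<^esub>d\<in>{d. band \<phi> d \<noteq> \<zero>\<^bsub>E\<^esub>}. band \<phi> d)"
    using band_homog[OF assms(1)] fin by simp
next
  fix c assume c: "(\<forall>d. c d \<in> homog R S G d) \<and> finite {d. c d \<noteq> \<zero>\<^bsub>E\<^esub>} \<and>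
      \<phi> = (\<Oplus>\<^bsub>E\<^esub>d\<in>{d. c d \<noteq> \<zero>\<^bsub>E\<^esub>}. c d)"
  show "c = band \<phi>"
  proof
    fix d
    have cE: "c d \<in> carrier E" using c by (simp add: homog_iff)
    show "c d = band \<phi> d"
    proof (rule E_eqI[OF cE band_closed[OF assms(1)]])
      fix m j assume m: "m \<in> I"
      have "\<phi> (x m) (m + d) = (if d \<in> {d. c d \<noteq> \<zero>\<^bsub>E\<^esub>} then c d (x m) (m + d) else \<zero>)"
        using homog_sum_x[of "{d. c d \<noteq> \<zero>\<^bsub>E\<^esub>}" c m d] c m by auto
      also have "\<dots> = c d (x m) (m + d)" using x_closed[OF m] by (auto simp: E_app)
      finally have "\<phi> (x m) (m + d) = c d (x m) (m + d)" .
      moreover have "c d (x m) j = \<zero>" if "j \<noteq> m + d" using c m that by (simp add: homog_iff)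
      ultimately show "c d (x m) j = band \<phi> d (x m) j" using band_x[OF assms(1) m] by auto
    qed
  qed
qed

lemma E_smult_closed:
  assumes "c \<in> carrier R" "\<phi> \<in> carrier E" shows "c \<odot>\<^bsub>E\<^esub> \<phi> \<in> carrier E"
proof -
  have "c \<odot>\<^bsub>S\<^esub> (d \<odot>\<^bsub>S\<^esub> f) = d \<odot>\<^bsub>S\<^esub> (c \<odot>\<^bsub>S\<^esub> f)" if "d \<in> carrier R" "f \<in> carrier S" for d f
    using that assms by (simp add: S.smult_assoc1[symmetric] m_comm)
  then show ?thesis using assms by (auto simp: lin_end_def S.smult_r_distr PiE_iff)
qed

subsection \<open>Multiplication operators\<close>

lemma mult_op_closed:
  assumes "s \<in> carrier S" shows "mult_op S s \<in> carrier E"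
proof -
  have "s \<otimes>\<^bsub>S\<^esub> (c \<odot>\<^bsub>S\<^esub> f) = c \<odot>\<^bsub>S\<^esub> (s \<otimes>\<^bsub>S\<^esub> f)" if "c \<in> carrier R" "f \<in> carrier S" for c f
    using that assms by (metis S.m_comm S.smult_assoc2 S.smult_closed)
  then show ?thesis using assms by (auto simp: E_carrier mult_op_def S.r_distr)
qed

lemma mult_op_x:
  assumes "s \<in> carrier S" "m \<in> I" shows "mult_op S s (x m) j = s (j - m)"
proof -
  have "(s \<otimes>\<^bsub>S\<^esub> x m) j = (x m \<otimes>\<^bsub>S\<^esub> s) j" using assms x_closed S.m_comm by metis
  also have "\<dots> = s (j - m)" using mon_mult_app[OF one_closed assms(2,1)] S_coeff[OF assms(1)] by simp
  finally show ?thesis using x_closed[OF assms(2)] by (simp add: mult_op_def)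
qed

lemma mult_op_banded: 
  assumes "s \<in> carrier S" shows "banded (mult_op S s)"
proof -
  have "degs (mult_op S s) \<subseteq> {d. s d \<noteq> \<zero>}"
    using mult_op_x[OF assms] by auto
  then show ?thesis using assms unfolding banded_def S_carrier by (meson finite_subset)
qed

lemma mult_op_left:
  assumes "\<phi> \<in> carrier E" "s \<in> carrier S" "m \<in> I"
  shows "(mult_op S s \<otimes>\<^bsub>E\<^esub> \<phi>) (x m) j = (\<Oplus>i\<in>{i. s i \<noteq> \<zero>}. s i \<otimes> \<phi> (x m) (j - i))"
proof -
  have "(s \<otimes>\<^bsub>S\<^esub> \<phi> (x m)) j = (\<Oplus>i\<in>{i. s i \<noteq> \<zero>}. s i \<otimes> \<phi> (x m) (j - i))"
    by (rule mult_app) (use assms E_maps x_closed in \<open>auto simp: S_carrier\<close>)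
  then show ?thesis using assms x_closed E_maps[OF assms(1) x_closed] by (simp add: E_app mult_op_def)
qed

lemma mult_op_right:
  assumes \<phi>: "\<phi> \<in> carrier E" and s: "s \<in> carrier S" and m: "m \<in> I"
  shows "(\<phi> \<otimes>\<^bsub>E\<^esub> mult_op S s) (x m) j = (\<Oplus>i\<in>{i. s i \<noteq> \<zero>}. s i \<otimes> \<phi> (x (m + i)) j)"
proof -
  let ?f = "mult_op S s (x m)" and ?F = "(\<lambda>i. m + i) ` {i. s i \<noteq> \<zero>}"
  have f: "?f \<in> carrier S" by (rule E_maps[OF mult_op_closed[OF s] x_closed[OF m]])
  have FI: "?F \<subseteq> I" using supp_I[OF s] m add_I by auto
  have "\<phi> ?f j = (\<Oplus>k\<in>?F. ?f k \<otimes> \<phi> (x k) j)"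
  proof (rule E_expand[OF \<phi> f _ _ FI])
    show "finite ?F" using s by (simp add: S_carrier)
    show "{k. ?f k \<noteq> \<zero>} \<subseteq> ?F"
    proof
      fix k assume "k \<in> {k. ?f k \<noteq> \<zero>}"
      then show "k \<in> ?F" using mult_op_x[OF s m] by (intro image_eqI[of _ _ "k - m"]) auto
    qed
  qed
  also have "\<dots> = (\<Oplus>i\<in>{i. s i \<noteq> \<zero>}. ?f (m + i) \<otimes> \<phi> (x (m + i)) j)"
    using FI E_x_coeff[OF \<phi>] S_coeff[OF f] by (subst finsum_reindex) auto
  also have "\<dots> = (\<Oplus>i\<in>{i. s i \<noteq> \<zero>}. s i \<otimes> \<phi> (x (m + i)) j)"
    using mult_op_x[OF s m] by simp
  finally show ?thesis using x_closed[OF m] by (simp add: E_app)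
qed

end

lemma (in monoid) Units_int_pow:
  fixes a b :: int
  assumes "q \<in> Units G"
  shows "q [^] a \<in> Units G" "q [^] (a + b) = q [^] a \<otimes> q [^] b" "q [^] (1::int) = q"
proof -
  have U: "group (units_of G)" by (rule units_group)
  have eq: "q [^]\<^bsub>units_of G\<^esub> z = q [^] z" for z :: int
    unfolding int_pow_def2 using assms units_of_pow[OF assms] units_of_inv[OF Units_pow_closed[OF assms]] by (simp del: pow_nat)
  have qU: "q \<in> carrier (units_of G)" using assms by (simp add: units_of_carrier)
  show "q [^] a \<in> Units G" using group.int_pow_closed[OF U qU, of a] unfolding eq units_of_carrier .
  show "q [^] (a + b) = q [^] a \<otimes> q [^] b" using group.int_pow_mult[OF U qU, of a b] unfolding eq units_of_mult .
  show "q [^] (1::int) = q" using group.int_pow_1[OF U qU] unfolding eq .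
qed

section \<open>The ring of \<open>q\<close>-differential operators when \<open>q - 1\<close> is nilpotent\<close>

context cring
begin

lemma poly_fun_diff_shift:
  assumes "poly_fun R (Suc k) p" "\<And>m. p m \<in> carrier R"
  shows "poly_fun R k (\<lambda>m. p (m + i) \<ominus> p m)"
proof -
  let ?d = "\<lambda>m. p (m + 1) \<ominus> p m"
  have d: "poly_fun R k ?d" using assms(1) by simp
  have nonneg: "poly_fun R k (\<lambda>m. p (m + int n) \<ominus> p m)" for n
  proof (induction n)
    case 0
    then show ?case using assms(2) poly_fun_zero by (simp add: minus_eq r_neg)
  next
    case (Suc n)
    have "poly_fun R k (\<lambda>m. ?d (m + int n) \<oplus> (p (m + int n) \<ominus> p m))"
      using assms(2) by (intro poly_fun_add Suc poly_fun_shift[OF d]) auto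
    moreover have "?d (m + int n) \<oplus> (p (m + int n) \<ominus> p m) = p (m + int (Suc n)) \<ominus> p m" for m
    proof -
      have e: "m + int (Suc n) = m + int n + 1" by simp
      show ?thesis unfolding e
        using assms(2)[of m] assms(2)[of "m + int n"] assms(2)[of "m + int n + 1"] by algebra
    qed
    ultimately show ?case by simp
  qed
  show ?thesis
  proof (cases "i \<ge> 0")
    case True
    then show ?thesis using nonneg[of "nat i"] by simp
  next
    case False
    then have "poly_fun R k (\<lambda>m. (\<ominus> \<one>) \<otimes> (p (m + i + int (nat (- i))) \<ominus> p (m + i)))"
      using assms(2) by (intro poly_fun_smult poly_fun_shift[OF nonneg]) auto
    moreover have "(\<ominus> \<one>) \<otimes> (p (m + i + int (nat (- i))) \<ominus> p (m + i)) = p (m + i) \<ominus> p m" for m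
    proof -
      have e: "m + i + int (nat (- i)) = m" using False by simp
      show ?thesis unfolding e using assms(2)[of m] assms(2)[of "m + i"] by algebra
    qed
    ultimately show ?thesis by simp
  qed
qed

text \<open>Since \<open>q - 1\<close> is nilpotent and divides \<open>q\<^sup>a - 1\<close>, the powers \<open>q\<^sup>a\<^sup>m\<close> depend polynomially
  on \<open>m\<close>.  This is what makes every \<open>q\<close>-differential operator an ordinary differential operator.\<close>

lemma poly_fun_unit_power:
  fixes a :: int
  assumes q: "q \<in> Units R" and nil: "(q \<ominus> \<one>) [^] n = \<zero>"
  shows "poly_fun R n (\<lambda>m. q [^] (a * m))"
proof -
  note pw = Units_int_pow[OF q]
  have cl: "q [^] z \<in> carrier R" for z :: int using pw(1) by blast
  have qc: "q \<in> carrier R" using q by blast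
  have dvd_nat: "\<exists>b\<in>carrier R. q [^] (int k) \<ominus> \<one> = (q \<ominus> \<one>) \<otimes> b" for k
  proof (induction k)
    case 0
    then show ?case using qc by (intro bexI[of _ \<zero>]) (auto simp: minus_eq r_neg)
  next
    case (Suc k)
    then obtain b where b: "b \<in> carrier R" "q [^] (int k) \<ominus> \<one> = (q \<ominus> \<one>) \<otimes> b" by blast
    have "q [^] (int (Suc k)) = q \<otimes> q [^] (int k)" using pw(2)[of 1 "int k"] pw(3) by simp
    then have "q [^] (int (Suc k)) \<ominus> \<one> = q \<otimes> (q [^] (int k) \<ominus> \<one>) \<oplus> (q \<ominus> \<one>)"
      using qc cl[of "int k"] by algebra
    also have "\<dots> = (q \<ominus> \<one>) \<otimes> (q \<otimes> b \<oplus> \<one>)" unfolding b(2) using qc b(1) by algebra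
    finally show ?case using qc b(1) by (intro bexI[of _ "q \<otimes> b \<oplus> \<one>"]) auto
  qed
  have "\<exists>b\<in>carrier R. q [^] a \<ominus> \<one> = (q \<ominus> \<one>) \<otimes> b"
  proof (cases "a \<ge> 0")
    case True
    then show ?thesis using dvd_nat[of "nat a"] by simp
  next
    case False
    then obtain b where b: "b \<in> carrier R" "q [^] (- a) \<ominus> \<one> = (q \<ominus> \<one>) \<otimes> b"
      using dvd_nat[of "nat (- a)"] by auto
    have "q [^] a \<otimes> q [^] (- a) = \<one>" using pw(2)[of a "- a"] by simp
    then have "q [^] a \<ominus> \<one> = (\<ominus> (q [^] a)) \<otimes> (q [^] (- a) \<ominus> \<one>)"
      using cl[of a] cl[of "- a"] by algebra
    also have "\<dots> = (q \<ominus> \<one>) \<otimes> (\<ominus> (q [^] a) \<otimes> b)" unfolding b(2) using qc b(1) cl[of a] by algebra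
    finally show ?thesis using b(1) cl by (intro bexI[of _ "\<ominus> (q [^] a) \<otimes> b"]) auto
  qed
  then obtain b where b: "b \<in> carrier R" "q [^] a \<ominus> \<one> = (q \<ominus> \<one>) \<otimes> b" by blast
  show ?thesis
  proof (rule poly_fun_geometric)
    fix m
    have "q [^] (a * (m + 1)) = q [^] a \<otimes> q [^] (a * m)"
      using pw(2)[of a "a * m"] by (simp add: algebra_simps)
    then show "q [^] (a * (m + 1)) \<ominus> q [^] (a * m) = (q [^] a \<ominus> \<one>) \<otimes> q [^] (a * m)"
      using cl[of a] cl[of "a * m"] by algebra
    have "(q [^] a \<ominus> \<one>) [^] n = \<zero>"
      unfolding b(2) using qc b(1) nil by (simp add: nat_pow_distrib)
    then show "(q [^] a \<ominus> \<one>) [^] n \<otimes> q [^] (a * m) = \<zero>" using cl by simp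
  qed (use cl in auto)
qed

end

context laurent_ops
begin

text \<open>The ordinary differential operators of order less than \<open>k\<close>.  The polynomial function \<open>p\<close> is taken
  on all integers rather than on \<open>I\<close>, so that operators on different half-lines can be compared.\<close>

definition diff_ord :: "nat \<Rightarrow> ((int \<Rightarrow> 'a) \<Rightarrow> int \<Rightarrow> 'a) set"
  where "diff_ord k = {\<phi> \<in> carrier E. banded \<phi> \<and>
    (\<forall>d. \<exists>p. (\<forall>m. p m \<in> carrier R) \<and> poly_fun R k p \<and> (\<forall>m\<in>I. \<phi> (x m) (m + d) = p m))}"

definition diff_ops :: "((int \<Rightarrow> 'a) \<Rightarrow> int \<Rightarrow> 'a) set"
  where "diff_ops = (\<Union>k. diff_ord k)"

lemma diff_ordE:
  assumes "\<phi> \<in> diff_ord k"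
  obtains P where "\<And>d m. P d m \<in> carrier R" "\<And>d. poly_fun R k (P d)"
    "\<And>d m. m \<in> I \<Longrightarrow> \<phi> (x m) (m + d) = P d m"
proof -
  have "\<forall>d. \<exists>p. (\<forall>m. p m \<in> carrier R) \<and> poly_fun R k p \<and> (\<forall>m\<in>I. \<phi> (x m) (m + d) = p m)"
    using assms by (simp add: diff_ord_def)
  then obtain P where "\<forall>d. (\<forall>m. P d m \<in> carrier R) \<and> poly_fun R k (P d) \<and> (\<forall>m\<in>I. \<phi> (x m) (m + d) = P d m)"
    by metis
  then show ?thesis using that by blast
qed

lemma diff_ordI:
  assumes "\<phi> \<in> carrier E" "finite (degs \<phi>)"
    "\<And>d m. P d m \<in> carrier R" "\<And>d. poly_fun R k (P d)"
    "\<And>d m. m \<in> I \<Longrightarrow> \<phi> (x m) (m + d) = P d m"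
  shows "\<phi> \<in> diff_ord k"
  using assms by (auto simp: diff_ord_def banded_def)

lemma diff_ord_closed: "\<phi> \<in> diff_ord k \<Longrightarrow> \<phi> \<in> carrier E"
  by (simp add: diff_ord_def)

lemma diff_ord_finite: "\<phi> \<in> diff_ord k \<Longrightarrow> finite (degs \<phi>)"
  by (simp add: diff_ord_def banded_def)

lemma diff_ord_mono: "k \<le> l \<Longrightarrow> diff_ord k \<subseteq> diff_ord l"
  unfolding diff_ord_def using poly_fun_mono by blast

lemma diff_ord_0: "\<phi> \<in> diff_ord 0 \<Longrightarrow> \<phi> = \<zero>\<^bsub>E\<^esub>"
proof (rule E_eqI)
  assume \<phi>: "\<phi> \<in> diff_ord 0"
  then show "\<phi> \<in> carrier E" by (rule diff_ord_closed)
  fix m j assume m: "m \<in> I"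
  obtain P where "\<And>d. poly_fun R 0 (P d)" "\<And>d m. m \<in> I \<Longrightarrow> \<phi> (x m) (m + d) = P d m"
    using diff_ordE[OF \<phi>] by metis
  then have "\<phi> (x m) (m + (j - m)) = \<zero>" using m by (metis poly_fun.simps(1))
  then show "\<phi> (x m) j = \<zero>\<^bsub>E\<^esub> (x m) j" using x_closed[OF m] by (simp add: E_app)
qed simp

lemma diff_ord_zero: "\<zero>\<^bsub>E\<^esub> \<in> diff_ord k"
  by (rule diff_ordI[where P = "\<lambda>_ _. \<zero>"]) (auto simp: E_app x_closed poly_fun_zero)

lemma diff_ord_add:
  assumes "\<phi> \<in> diff_ord k" "\<psi> \<in> diff_ord k" shows "\<phi> \<oplus>\<^bsub>E\<^esub> \<psi> \<in> diff_ord k"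
proof -
  obtain P where P: "\<And>d m. P d m \<in> carrier R" "\<And>d. poly_fun R k (P d)"
    "\<And>d m. m \<in> I \<Longrightarrow> \<phi> (x m) (m + d) = P d m" using diff_ordE[OF assms(1)] by blast
  obtain Q where Q: "\<And>d m. Q d m \<in> carrier R" "\<And>d. poly_fun R k (Q d)"
    "\<And>d m. m \<in> I \<Longrightarrow> \<psi> (x m) (m + d) = Q d m" using diff_ordE[OF assms(2)] by blast
  note app = E_app(1)[OF x_closed]
  show ?thesis
  proof (rule diff_ordI[where P = "\<lambda>d m. P d m \<oplus> Q d m"])
    show "\<phi> \<oplus>\<^bsub>E\<^esub> \<psi> \<in> carrier E" using assms diff_ord_closed by blast
    have "degs (\<phi> \<oplus>\<^bsub>E\<^esub> \<psi>) \<subseteq> degs \<phi> \<union> degs \<psi>"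
      using app E_x_coeff[OF diff_ord_closed[OF assms(1)]] by auto
    then show "finite (degs (\<phi> \<oplus>\<^bsub>E\<^esub> \<psi>))"
      using diff_ord_finite[OF assms(1)] diff_ord_finite[OF assms(2)] finite_subset by blast
    show "poly_fun R k (\<lambda>m. P d m \<oplus> Q d m)" for d using P Q by (intro poly_fun_add) auto
  qed (use P Q app in auto)
qed

lemma diff_ord_uminus:
  assumes "\<phi> \<in> diff_ord k" shows "\<ominus>\<^bsub>E\<^esub> \<phi> \<in> diff_ord k"
proof -
  obtain P where P: "\<And>d m. P d m \<in> carrier R" "\<And>d. poly_fun R k (P d)"
    "\<And>d m. m \<in> I \<Longrightarrow> \<phi> (x m) (m + d) = P d m" using diff_ordE[OF assms(1)] by blast
  note \<phi> = diff_ord_closed[OF assms]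
  note app = E_uminus_app[OF \<phi> x_closed]
  show ?thesis
  proof (rule diff_ordI[where P = "\<lambda>d m. (\<ominus> \<one>) \<otimes> P d m"])
    have "degs (\<ominus>\<^bsub>E\<^esub> \<phi>) \<subseteq> degs \<phi>"
    proof
      fix d assume "d \<in> degs (\<ominus>\<^bsub>E\<^esub> \<phi>)"
      then obtain m where m: "m \<in> I" "(\<ominus>\<^bsub>E\<^esub> \<phi>) (x m) (m + d) \<noteq> \<zero>" by blast
      have "\<phi> (x m) (m + d) \<noteq> \<zero>" using m(2) unfolding app[OF m(1)] by auto
      then show "d \<in> degs \<phi>" using m(1) by blast
    qed
    then show "finite (degs (\<ominus>\<^bsub>E\<^esub> \<phi>))"
      using diff_ord_finite[OF assms(1)] finite_subset by blast
    show "poly_fun R k (\<lambda>m. (\<ominus> \<one>) \<otimes> P d m)" for d using P by (intro poly_fun_smult) auto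
  qed (use P app \<phi> in \<open>auto simp: l_minus\<close>)
qed

text \<open>Products with a multiplication operator and commutators with it have coefficients of the same
  shape, a combination along the support of \<open>s\<close>; only the inner coefficients \<open>Q\<close> differ.\<close>

lemma diff_ord_combination:
  assumes \<phi>: "\<phi> \<in> diff_ord l" and s: "s \<in> carrier S" and \<psi>: "\<psi> \<in> carrier E"
    and \<psi>_x: "\<And>m d. m \<in> I \<Longrightarrow> \<psi> (x m) (m + d) = (\<Oplus>i\<in>{i. s i \<noteq> \<zero>}. s i \<otimes> Q (d - i) i m)"
    and Qc: "\<And>d i m. Q d i m \<in> carrier R" and Q_poly: "\<And>d i. poly_fun R k (Q d i)"
    and Q_degs: "\<And>d i m. m \<in> I \<Longrightarrow> i \<in> I \<Longrightarrow> Q d i m \<noteq> \<zero> \<Longrightarrow> d \<in> degs \<phi>"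
  shows "\<psi> \<in> diff_ord k"
proof (rule diff_ordI[OF \<psi>, where P = "\<lambda>d m. \<Oplus>i\<in>{i. s i \<noteq> \<zero>}. s i \<otimes> Q (d - i) i m"])
  let ?T = "{i. s i \<noteq> \<zero>}"
  have fin: "finite ?T" using s by (simp add: S_carrier)
  note sc = S_coeff[OF s]
  have "degs \<psi> \<subseteq> (\<lambda>(i, d). i + d) ` (?T \<times> degs \<phi>)" (is "?L \<subseteq> ?M")
  proof
    fix d assume "d \<in> ?L"
    then obtain m where m: "m \<in> I" "(\<Oplus>i\<in>?T. s i \<otimes> Q (d - i) i m) \<noteq> \<zero>" using \<psi>_x by auto
    have "\<exists>i\<in>?T. s i \<otimes> Q (d - i) i m \<noteq> \<zero>"
      using m(2) by (metis (mono_tags, lifting) add.finprod_one_eqI)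
    then obtain i where i: "i \<in> ?T" "s i \<otimes> Q (d - i) i m \<noteq> \<zero>" by blast
    have nz: "Q (d - i) i m \<noteq> \<zero>" using i(2) sc by auto
    have "i \<in> I" using i(1) supp_I[OF s] by blast
    from Q_degs[OF m(1) this nz] show "d \<in> ?M"
      using i(1) by (intro image_eqI[of _ _ "(i, d - i)"]) simp_all
  qed
  then show "finite ?L" using fin diff_ord_finite[OF \<phi>] by (meson finite_SigmaI finite_imageI finite_subset)
  show "poly_fun R k (\<lambda>m. \<Oplus>i\<in>?T. s i \<otimes> Q (d - i) i m)" for d
    using fin Qc Q_poly sc by (intro poly_fun_finsum poly_fun_smult) auto
  show "(\<Oplus>i\<in>?T. s i \<otimes> Q (d - i) i m) \<in> carrier R" for d m
    using Qc sc by (intro finsum_closed) auto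
qed (rule \<psi>_x)

lemma diff_ord_mult_left:
  assumes \<phi>: "\<phi> \<in> diff_ord k" and s: "s \<in> carrier S" shows "mult_op S s \<otimes>\<^bsub>E\<^esub> \<phi> \<in> diff_ord k"
proof -
  obtain P where P: "\<And>d m. P d m \<in> carrier R" "\<And>d. poly_fun R k (P d)"
    "\<And>d m. m \<in> I \<Longrightarrow> \<phi> (x m) (m + d) = P d m" using diff_ordE[OF \<phi>] by blast
  note \<phi>E = diff_ord_closed[OF \<phi>]
  show ?thesis
  proof (rule diff_ord_combination[OF \<phi> s, where Q = "\<lambda>d i. P d"])
    show "mult_op S s \<otimes>\<^bsub>E\<^esub> \<phi> \<in> carrier E" using \<phi>E mult_op_closed[OF s] by blast
    show "(mult_op S s \<otimes>\<^bsub>E\<^esub> \<phi>) (x m) (m + d) = (\<Oplus>i\<in>{i. s i \<noteq> \<zero>}. s i \<otimes> P (d - i) m)" if "m \<in> I" for m d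
      using mult_op_left[OF \<phi>E s that, of "m + d"] P(3)[OF that, of "d - i" for i] by (simp add: add_diff_eq)
    show "d \<in> degs \<phi>" if "m \<in> I" "P d m \<noteq> \<zero>" for d m
      unfolding mem_Collect_eq using that P(3)[OF that(1), of d] by (intro bexI[of _ m]) simp_all
  qed (rule P)+
qed

lemma diff_ord_mult_right:
  assumes \<phi>: "\<phi> \<in> diff_ord k" and s: "s \<in> carrier S" shows "\<phi> \<otimes>\<^bsub>E\<^esub> mult_op S s \<in> diff_ord k"
proof -
  obtain P where P: "\<And>d m. P d m \<in> carrier R" "\<And>d. poly_fun R k (P d)"
    "\<And>d m. m \<in> I \<Longrightarrow> \<phi> (x m) (m + d) = P d m" using diff_ordE[OF \<phi>] by blast
  note \<phi>E = diff_ord_closed[OF \<phi>]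
  show ?thesis
  proof (rule diff_ord_combination[OF \<phi> s, where Q = "\<lambda>d i m. P d (m + i)"])
    show "\<phi> \<otimes>\<^bsub>E\<^esub> mult_op S s \<in> carrier E" using \<phi>E mult_op_closed[OF s] by blast
    have P': "\<phi> (x (m + i)) (m + d) = P (d - i) (m + i)" if "m \<in> I" "i \<in> {i. s i \<noteq> \<zero>}" for m d i
    proof -
      have "m + i \<in> I" using that supp_I[OF s] add_I by blast
      from P(3)[OF this, of "d - i"] show ?thesis by simp
    qed
    show "(\<phi> \<otimes>\<^bsub>E\<^esub> mult_op S s) (x m) (m + d) = (\<Oplus>i\<in>{i. s i \<noteq> \<zero>}. s i \<otimes> P (d - i) (m + i))" if "m \<in> I" for m d
      using mult_op_right[OF \<phi>E s that, of "m + d"] P'[OF that] S_coeff[OF s] P(1)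
      by (auto intro!: finsum_cong')
    show "d \<in> degs \<phi>" if "m \<in> I" "i \<in> I" "P d (m + i) \<noteq> \<zero>" for d i m
      unfolding mem_Collect_eq using that(3) P(3)[OF add_I[OF that(1,2)], of d] add_I[OF that(1,2)]
      by (intro bexI[of _ "m + i"]) simp_all
    show "poly_fun R k (\<lambda>m. P d (m + i))" for d i by (rule poly_fun_shift[OF P(2)])
  qed (rule P)
qed

lemma diff_ops_sub_bimodule: "sub_bimodule R S G diff_ops"
proof -
  have "additive_subgroup diff_ops E"
  proof (intro additive_subgroup.intro subgroup.intro)
    show "diff_ops \<subseteq> carrier (add_monoid E)" using diff_ord_closed by (auto simp: diff_ops_def)
    show "\<one>\<^bsub>add_monoid E\<^esub> \<in> diff_ops" using diff_ord_zero by (auto simp: diff_ops_def)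
    fix \<phi> assume "\<phi> \<in> diff_ops"
    then obtain k where k: "\<phi> \<in> diff_ord k" by (auto simp: diff_ops_def)
    show "inv\<^bsub>add_monoid E\<^esub> \<phi> \<in> diff_ops"
      using diff_ord_uminus[OF k] by (auto simp: diff_ops_def a_inv_def)
    fix \<psi> assume "\<psi> \<in> diff_ops"
    then obtain l where l: "\<psi> \<in> diff_ord l" by (auto simp: diff_ops_def)
    have "\<phi> \<in> diff_ord (max k l)" "\<psi> \<in> diff_ord (max k l)"
      using k l diff_ord_mono[of k "max k l"] diff_ord_mono[of l "max k l"] by auto
    then show "\<phi> \<otimes>\<^bsub>add_monoid E\<^esub> \<psi> \<in> diff_ops"
      using diff_ord_add by (auto simp: diff_ops_def)
  qed
  moreover have "diff_ops \<subseteq> gr_hom R S G"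
    by (auto simp: diff_ops_def gr_hom_iff diff_ord_def)
  moreover have "mult_op S s \<otimes>\<^bsub>E\<^esub> \<phi> \<in> diff_ops" "\<phi> \<otimes>\<^bsub>E\<^esub> mult_op S s \<in> diff_ops"
    if s: "s \<in> carrier S" and \<phi>: "\<phi> \<in> diff_ops" for s \<phi>
  proof -
    obtain k where k: "\<phi> \<in> diff_ord k" using \<phi> unfolding diff_ops_def by blast
    show "mult_op S s \<otimes>\<^bsub>E\<^esub> \<phi> \<in> diff_ops" "\<phi> \<otimes>\<^bsub>E\<^esub> mult_op S s \<in> diff_ops"
      unfolding diff_ops_def using diff_ord_mult_left[OF k s] diff_ord_mult_right[OF k s] by blast+
  qed
  ultimately show ?thesis by (simp add: sub_bimodule_def)
qed

end

locale q_laurent_ops = laurent_ops R I for R (structure) and I +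
  fixes q :: 'a and n :: nat
  assumes q_unit: "q \<in> Units R" and q_nilpotent: "(q \<ominus> \<one>) [^] n = \<zero>"
begin

abbreviation "twist a s \<equiv> (\<lambda>d. q [^] (a * d) \<otimes> s d)"

lemma q_pow_closed: "q [^] (z::int) \<in> carrier R"
  using Units_int_pow(1)[OF q_unit] by blast

lemma twist_closed:
  assumes "s \<in> carrier S" shows "twist (a::int) s \<in> carrier S"
proof -
  have "{j. twist a s j \<noteq> \<zero>} \<subseteq> {j. s j \<noteq> \<zero>}" using q_pow_closed by auto
  then have "finite {j. twist a s j \<noteq> \<zero>}" using assms unfolding S_carrier by (meson finite_subset)
  then show ?thesis using assms q_pow_closed by (simp add: S_carrier)
qed

lemma sigma_tw_mult_op:
  assumes s: "s \<in> carrier S"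
  shows "sigma_tw R S G q a (mult_op S s) = mult_op S (twist a s)"
proof -
  let ?\<psi> = "mult_op S s" and ?c = "band (mult_op S s)"
  let ?J = "{d. ?c d \<noteq> \<zero>\<^bsub>E\<^esub>}"
  note \<psi> = mult_op_closed[OF s]
  have eq: "sigma_tw R S G q a ?\<psi> = (\<Oplus>\<^bsub>E\<^esub>d\<in>?J. (q [^] (a * d)) \<odot>\<^bsub>E\<^esub> ?c d)"
    unfolding sigma_tw_def Let_def components_eq_band[OF \<psi> mult_op_banded[OF s]] ..
  have J: "?J \<subseteq> {d. s d \<noteq> \<zero>}"
  proof (rule subsetI, rule ccontr)
    fix d assume d: "d \<in> ?J" and "d \<notin> {d. s d \<noteq> \<zero>}"
    then have "?c d = \<zero>\<^bsub>E\<^esub>"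
      using band_x[OF \<psi>] mult_op_x[OF s] x_closed
      by (intro E_eqI band_closed \<psi>) (auto simp: E_app)
    with d show False by simp
  qed
  then have finJ: "finite ?J" using s unfolding S_carrier by (meson finite_subset)
  have hom: "(q [^] (a * d)) \<odot>\<^bsub>E\<^esub> ?c d \<in> homog R S G d" for d
    using E_smult_closed[OF q_pow_closed band_closed[OF \<psi>]] band_x[OF \<psi>] x_closed q_pow_closed
    by (auto simp: homog_iff E_app)
  show ?thesis
  proof (rule E_eqI)
    show "sigma_tw R S G q a ?\<psi> \<in> carrier E" unfolding eq
      using E_smult_closed[OF q_pow_closed band_closed[OF \<psi>]] by (intro E.finsum_closed) auto
    show "mult_op S (twist a s) \<in> carrier E" by (rule mult_op_closed[OF twist_closed[OF s]])
    fix m j assume m: "m \<in> I"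
    have "sigma_tw R S G q a ?\<psi> (x m) (m + (j - m)) =
        (if j - m \<in> ?J then ((q [^] (a * (j - m))) \<odot>\<^bsub>E\<^esub> ?c (j - m)) (x m) (m + (j - m)) else \<zero>)"
      unfolding eq by (rule homog_sum_x[OF finJ hom m])
    also have "\<dots> = ((q [^] (a * (j - m))) \<odot>\<^bsub>E\<^esub> ?c (j - m)) (x m) (m + (j - m))"
      using x_closed[OF m] q_pow_closed by (auto simp: E_app)
    also have "\<dots> = q [^] (a * (j - m)) \<otimes> s (j - m)"
      using x_closed[OF m] band_x[OF \<psi> m] mult_op_x[OF s m] by (simp add: E_app)
    finally show "sigma_tw R S G q a ?\<psi> (x m) j = mult_op S (twist a s) (x m) j"
      using mult_op_x[OF twist_closed[OF s] m] by simp
  qed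
qed

lemma q_bracket_closed:
  assumes "\<phi> \<in> carrier E" "s \<in> carrier S"
  shows "q_bracket R S G q a \<phi> (mult_op S s) \<in> carrier E"
  unfolding q_bracket_def sigma_tw_mult_op[OF assms(2)]
  using assms mult_op_closed twist_closed[OF assms(2)] by auto

lemma q_bracket_x:
  assumes \<phi>: "\<phi> \<in> carrier E" and s: "s \<in> carrier S" and m: "m \<in> I"
  shows "q_bracket R S G q a \<phi> (mult_op S s) (x m) j =
    (\<Oplus>i\<in>{i. s i \<noteq> \<zero>}. s i \<otimes> (\<phi> (x (m + i)) j \<ominus> q [^] (a * i) \<otimes> \<phi> (x m) (j - i)))"
proof -
  let ?T = "{i. s i \<noteq> \<zero>}"
  have fin: "finite ?T" using s by (simp add: S_carrier)
  have mI: "m + i \<in> I" if "i \<in> ?T" for i using that m supp_I[OF s] add_I by blast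
  note sc = S_coeff[OF s] and pc = E_x_coeff[OF \<phi> mI] E_x_coeff[OF \<phi> m]
  have 1: "(\<phi> \<otimes>\<^bsub>E\<^esub> mult_op S s) (x m) j = (\<Oplus>i\<in>?T. s i \<otimes> \<phi> (x (m + i)) j)"
    by (rule mult_op_right[OF \<phi> s m])
  have "(mult_op S (twist a s) \<otimes>\<^bsub>E\<^esub> \<phi>) (x m) j = (twist a s \<otimes>\<^bsub>S\<^esub> \<phi> (x m)) j"
    using x_closed[OF m] E_maps[OF \<phi>] by (simp add: E_app mult_op_def)
  also have "\<dots> = (\<Oplus>i\<in>?T. (q [^] (a * i) \<otimes> s i) \<otimes> \<phi> (x m) (j - i))"
    by (rule mult_app[OF twist_closed[OF s] E_maps[OF \<phi> x_closed[OF m]] fin]) (use q_pow_closed in auto)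
  finally have 2: "(mult_op S (twist a s) \<otimes>\<^bsub>E\<^esub> \<phi>) (x m) j = (\<Oplus>i\<in>?T. (q [^] (a * i) \<otimes> s i) \<otimes> \<phi> (x m) (j - i))" .
  have "q_bracket R S G q a \<phi> (mult_op S s) (x m) j =
      (\<phi> \<otimes>\<^bsub>E\<^esub> mult_op S s) (x m) j \<ominus> (mult_op S (twist a s) \<otimes>\<^bsub>E\<^esub> \<phi>) (x m) j"
    unfolding q_bracket_def sigma_tw_mult_op[OF s]
    using \<phi> mult_op_closed[OF s] mult_op_closed[OF twist_closed[OF s]] x_closed[OF m]
    by (intro E_minus_app) auto
  also have "\<dots> = (\<Oplus>i\<in>?T. s i \<otimes> \<phi> (x (m + i)) j) \<oplus>
      (\<ominus> \<one>) \<otimes> (\<Oplus>i\<in>?T. (q [^] (a * i) \<otimes> s i) \<otimes> \<phi> (x m) (j - i))"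
    unfolding 1 2 using sc pc q_pow_closed by (subst minus_eq, subst l_minus) (auto intro!: finsum_closed)
  also have "(\<ominus> \<one>) \<otimes> (\<Oplus>i\<in>?T. (q [^] (a * i) \<otimes> s i) \<otimes> \<phi> (x m) (j - i)) =
      (\<Oplus>i\<in>?T. (\<ominus> \<one>) \<otimes> ((q [^] (a * i) \<otimes> s i) \<otimes> \<phi> (x m) (j - i)))"
    using sc pc q_pow_closed fin by (intro finsum_rdistr) auto
  also have "(\<Oplus>i\<in>?T. s i \<otimes> \<phi> (x (m + i)) j) \<oplus> (\<Oplus>i\<in>?T. (\<ominus> \<one>) \<otimes> ((q [^] (a * i) \<otimes> s i) \<otimes> \<phi> (x m) (j - i))) =
      (\<Oplus>i\<in>?T. s i \<otimes> \<phi> (x (m + i)) j \<oplus> (\<ominus> \<one>) \<otimes> ((q [^] (a * i) \<otimes> s i) \<otimes> \<phi> (x m) (j - i)))"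
    using sc pc q_pow_closed by (intro finsum_addf[symmetric]) auto
  also have "\<dots> = (\<Oplus>i\<in>?T. s i \<otimes> (\<phi> (x (m + i)) j \<ominus> q [^] (a * i) \<otimes> \<phi> (x m) (j - i)))"
  proof (intro finsum_cong' refl)
    fix i assume i: "i \<in> ?T"
    show "s i \<otimes> \<phi> (x (m + i)) j \<oplus> (\<ominus> \<one>) \<otimes> ((q [^] (a * i) \<otimes> s i) \<otimes> \<phi> (x m) (j - i)) =
        s i \<otimes> (\<phi> (x (m + i)) j \<ominus> q [^] (a * i) \<otimes> \<phi> (x m) (j - i))"
      using sc[of i] pc(1)[OF i, of j] pc(2)[of "j - i"] q_pow_closed[of "a * i"] by algebra
  qed (use sc pc q_pow_closed in auto)
  finally show ?thesis .
qed

text \<open>With \<open>a = 0\<close> the bracket is the ordinary commutator, which lowers the order.\<close>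

lemma commutator_diff_ord:
  assumes \<phi>: "\<phi> \<in> diff_ord (Suc k)" and s: "s \<in> carrier S"
  shows "q_bracket R S G q 0 \<phi> (mult_op S s) \<in> diff_ord k"
proof -
  obtain P where P: "\<And>d m. P d m \<in> carrier R" "\<And>d. poly_fun R (Suc k) (P d)"
    "\<And>d m. m \<in> I \<Longrightarrow> \<phi> (x m) (m + d) = P d m" using diff_ordE[OF \<phi>] by blast
  let ?T = "{i. s i \<noteq> \<zero>}" and ?\<beta> = "q_bracket R S G q 0 \<phi> (mult_op S s)"
  note \<phi>E = diff_ord_closed[OF \<phi>] and sc = S_coeff[OF s]
  have eq: "?\<beta> (x m) (m + d) = (\<Oplus>i\<in>?T. s i \<otimes> (P (d - i) (m + i) \<ominus> P (d - i) m))" if m: "m \<in> I" for m d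
  proof -
    have "?\<beta> (x m) (m + d) = (\<Oplus>i\<in>?T. s i \<otimes> (\<phi> (x (m + i)) (m + d) \<ominus> q [^] (0 * i) \<otimes> \<phi> (x m) (m + d - i)))"
      by (rule q_bracket_x[OF \<phi>E s m])
    also have "\<dots> = (\<Oplus>i\<in>?T. s i \<otimes> (P (d - i) (m + i) \<ominus> P (d - i) m))"
    proof (intro finsum_cong' refl)
      fix i assume "i \<in> ?T"
      then have "m + i \<in> I" using m supp_I[OF s] add_I by blast
      from P(3)[OF this, of "d - i"] P(3)[OF m, of "d - i"] P(1)
      show "s i \<otimes> (\<phi> (x (m + i)) (m + d) \<ominus> q [^] (0 * i) \<otimes> \<phi> (x m) (m + d - i)) =
          s i \<otimes> (P (d - i) (m + i) \<ominus> P (d - i) m)"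
        by (simp add: add_diff_eq)
    qed (use sc P(1) in auto)
    finally show ?thesis .
  qed
  show ?thesis
  proof (rule diff_ord_combination[OF \<phi> s q_bracket_closed[OF \<phi>E s] eq])
    show "poly_fun R k (\<lambda>m. P d (m + i) \<ominus> P d m)" for d i by (rule poly_fun_diff_shift[OF P(2,1)])
    show "d \<in> degs \<phi>"
      if "m \<in> I" "i \<in> I" "P d (m + i) \<ominus> P d m \<noteq> \<zero>" for d i m
    proof -
      have "P d (m + i) \<noteq> \<zero> \<or> P d m \<noteq> \<zero>" using that(3) by (auto simp: minus_eq)
      then have "\<exists>m\<in>I. P d m \<noteq> \<zero>" using that(1) add_I[OF that(1,2)] by blast
      then show ?thesis using P(3) by auto
    qed
  qed (use P(1) in auto)
qed

lemma band_diff_ord: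
  assumes \<phi>: "\<phi> \<in> diff_ord k" shows "band \<phi> d \<in> diff_ord k"
proof -
  obtain P where P: "\<And>d m. P d m \<in> carrier R" "\<And>d. poly_fun R k (P d)"
    "\<And>d m. m \<in> I \<Longrightarrow> \<phi> (x m) (m + d) = P d m" using diff_ordE[OF \<phi>] by blast
  note \<phi>E = diff_ord_closed[OF \<phi>]
  show ?thesis
  proof (rule diff_ordI[where P = "\<lambda>e m. if e = d then P e m else \<zero>"])
    have "{e. \<exists>m\<in>I. band \<phi> d (x m) (m + e) \<noteq> \<zero>} \<subseteq> {d}" using band_x[OF \<phi>E] by auto
    then show "finite {e. \<exists>m\<in>I. band \<phi> d (x m) (m + e) \<noteq> \<zero>}" by (rule finite_subset) simp
    show "poly_fun R k (\<lambda>m. if e = d then P e m else \<zero>)" for e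
      using P(2) poly_fun_zero by (cases "e = d") auto
  qed (use P band_x[OF \<phi>E] band_closed[OF \<phi>E] in auto)
qed

lemma finsum_additive_subgroup:
  assumes "additive_subgroup M E" "finite J" "\<And>d. d \<in> J \<Longrightarrow> c d \<in> M"
  shows "(\<Oplus>\<^bsub>E\<^esub>d\<in>J. c d) \<in> M"
  using assms(2,3)
proof (induction J)
  case empty
  then show ?case using additive_subgroup.zero_closed[OF assms(1)] by simp
next
  case (insert a J)
  have "M \<subseteq> carrier E" using additive_subgroup.a_subset[OF assms(1)] .
  then have "(\<Oplus>\<^bsub>E\<^esub>d\<in>insert a J. c d) = c a \<oplus>\<^bsub>E\<^esub> (\<Oplus>\<^bsub>E\<^esub>d\<in>J. c d)"
    using insert by (intro E.finsum_insert) auto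
  then show ?case using insert additive_subgroup.a_closed[OF assms(1)] by simp
qed

text \<open>The bimodules of the definition are generated by homogeneous operators, so membership can be tested
  on homogeneous parts.\<close>

lemma mem_sub_bimodule_if_bands:
  assumes M: "sub_bimodule R S G M" and \<phi>: "\<phi> \<in> diff_ord k" and "\<And>d. band \<phi> d \<in> M"
  shows "\<phi> \<in> M"
proof -
  have "(\<Oplus>\<^bsub>E\<^esub>d\<in>degs \<phi>. band \<phi> d) \<in> M"
    using M diff_ord_finite[OF \<phi>] assms(3) by (intro finsum_additive_subgroup) (auto simp: sub_bimodule_def)
  then show ?thesis
    using sum_of_bands[OF diff_ord_closed[OF \<phi>] diff_ord_finite[OF \<phi>] subset_refl] by simp
qed

lemma diff_ord_subset_level: "diff_ord (Suc k) \<subseteq> q_diff_ops_level R S G q k"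
proof (induction k)
  case 0
  show ?case
    unfolding q_diff_ops_level.simps hull_def
  proof (intro subsetI InterI, elim CollectE conjE)
    fix \<phi> M assume \<phi>: "\<phi> \<in> diff_ord (Suc 0)" and M: "sub_bimodule R S G M"
      and gen: "{\<phi>. (\<exists>d. \<phi> \<in> homog R S G d) \<and>
        (\<exists>a. \<forall>s\<in>carrier S. q_bracket R S G q a \<phi> (mult_op S s) = \<zero>\<^bsub>E\<^esub>)} \<subseteq> M"
    show "\<phi> \<in> M"
      using gen band_homog[OF diff_ord_closed[OF \<phi>]]
        diff_ord_0[OF commutator_diff_ord[OF band_diff_ord[OF \<phi>]]]
      by (intro mem_sub_bimodule_if_bands[OF M \<phi>]) blast
  qed
next
  case (Suc k)
  show ?case
    unfolding q_diff_ops_level.simps hull_def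
  proof (intro subsetI InterI, elim CollectE conjE)
    fix \<phi> M assume \<phi>: "\<phi> \<in> diff_ord (Suc (Suc k))" and M: "sub_bimodule R S G M"
      and gen: "{\<phi>. (\<exists>d. \<phi> \<in> homog R S G d) \<and>
        (\<exists>a. \<forall>s\<in>carrier S. q_bracket R S G q a \<phi> (mult_op S s) \<in> q_diff_ops_level R S G q k)} \<subseteq> M"
    show "\<phi> \<in> M"
      using gen band_homog[OF diff_ord_closed[OF \<phi>]] Suc commutator_diff_ord[OF band_diff_ord[OF \<phi>]]
      by (intro mem_sub_bimodule_if_bands[OF M \<phi>]) blast
  qed
qed

text \<open>A solution of the recurrence \<open>p (m + 1) = q\<^sup>a p m + g m\<close> with polynomial \<open>g\<close> is polynomial:
  \<open>p m = q\<^sup>a\<^sup>m s m\<close> where \<open>s\<close> has the polynomial difference \<open>q\<^sup>-\<^sup>a\<^sup>(\<^sup>m\<^sup>+\<^sup>1\<^sup>) g m\<close>.\<close>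

lemma poly_fun_recurrence:
  fixes a :: int
  assumes p: "\<And>m. m \<in> I \<Longrightarrow> p m \<in> carrier R"
    and g: "\<And>m. g m \<in> carrier R" "poly_fun R k g"
    and rec: "\<And>m. m \<in> I \<Longrightarrow> m + 1 \<in> I \<Longrightarrow> p (m + 1) \<ominus> q [^] a \<otimes> p m = g m"
  obtains p' l where "\<And>m. p' m \<in> carrier R" "poly_fun R l p'" "\<And>m. m \<in> I \<Longrightarrow> p m = p' m"
proof -
  note pw = Units_int_pow(2)[OF q_unit] and cl = q_pow_closed
  let ?h = "\<lambda>m. q [^] ((- a) * (m + 1)) \<otimes> g m"
  have h: "?h m \<in> carrier R" for m using cl g(1) by simp
  have h_poly: "poly_fun R (n + k) ?h"
    using poly_fun_unit_power[OF q_unit q_nilpotent, of "- a"] cl g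
    by (intro poly_fun_mult poly_fun_shift[where p = "\<lambda>m. q [^] ((- a) * m)"]) auto
  obtain s where s: "\<And>m. s m \<in> carrier R" "s 0 = p 0" "\<And>m. s (m + 1) \<ominus> s m = ?h m"
    by (rule exists_antidifference[of "p 0" ?h, OF p[OF zero_I] h]) (rule that)
  have s_poly: "poly_fun R (Suc (n + k)) s" using h_poly s(3) by simp
  define p' where "p' m = q [^] (a * m) \<otimes> s m" for m
  have p'c: "p' m \<in> carrier R" for m unfolding p'_def using cl s(1) by simp
  have p'_poly: "poly_fun R (n + Suc (n + k)) p'"
    unfolding p'_def using cl s(1) poly_fun_unit_power[OF q_unit q_nilpotent, of a] s_poly
    by (intro poly_fun_mult) auto
  have p'_rec: "p' (m + 1) = g m \<oplus> q [^] a \<otimes> p' m" for m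
  proof -
    have e1: "q [^] (a * (m + 1)) = q [^] a \<otimes> q [^] (a * m)" using pw[of a "a * m"] by (simp add: algebra_simps)
    have e2: "q [^] (a * (m + 1)) \<otimes> q [^] ((- a) * (m + 1)) = \<one>"
      using pw[of "a * (m + 1)" "(- a) * (m + 1)"] by simp
    have "s (m + 1) = ?h m \<oplus> s m"
      using s(3)[of m, symmetric] s(1)[of m] s(1)[of "m + 1"] by algebra
    then have "p' (m + 1) = q [^] (a * (m + 1)) \<otimes> (?h m \<oplus> s m)" unfolding p'_def by simp
    also have "\<dots> = (q [^] (a * (m + 1)) \<otimes> q [^] ((- a) * (m + 1))) \<otimes> g m \<oplus> q [^] (a * (m + 1)) \<otimes> s m"
      using cl[of "a * (m + 1)"] cl[of "(- a) * (m + 1)"] g(1)[of m] s(1)[of m] by algebra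
    also have "\<dots> = g m \<oplus> q [^] a \<otimes> p' m"
      unfolding e2 p'_def unfolding e1 using cl[of a] cl[of "a * m"] g(1)[of m] s(1)[of m] by algebra
    finally show ?thesis .
  qed
  have p_rec: "p (m + 1) = g m \<oplus> q [^] a \<otimes> p m" if "m \<in> I" "m + 1 \<in> I" for m
    using rec[OF that, symmetric] p[OF that(1)] p[OF that(2)] cl[of a] by algebra
  have p'0: "p' 0 = p 0" unfolding p'_def using s(2) p[OF zero_I] by simp
  have up: "p (int j) = p' (int j)" if "int j \<in> I" for j
    using that
  proof (induction j)
    case 0
    then show ?case using p'0 by simp
  next
    case (Suc j)
    then have "int j \<in> I" "int j + 1 \<in> I" using ray by auto
    then show ?case using p_rec[of "int j"] p'_rec[of "int j"] Suc.IH by (simp add: add.commute)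
  qed
  have down: "p (- int j) = p' (- int j)" if "- int j \<in> I" for j
    using that
  proof (induction j)
    case 0
    then show ?case using p'0 by simp
  next
    case (Suc j)
    obtain k where k: "k = - int (Suc j)" by simp
    have I: "k \<in> I" "k + 1 \<in> I" and e: "k + 1 = - int j" using Suc.prems ray k by auto
    have "p (k + 1) = p' (k + 1)" unfolding e using Suc.IH I(2) unfolding e by simp
    then have "g k \<oplus> q [^] a \<otimes> p k = g k \<oplus> q [^] a \<otimes> p' k" unfolding p_rec[OF I] p'_rec .
    then have "q [^] a \<otimes> p k = q [^] a \<otimes> p' k" using g(1) cl p[OF I(1)] p'c by simp
    then have "q [^] (- a) \<otimes> q [^] a \<otimes> p k = q [^] (- a) \<otimes> q [^] a \<otimes> p' k"
      using cl p[OF I(1)] p'c by (simp add: m_assoc)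
    then have "p k = p' k" using pw[of "- a" a, symmetric] p[OF I(1)] p'c by simp
    then show ?case unfolding k .
  qed
  have "p m = p' m" if "m \<in> I" for m
    using up[of "nat m"] down[of "nat (- m)"] that by (cases "m \<ge> 0") auto
  from that[OF p'c p'_poly this] show ?thesis .
qed

text \<open>Bracketing with \<open>x\<close> or \<open>x\<inverse>\<close>, whichever belongs to the ring, turns the hypothesis into a recurrence
  for the only nonzero diagonal of \<open>\<phi>\<close>.\<close>

lemma diff_ops_if_bracket:
  assumes hom: "\<phi> \<in> homog R S G d"
    and br: "\<And>s. s \<in> carrier S \<Longrightarrow> q_bracket R S G q a \<phi> (mult_op S s) \<in> diff_ops"
  shows "\<phi> \<in> diff_ops"
proof -
  have \<phi>: "\<phi> \<in> carrier E" and off: "\<And>m j. m \<in> I \<Longrightarrow> j \<noteq> m + d \<Longrightarrow> \<phi> (x m) j = \<zero>"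
    using hom by (auto simp: homog_iff)
  define p where "p m = \<phi> (x m) (m + d)" for m
  have pc: "p m \<in> carrier R" if "m \<in> I" for m unfolding p_def by (rule E_x_coeff[OF \<phi> that])
  have br_x: "\<exists>g k. (\<forall>m. g m \<in> carrier R) \<and> poly_fun R k g \<and>
      (\<forall>m\<in>I. p (m + i) \<ominus> q [^] (a * i) \<otimes> p m = g m)" if i: "i \<in> I" for i
  proof -
    obtain k where "q_bracket R S G q a \<phi> (mult_op S (x i)) \<in> diff_ord k"
      using br[OF x_closed[OF i]] by (auto simp: diff_ops_def)
    then obtain P where P: "\<And>d m. P d m \<in> carrier R" "\<And>d. poly_fun R k (P d)"
      "\<And>d m. m \<in> I \<Longrightarrow> q_bracket R S G q a \<phi> (mult_op S (x i)) (x m) (m + d) = P d m"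
      using diff_ordE by metis
    have "p (m + i) \<ominus> q [^] (a * i) \<otimes> p m = P (d + i) m" if m: "m \<in> I" for m
    proof -
      have mi: "m + i \<in> I" by (rule add_I[OF m i])
      let ?t = "\<lambda>k. x i k \<otimes> (\<phi> (x (m + k)) (m + (d + i)) \<ominus> q [^] (a * k) \<otimes> \<phi> (x m) (m + (d + i) - k))"
      have tc: "p (m + i) \<ominus> q [^] (a * i) \<otimes> p m \<in> carrier R" using pc m mi q_pow_closed by simp
      have yc: "\<phi> (x (m + i)) (m + (d + i)) \<ominus> q [^] (a * i) \<otimes> \<phi> (x m) (m + (d + i) - i) \<in> carrier R"
        using E_x_coeff[OF \<phi> mi] E_x_coeff[OF \<phi> m] q_pow_closed by simp
      have ti: "?t i = p (m + i) \<ominus> q [^] (a * i) \<otimes> p m"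
        using tc by (simp add: mon_def p_def algebra_simps)
      have "P (d + i) m = (\<Oplus>k\<in>{k. x i k \<noteq> \<zero>}. ?t k)"
        using P(3)[OF m, of "d + i"] q_bracket_x[OF \<phi> x_closed[OF i] m, of a "m + (d + i)"] by simp
      also have "\<dots> = (\<Oplus>k\<in>{i}. ?t k)"
        using tc ti l_null[OF yc] by (intro add.finprod_mono_neutral_cong_left) (auto simp: mon_def)
      also have "\<dots> = p (m + i) \<ominus> q [^] (a * i) \<otimes> p m" using tc ti by simp
      finally show ?thesis by simp
    qed
    then show ?thesis using P by blast
  qed
  have "\<exists>g k. (\<forall>m. g m \<in> carrier R) \<and> poly_fun R k g \<and>
      (\<forall>m. m \<in> I \<longrightarrow> m + 1 \<in> I \<longrightarrow> p (m + 1) \<ominus> q [^] a \<otimes> p m = g m)"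
  proof (cases "1 \<in> I")
    case True
    then show ?thesis using br_x[OF True] by auto
  next
    case False
    then have "-1 \<in> I" using ray by auto
    then obtain g k where g: "\<And>m. g m \<in> carrier R" "poly_fun R k g"
      "\<And>m. m \<in> I \<Longrightarrow> p (m - 1) \<ominus> q [^] (- a) \<otimes> p m = g m"
      using br_x[of "-1"] by auto
    let ?g = "\<lambda>m. (\<ominus> (q [^] a)) \<otimes> g (m + 1)"
    have "poly_fun R k ?g" using g q_pow_closed by (intro poly_fun_smult poly_fun_shift) auto
    moreover have "p (m + 1) \<ominus> q [^] a \<otimes> p m = ?g m" if m: "m \<in> I" "m + 1 \<in> I" for m
    proof -
      have e: "q [^] a \<otimes> q [^] (- a) = \<one>" using Units_int_pow(2)[OF q_unit, of a "- a"] by simp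
      have "?g m = (q [^] a \<otimes> q [^] (- a)) \<otimes> p (m + 1) \<ominus> q [^] a \<otimes> p m"
        unfolding g(3)[OF m(2), symmetric]
        using pc[OF m(1)] pc[OF m(2)] q_pow_closed[of a] q_pow_closed[of "- a"] by simp algebra
      then show ?thesis unfolding e using pc[OF m(2)] by simp
    qed
    moreover have "?g m \<in> carrier R" for m using g(1) q_pow_closed by simp
    ultimately show ?thesis by (intro exI[of _ ?g] exI[of _ k]) simp
  qed
  then obtain g k where g: "\<And>m. g m \<in> carrier R" "poly_fun R k g"
    "\<And>m. m \<in> I \<Longrightarrow> m + 1 \<in> I \<Longrightarrow> p (m + 1) \<ominus> q [^] a \<otimes> p m = g m" by blast
  obtain p' l where p': "\<And>m. p' m \<in> carrier R" "poly_fun R l p'" "\<And>m. m \<in> I \<Longrightarrow> p m = p' m"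
    by (rule poly_fun_recurrence[OF pc g]; (rule that)?)
  have "\<phi> \<in> diff_ord l"
  proof (rule diff_ordI[OF \<phi>, where P = "\<lambda>e m. if e = d then p' m else \<zero>"])
    have "{e. \<exists>m\<in>I. \<phi> (x m) (m + e) \<noteq> \<zero>} \<subseteq> {d}"
    proof
      fix e assume "e \<in> {e. \<exists>m\<in>I. \<phi> (x m) (m + e) \<noteq> \<zero>}"
      then obtain m where "m \<in> I" "\<phi> (x m) (m + e) \<noteq> \<zero>" by blast
      with off[of m "m + e"] show "e \<in> {d}" by auto
    qed
    then show "finite {e. \<exists>m\<in>I. \<phi> (x m) (m + e) \<noteq> \<zero>}" by (rule finite_subset) simp
    show "poly_fun R l (\<lambda>m. if e = d then p' m else \<zero>)" for e
      using p'(2) poly_fun_zero by (cases "e = d") auto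
  qed (use p' off in \<open>auto simp: p_def\<close>)
  then show ?thesis by (auto simp: diff_ops_def)
qed

lemma level_subset_diff_ops: "q_diff_ops_level R S G q k \<subseteq> diff_ops"
proof (induction k)
  case 0
  have "\<zero>\<^bsub>E\<^esub> \<in> diff_ops" using diff_ord_zero by (auto simp: diff_ops_def)
  then have "\<phi> \<in> diff_ops" if "\<phi> \<in> homog R S G d"
    "\<forall>s\<in>carrier S. q_bracket R S G q a \<phi> (mult_op S s) = \<zero>\<^bsub>E\<^esub>" for \<phi> d a
    using that by (intro diff_ops_if_bracket[of \<phi> d a]) simp_all
  then show ?case unfolding q_diff_ops_level.simps
    by (intro hull_minimal diff_ops_sub_bimodule subsetI) blast
next
  case (Suc k)
  then have "\<phi> \<in> diff_ops" if "\<phi> \<in> homog R S G d"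
    "\<forall>s\<in>carrier S. q_bracket R S G q a \<phi> (mult_op S s) \<in> q_diff_ops_level R S G q k" for \<phi> d a
    using that by (intro diff_ops_if_bracket[of \<phi> d a]) auto
  then show ?case unfolding q_diff_ops_level.simps
    by (intro hull_minimal diff_ops_sub_bimodule subsetI) blast
qed

theorem q_diff_ops_carrier: "carrier (q_diff_ops R S G q) = diff_ops"
proof -
  have "(\<Union>k. q_diff_ops_level R S G q k) = diff_ops"
  proof
    show "(\<Union>k. q_diff_ops_level R S G q k) \<subseteq> diff_ops" using level_subset_diff_ops by blast
    show "diff_ops \<subseteq> (\<Union>k. q_diff_ops_level R S G q k)"
      unfolding diff_ops_def using diff_ord_subset_level diff_ord_mono[of k "Suc k" for k] by fastforce
  qed
  then show ?thesis by (simp add: q_diff_ops_def)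
qed

end

section \<open>The local ring at \<open>q = 1\<close> and its quotients\<close>

definition res :: "'k::field_char_0 \<Rightarrow> nat \<Rightarrow> 'k \<Rightarrow> 'k set"
  where "res q n a = loc_ideal q n +>\<^bsub>loc_ring q\<^esub> a"

lemma (in ideal) rcos_eq_iff:
  assumes "a \<in> carrier R" "b \<in> carrier R"
  shows "I +> a = I +> b \<longleftrightarrow> a \<ominus> b \<in> I"
proof
  assume "I +> a = I +> b"
  then have "a \<in> I +> b" using a_rcos_self[OF assms(1)] by simp
  then obtain i where "i \<in> I" "a = i \<oplus> b" by (auto simp: a_r_coset_def')
  moreover have "i \<in> carrier R" using \<open>i \<in> I\<close> Icarr by blast
  moreover have "i \<oplus> b \<ominus> b = i" using \<open>i \<in> carrier R\<close> assms(2) by algebra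
  ultimately show "a \<ominus> b \<in> I" by simp
next
  assume *: "a \<ominus> b \<in> I"
  have "a = (a \<ominus> b) \<oplus> b" using assms by algebra
  with * have "a \<in> I +> b" by (auto simp: a_r_coset_def')
  then show "I +> a = I +> b" using a_repr_independence'[OF _ assms(2)] by metis
qed

locale transcendental =
  fixes q :: "'k::field_char_0"
  assumes trans: "\<not> algebraic q"
begin

abbreviation "A \<equiv> carrier (loc_ring q)"
abbreviation "rat_poly (p :: 'k poly) \<equiv> \<forall>i. coeff p i \<in> \<rat>"

sublocale A: cring "loc_ring q" by (rule loc_ring_cring[OF trans])

lemma q_nz: "q \<noteq> 0" and q_ne_1: "q \<noteq> 1"
  using trans by auto

lemma loc_ops: "a \<oplus>\<^bsub>loc_ring q\<^esub> b = a + b" "a \<otimes>\<^bsub>loc_ring q\<^esub> b = a * b"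
  "\<zero>\<^bsub>loc_ring q\<^esub> = 0" "\<one>\<^bsub>loc_ring q\<^esub> = 1"
  by (simp_all add: loc_ring_def field_ring_def)

lemma A_closed: "0 \<in> A" "1 \<in> A" "a \<in> A \<Longrightarrow> b \<in> A \<Longrightarrow> a + b \<in> A" "a \<in> A \<Longrightarrow> b \<in> A \<Longrightarrow> a * b \<in> A"
  using A.zero_closed A.one_closed A.a_closed A.m_closed by (simp_all add: loc_ops)

lemma loc_uminus: "a \<in> A \<Longrightarrow> \<ominus>\<^bsub>loc_ring q\<^esub> a = - a"
  using A.r_neg[of a] by (simp add: loc_ops eq_neg_iff_add_eq_0 add.commute)

lemma A_uminus: "a \<in> A \<Longrightarrow> - a \<in> A"
  using A.a_inv_closed[of a] by (simp add: loc_uminus)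

lemma A_minus: "a \<in> A \<Longrightarrow> b \<in> A \<Longrightarrow> a - b \<in> A"
  using A_closed(3)[of a "- b"] A_uminus by simp

lemma loc_minus: "a \<in> A \<Longrightarrow> b \<in> A \<Longrightarrow> a \<ominus>\<^bsub>loc_ring q\<^esub> b = a - b"
  by (simp add: a_minus_def loc_ops loc_uminus)

lemma A_power: "a \<in> A \<Longrightarrow> a ^ k \<in> A"
  by (induction k) (auto simp: A_closed)

lemma rat_poly_nz: "rat_poly p \<Longrightarrow> poly p 1 \<noteq> 0 \<Longrightarrow> poly p q \<noteq> 0"
  using transcendental_poly_zero[OF trans] by force

lemma rat_poly_mult: "rat_poly p \<Longrightarrow> rat_poly r \<Longrightarrow> rat_poly (p * r)"
  by (auto simp: coeff_mult intro!: sum_in_Rats)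

lemma A_iff: "a \<in> A \<longleftrightarrow> (\<exists>p s. rat_poly p \<and> rat_poly s \<and> poly s 1 \<noteq> 0 \<and> a = poly p q / poly s q)"
proof
  assume "a \<in> A"
  then obtain x y where xy: "a = x / y" "x \<in> rat_laurent q" "y \<in> rat_laurent q"
    "y \<notin> {(q - 1) * c | c. c \<in> rat_laurent q}" by (auto simp: loc_ring_def)
  obtain p m where p: "x = poly p q / q ^ m" "rat_poly p" using xy(2) by (auto simp: rat_laurent_def)
  obtain r l where r: "y = poly r q / q ^ l" "rat_poly r" using xy(3) by (auto simp: rat_laurent_def)
  have "poly r 1 \<noteq> 0" using in_ideal_iff[OF trans r(2)] xy(4) r(1) by blast
  then have "poly (monom 1 m * r) 1 \<noteq> 0" by (simp add: poly_monom)
  moreover have "rat_poly (monom 1 l * p)" "rat_poly (monom 1 m * r)"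
    using p(2) r(2) by (auto intro!: rat_poly_mult[rule_format])
  moreover have "a = poly (monom 1 l * p) q / poly (monom 1 m * r) q"
    unfolding xy(1) p(1) r(1) using q_nz by (simp add: poly_monom field_simps)
  ultimately show "\<exists>p s. rat_poly p \<and> rat_poly s \<and> poly s 1 \<noteq> 0 \<and> a = poly p q / poly s q" by blast
next
  assume "\<exists>p s. rat_poly p \<and> rat_poly s \<and> poly s 1 \<noteq> 0 \<and> a = poly p q / poly s q"
  then obtain p s where ps: "rat_poly p" "rat_poly s" "poly s 1 \<noteq> 0" "a = poly p q / poly s q" by blast
  have "poly p q / q ^ 0 \<in> rat_laurent q" "poly s q / q ^ 0 \<in> rat_laurent q"
    unfolding rat_laurent_def using ps by blast+
  moreover have "poly s q / q ^ 0 \<notin> {(q - 1) * c | c. c \<in> rat_laurent q}"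
    unfolding in_ideal_iff[OF trans ps(2)] by (rule ps(3))
  ultimately show "a \<in> A" using ps(4) by (auto simp: loc_ring_def)
qed

lemma A_poly: "rat_poly p \<Longrightarrow> poly p q \<in> A"
  unfolding A_iff by (intro exI[of _ p] exI[of _ 1]) (auto simp: one_pCons coeff_pCons split: nat.split)

lemma A_inverse_poly: "rat_poly s \<Longrightarrow> poly s 1 \<noteq> 0 \<Longrightarrow> inverse (poly s q) \<in> A"
  unfolding A_iff
  by (intro exI[of _ 1] exI[of _ s]) (auto simp: one_pCons coeff_pCons field_simps split: nat.split)

lemma A_rat: "c \<in> \<rat> \<Longrightarrow> c \<in> A"
  using A_poly[of "[:c:]"] by (auto simp: coeff_pCons split: nat.split)

lemma A_q: "q \<in> A" "inverse q \<in> A"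
  using A_poly[of "[:0, 1:]"] A_inverse_poly[of "[:0, 1:]"] by (auto simp: coeff_pCons split: nat.split)

lemma A_q_powi: "q powi z \<in> A"
  using A_q A_power by (auto simp: power_int_def)

text \<open>Modulo \<open>q - 1\<close> every element of the local ring is congruent to exactly one rational number:
  its value at \<open>q = 1\<close>.\<close>

lemma rat_residue:
  assumes "a \<in> A" obtains c where "c \<in> \<rat>" "\<exists>b\<in>A. a - c = (q - 1) * b"
proof -
  obtain p s where ps: "rat_poly p" "rat_poly s" "poly s 1 \<noteq> 0" "a = poly p q / poly s q"
    using assms A_iff by blast
  have rat1: "poly r 1 \<in> \<rat>" if "rat_poly r" for r
    using that by (auto simp: poly_altdef intro!: sum_in_Rats)
  define c where "c = poly p 1 / poly s 1"
  let ?r = "p - smult c s"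
  have c: "c \<in> \<rat>" unfolding c_def using ps rat1 by auto
  have r: "rat_poly ?r" using ps c by auto
  have "poly ?r 1 = 0" unfolding c_def using ps(3) by simp
  then have "poly ?r q / q ^ 0 \<in> {(q - 1) * c | c. c \<in> rat_laurent q}" using in_ideal_iff[OF trans r] by blast
  then obtain b where b: "poly ?r q = (q - 1) * b" "b \<in> rat_laurent q" by auto
  obtain u m where u: "b = poly u q / q ^ m" "rat_poly u" using b(2) by (auto simp: rat_laurent_def)
  have "b \<in> A" unfolding u(1) using A_poly[OF u(2)] A_power[OF A_q(2), of m] A_closed(4)
    by (simp add: divide_inverse power_inverse)
  then have bA: "b * inverse (poly s q) \<in> A" using A_inverse_poly[OF ps(2,3)] A_closed by blast
  have "a - c = poly ?r q * inverse (poly s q)"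
    using rat_poly_nz[OF ps(2,3)] ps(4) by (simp add: field_simps)
  then have "a - c = (q - 1) * (b * inverse (poly s q))" using b(1) by simp
  with bA that c show ?thesis by blast
qed

lemma rat_in_ideal_zero:
  assumes "c \<in> \<rat>" "b \<in> A" "c = (q - 1) * b" shows "c = 0"
proof -
  obtain p s where ps: "rat_poly p" "rat_poly s" "poly s 1 \<noteq> 0" "b = poly p q / poly s q"
    using assms(2) A_iff by blast
  let ?r = "smult c s - [:-1, 1:] * p"
  have r: "rat_poly ?r" using ps assms(1) by (auto simp: coeff_pCons split: nat.split)
  have "c * poly s q = (q - 1) * poly p q" using assms(3) ps(4) rat_poly_nz[OF ps(2,3)] by simp
  then have "poly ?r q = 0" by (simp add: algebra_simps)
  then have "?r = 0" using transcendental_poly_zero[OF trans r] by blast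
  then have "poly ?r 1 = 0" by simp
  then show ?thesis using ps(3) by simp
qed

lemma A_qm1: "(q - 1) ^ n \<in> A"
  using A_power[OF A_minus[OF A_q(1) A_closed(2)]] .

lemma loc_ideal_eq: "loc_ideal q n = {a * (q - 1) ^ n | a. a \<in> A}"
  unfolding loc_ideal_def cgenideal_def by (simp add: loc_ops)

lemma loc_ideal_ideal: "ideal (loc_ideal q n) (loc_ring q)"
  unfolding loc_ideal_def by (rule A.cgenideal_ideal[OF A_qm1])

lemma B_cring: "cring (loc_quot q n)"
  by (rule loc_quot_cring[OF trans])

lemma res_hom: "res q n \<in> ring_hom (loc_ring q) (loc_quot q n)"
  using ideal.rcos_ring_hom[OF loc_ideal_ideal] unfolding res_def loc_quot_def .

lemma res_ring_hom: "ring_hom_ring (loc_ring q) (loc_quot q n) (res q n)"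
  by (intro ring_hom_ringI2 res_hom A.ring_axioms cring.axioms(1)[OF B_cring])

lemma B_carrier: "carrier (loc_quot q n) = res q n ` A"
  by (auto simp: loc_quot_def FactRing_def A_RCOSETS_def' res_def)

lemma res_closed: "a \<in> A \<Longrightarrow> res q n a \<in> carrier (loc_quot q n)"
  by (simp add: B_carrier)

lemma res_ops:
  assumes "a \<in> A" "b \<in> A"
  shows "res q n a \<oplus>\<^bsub>loc_quot q n\<^esub> res q n b = res q n (a + b)"
    "res q n a \<otimes>\<^bsub>loc_quot q n\<^esub> res q n b = res q n (a * b)"
    "res q n a \<ominus>\<^bsub>loc_quot q n\<^esub> res q n b = res q n (a - b)"
    "\<zero>\<^bsub>loc_quot q n\<^esub> = res q n 0" "\<one>\<^bsub>loc_quot q n\<^esub> = res q n 1"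
proof -
  interpret h: ring_hom_ring "loc_ring q" "loc_quot q n" "res q n" by (rule res_ring_hom)
  show "res q n a \<oplus>\<^bsub>loc_quot q n\<^esub> res q n b = res q n (a + b)"
    using h.hom_add[OF assms] by (simp add: loc_ops)
  show "res q n a \<otimes>\<^bsub>loc_quot q n\<^esub> res q n b = res q n (a * b)"
    using h.hom_mult[OF assms] by (simp add: loc_ops)
  show "\<zero>\<^bsub>loc_quot q n\<^esub> = res q n 0" using h.hom_zero by (simp add: loc_ops)
  show "\<one>\<^bsub>loc_quot q n\<^esub> = res q n 1" using h.hom_one by (simp add: loc_ops)
  have "res q n (a \<oplus>\<^bsub>loc_ring q\<^esub> \<ominus>\<^bsub>loc_ring q\<^esub> b) = res q n a \<oplus>\<^bsub>loc_quot q n\<^esub> \<ominus>\<^bsub>loc_quot q n\<^esub> res q n b"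
    using h.hom_add h.hom_a_inv assms by simp
  then show "res q n a \<ominus>\<^bsub>loc_quot q n\<^esub> res q n b = res q n (a - b)"
    using assms by (simp add: a_minus_def loc_ops loc_uminus)
qed

lemma res_eq_iff:
  assumes "a \<in> A" "b \<in> A" shows "res q n a = res q n b \<longleftrightarrow> (\<exists>c\<in>A. a - b = (q - 1) ^ n * c)"
proof -
  interpret I: ideal "loc_ideal q n" "loc_ring q" by (rule loc_ideal_ideal)
  have "res q n a = res q n b \<longleftrightarrow> a \<ominus>\<^bsub>loc_ring q\<^esub> b \<in> loc_ideal q n"
    unfolding res_def by (rule I.rcos_eq_iff[OF assms])
  then show ?thesis
    unfolding loc_minus[OF assms] loc_ideal_eq by (auto simp: mult.commute[of "(q - 1) ^ n"])
qed

lemma res_nat_pow: "a \<in> A \<Longrightarrow> res q n a [^]\<^bsub>loc_quot q n\<^esub> (k::nat) = res q n (a ^ k)"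
proof (induction k)
  case 0
  then show ?case using res_ops(5)[of a a n] by simp
next
  case (Suc k)
  then show ?case using res_ops(2)[OF A_power[OF Suc.prems] Suc.prems] by (simp add: mult.commute)
qed

lemma q_mod_res: "q_mod q n = res q n q"
  by (simp add: q_mod_def res_def)

lemma q_mod_unit: "q_mod q n \<in> Units (loc_quot q n)"
proof -
  have "q * inverse q = 1" "inverse q * q = 1" using q_nz by auto
  then have "res q n q \<otimes>\<^bsub>loc_quot q n\<^esub> res q n (inverse q) = \<one>\<^bsub>loc_quot q n\<^esub>"
    "res q n (inverse q) \<otimes>\<^bsub>loc_quot q n\<^esub> res q n q = \<one>\<^bsub>loc_quot q n\<^esub>"
    using A_q res_ops by metis+
  then show ?thesis unfolding q_mod_res Units_def using res_closed A_q by blast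
qed

lemma q_mod_nilpotent: "(q_mod q n \<ominus>\<^bsub>loc_quot q n\<^esub> \<one>\<^bsub>loc_quot q n\<^esub>) [^]\<^bsub>loc_quot q n\<^esub> n = \<zero>\<^bsub>loc_quot q n\<^esub>"
proof -
  have "(q_mod q n \<ominus>\<^bsub>loc_quot q n\<^esub> \<one>\<^bsub>loc_quot q n\<^esub>) [^]\<^bsub>loc_quot q n\<^esub> n = res q n ((q - 1) ^ n)"
    unfolding q_mod_res res_ops(5)[OF A_closed(1,1)] res_ops(3)[OF A_q(1) A_closed(2)]
    by (rule res_nat_pow[OF A_minus[OF A_q(1) A_closed(2)]])
  also have "\<dots> = res q n 0"
    using res_eq_iff[OF A_qm1 A_closed(1), of n n] A_closed(2) by force
  finally show ?thesis using res_ops(4)[OF A_closed(1,1)] by simp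
qed

end

section \<open>The kernels \<open>\<Gamma>\<close> in terms of symbols\<close>

definition diff_symbol :: "('r, 'm) ring_scheme \<Rightarrow> int set \<Rightarrow> (int \<Rightarrow> int \<Rightarrow> 'r) \<Rightarrow> bool"
  where "diff_symbol R I P \<longleftrightarrow> (\<forall>d m. P d m \<in> carrier R) \<and> finite {d. \<exists>m. P d m \<noteq> \<zero>\<^bsub>R\<^esub>} \<and>
    (\<forall>d. \<exists>k. poly_fun R k (P d)) \<and> (\<forall>d. \<forall>m\<in>I. m + d \<notin> I \<longrightarrow> P d m = \<zero>\<^bsub>R\<^esub>)"

context laurent_ops
begin

lemma poly_fun_eqI:
  assumes "poly_fun R k p" "poly_fun R l r" "\<And>m. p m \<in> carrier R" "\<And>m. r m \<in> carrier R"
    and "\<And>m. m \<in> I \<Longrightarrow> p m = r m"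
  shows "p = r"
proof
  fix m
  have "poly_fun R (max k l) (\<lambda>m. p m \<ominus> r m)"
    using poly_fun_mono[OF assms(1) _ assms(3), of "max k l"] poly_fun_mono[OF assms(2) _ assms(4), of "max k l"] assms(3,4)
    by (intro poly_fun_minus) simp_all
  moreover have "(\<forall>m\<ge>0. p m \<ominus> r m = \<zero>) \<or> (\<forall>m\<le>0. p m \<ominus> r m = \<zero>)"
    using ray assms(4,5) by (auto simp: minus_eq r_neg)
  ultimately have "p m \<ominus> r m = \<zero>"
    using assms(3,4) by (intro poly_fun_eventually_zero[where p = "\<lambda>m. p m \<ominus> r m"]) auto
  then show "p m = r m" using eq_minus_zeroD assms(3,4) by blast
qed

lemma diff_symbol_presymbol:
  assumes "diff_symbol R I P" shows "presymbol P"
proof -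
  have "{d. \<exists>m\<in>I. P d m \<noteq> \<zero>} \<subseteq> {d. \<exists>m. P d m \<noteq> \<zero>}" by blast
  then show ?thesis using assms finite_subset by (auto simp: presymbol_def diff_symbol_def)
qed

lemma symop_diff_ops:
  assumes "diff_symbol R I P" shows "symop R I P \<in> diff_ops"
proof -
  let ?D = "{d. \<exists>m. P d m \<noteq> \<zero>}"
  have P: "\<And>d m. P d m \<in> carrier R" "finite ?D" "\<forall>d. \<exists>k. poly_fun R k (P d)"
    using assms by (auto simp: diff_symbol_def)
  obtain K where K: "\<And>d. poly_fun R (K d) (P d)" using P(3) by metis
  define k where "k = (\<Sum>d\<in>?D. K d)"
  have "poly_fun R k (P d)" for d
  proof (cases "d \<in> ?D")
    case True
    then have "K d \<le> k" unfolding k_def using P(2) by (intro member_le_sum) auto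
    then show ?thesis using poly_fun_mono K P(1) by blast
  next
    case False
    then have "P d = (\<lambda>_. \<zero>)" by auto
    then show ?thesis using poly_fun_zero by simp
  qed
  moreover have "degs (symop R I P) \<subseteq> ?D" using symop_x[OF P(1)] by auto
  then have "finite (degs (symop R I P))" using P(2) finite_subset by blast
  ultimately have "symop R I P \<in> diff_ord k"
    using P(1) symop_x[OF P(1)] symop_closed[OF diff_symbol_presymbol[OF assms]]
    by (intro diff_ordI[where P = P]) auto
  then show ?thesis by (auto simp: diff_ops_def)
qed

lemma diff_ops_symop:
  assumes "\<phi> \<in> diff_ops" shows "\<exists>P. diff_symbol R I P \<and> \<phi> = symop R I P"
proof -
  obtain k where k: "\<phi> \<in> diff_ord k" using assms by (auto simp: diff_ops_def)
  then obtain P where P: "\<And>d m. P d m \<in> carrier R" "\<And>d. poly_fun R k (P d)"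
    "\<And>d m. m \<in> I \<Longrightarrow> \<phi> (x m) (m + d) = P d m" using diff_ordE by metis
  note \<phi> = diff_ord_closed[OF k]
  have "P d = (\<lambda>_. \<zero>)" if "d \<notin> degs \<phi>" for d
    using that P by (intro poly_fun_eqI[of k _ k]) (auto simp: poly_fun_zero)
  then have "{d. \<exists>m. P d m \<noteq> \<zero>} \<subseteq> degs \<phi>" by force
  then have "finite {d. \<exists>m. P d m \<noteq> \<zero>}" using diff_ord_finite[OF k] finite_subset by blast
  moreover have "P d m = \<zero>" if "m \<in> I" "m + d \<notin> I" for d m
    using P(3)[OF that(1)] E_outside[OF \<phi> that] by simp
  ultimately have "diff_symbol R I P" using P unfolding diff_symbol_def by blast
  moreover have "\<phi> = symop R I P"
    by (rule trans[OF E_eq_symop[OF \<phi>] symop_cong]) (simp_all add: P)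
  ultimately show ?thesis by blast
qed

end

context q_laurent_ops
begin

lemma q_diff_ops_symop: "carrier (q_diff_ops R S G q) = symop R I ` {P. diff_symbol R I P}"
  unfolding q_diff_ops_carrier using symop_diff_ops diff_ops_symop by blast

lemma q_diff_ops_abelian_group: "abelian_group (q_diff_ops R S G q)"
proof -
  let ?D = "q_diff_ops R S G q"
  have ops: "a \<oplus>\<^bsub>?D\<^esub> b = a \<oplus>\<^bsub>E\<^esub> b" "\<zero>\<^bsub>?D\<^esub> = \<zero>\<^bsub>E\<^esub>" for a b by (simp_all add: q_diff_ops_def)
  interpret M: additive_subgroup diff_ops E
    using diff_ops_sub_bimodule by (simp add: sub_bimodule_def)
  have sub: "a \<in> carrier E" if "a \<in> diff_ops" for a using that M.a_subset by blast
  have "\<exists>y\<in>diff_ops. y \<oplus>\<^bsub>E\<^esub> a = \<zero>\<^bsub>E\<^esub>" if "a \<in> diff_ops" for a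
    using M.a_inv_closed[OF that] E.l_neg[OF sub[OF that]] by blast
  then show ?thesis
    by (intro abelian_groupI) (auto simp: q_diff_ops_carrier ops E.a_ac sub)
qed

end

text \<open>Over a field of characteristic zero these are the symbols of the global differential operators on
  the projective line.\<close>

definition global_symbol :: "('r, 'm) ring_scheme \<Rightarrow> (int \<Rightarrow> int \<Rightarrow> 'r) \<Rightarrow> bool"
  where "global_symbol R P \<longleftrightarrow> diff_symbol R {0..} P \<and> diff_symbol R {..0} P"

context transcendental
begin

abbreviation "B n \<equiv> loc_quot q n"

lemma B_ops:
  assumes "I = {0..} \<or> I = {..0} \<or> I = UNIV" shows "q_laurent_ops (B n) I (q_mod q n) n"
  by (intro q_laurent_ops.intro laurent_ops.intro B_cring laurent_ops_axioms.intro assms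
      q_laurent_ops_axioms.intro q_mod_unit q_mod_nilpotent)

text \<open>The operator with the same symbol is an extension, and it is the only one because polynomial
  functions that agree on a half-line are equal.\<close>

lemma extend_op_symop:
  assumes I: "I = {0..} \<or> I = {..0} \<or> I = UNIV" and P: "diff_symbol (B n) I P"
  shows "extend_op q n I (symop (B n) I P) = symop (B n) UNIV P"
proof -
  interpret L: q_laurent_ops "B n" I "q_mod q n" n by (rule B_ops[OF I])
  interpret U: q_laurent_ops "B n" UNIV "q_mod q n" n by (rule B_ops) simp
  have Pc: "\<And>d m. P d m \<in> carrier (B n)" using P by (simp add: diff_symbol_def)
  have PU: "diff_symbol (B n) UNIV P" using P by (simp add: diff_symbol_def)
  have sub: "carrier (laurent (B n) I) \<subseteq> carrier (laurent (B n) UNIV)" by (auto simp: laurent_def)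
  show ?thesis
    unfolding extend_op_def
  proof (rule the_equality, intro conjI ballI)
    show "symop (B n) UNIV P \<in> carrier (D_n q n UNIV)" using PU U.q_diff_ops_symop by blast
    show "symop (B n) UNIV P f = symop (B n) I P f" if "f \<in> carrier (laurent (B n) I)" for f
      using that sub by (auto simp: symop_def)
  next
    fix \<psi> assume \<psi>: "\<psi> \<in> carrier (D_n q n UNIV) \<and> (\<forall>f\<in>carrier (laurent (B n) I). \<psi> f = symop (B n) I P f)"
    then obtain Q where Q: "diff_symbol (B n) UNIV Q" "\<psi> = symop (B n) UNIV Q"
      using U.q_diff_ops_symop by blast
    have Qc: "\<And>d m. Q d m \<in> carrier (B n)" using Q by (simp add: diff_symbol_def)
    have agree: "Q d m = P d m" if m: "m \<in> I" for d m
    proof -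
      have "Q (m + d - m) m = \<psi> (L.x m) (m + d)" unfolding Q(2) by (rule U.symop_x[OF Qc, symmetric]) simp
      also have "\<dots> = symop (B n) I P (L.x m) (m + d)" using \<psi> L.x_closed[OF m] by simp
      also have "\<dots> = P (m + d - m) m" by (rule L.symop_x[OF Pc m])
      finally show ?thesis by simp
    qed
    have "Q d = P d" for d
    proof -
      obtain k l where "poly_fun (B n) k (Q d)" "poly_fun (B n) l (P d)"
        using P Q(1) unfolding diff_symbol_def by blast
      then show ?thesis using Qc Pc agree by (intro L.poly_fun_eqI) auto
    qed
    then have "Q = P" by blast
    then show "\<psi> = symop (B n) UNIV P" using Q(2) by simp
  qed
qed

lemma symop_eq_iff:
  assumes I: "I = {0..} \<or> I = {..0} \<or> I = UNIV" and "diff_symbol (B n) I P" "diff_symbol (B n) I Q"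
  shows "symop (B n) I P = symop (B n) I Q \<longleftrightarrow> P = Q"
proof
  interpret L: q_laurent_ops "B n" I "q_mod q n" n by (rule B_ops[OF I])
  have Pc: "\<And>d m. P d m \<in> carrier (B n)" and Qc: "\<And>d m. Q d m \<in> carrier (B n)"
    using assms by (auto simp: diff_symbol_def)
  assume eq: "symop (B n) I P = symop (B n) I Q"
  have agree: "P d m = Q d m" if m: "m \<in> I" for d m
    using L.symop_x[where P = P and j = "m + d", OF Pc m] L.symop_x[where P = Q and j = "m + d", OF Qc m] eq by simp
  have "P d = Q d" for d
  proof -
    obtain k l where "poly_fun (B n) k (P d)" "poly_fun (B n) l (Q d)"
      using assms unfolding diff_symbol_def by blast
    then show ?thesis using Qc Pc agree by (intro L.poly_fun_eqI) auto
  qed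
  then show "P = Q" by blast
qed simp

text \<open>Two operators on \<open>B[x]\<close> and \<open>B[x\<inverse>]\<close> have the same extension exactly if they have the same
  symbol, because a polynomial function is determined by its values on either half-line.\<close>

lemma Gamma_n_eq:
  "Gamma_n q n = {(symop (B n) {0..} P, symop (B n) {..0} P) | P. global_symbol (B n) P}"
proof -
  have r: "{0..} = {0..} \<or> {0..} = {..0} \<or> {0..} = (UNIV :: int set)"
    "{..0} = {0..} \<or> {..0} = {..0} \<or> {..0} = (UNIV :: int set)" by simp_all
  interpret X: q_laurent_ops "B n" "{0..}" "q_mod q n" n by (rule B_ops) simp
  interpret Y: q_laurent_ops "B n" "{..0}" "q_mod q n" n by (rule B_ops) simp
  interpret U: q_laurent_ops "B n" UNIV "q_mod q n" n by (rule B_ops) simp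
  have symU: "diff_symbol (B n) UNIV P" if "diff_symbol (B n) I P" for P and I :: "int set"
    using that by (simp add: diff_symbol_def)
  interpret D: abelian_group "D_n q n UNIV" by (rule U.q_diff_ops_abelian_group)
  have key: "(symop (B n) {0..} P, symop (B n) {..0} Q) \<in> Gamma_n q n \<longleftrightarrow> P = Q"
    if P: "diff_symbol (B n) {0..} P" and Q: "diff_symbol (B n) {..0} Q" for P Q
  proof -
    have cl: "symop (B n) UNIV P \<in> carrier (D_n q n UNIV)" "symop (B n) UNIV Q \<in> carrier (D_n q n UNIV)"
      using U.q_diff_ops_symop symU P Q by blast+
    have "(symop (B n) {0..} P, symop (B n) {..0} Q) \<in> Gamma_n q n \<longleftrightarrow>
        symop (B n) UNIV P \<ominus>\<^bsub>D_n q n UNIV\<^esub> symop (B n) UNIV Q = \<zero>\<^bsub>D_n q n UNIV\<^esub>"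
      unfolding Gamma_n_def a_kernel_def' RDirProd_carrier
      using P Q X.q_diff_ops_symop Y.q_diff_ops_symop
        extend_op_symop[OF r(1) P] extend_op_symop[OF r(2) Q] by auto
    also have "\<dots> \<longleftrightarrow> symop (B n) UNIV P = symop (B n) UNIV Q" 
      using D.minus_equality[of "symop (B n) UNIV P" "\<ominus>\<^bsub>D_n q n UNIV\<^esub> symop (B n) UNIV Q"] cl
      by (auto simp: a_minus_def D.r_neg)
    also have "\<dots> \<longleftrightarrow> P = Q" by (rule symop_eq_iff) (use P Q symU in auto)
    finally show ?thesis .
  qed
  have "g \<in> Gamma_n q n \<Longrightarrow> \<exists>P Q. g = (symop (B n) {0..} P, symop (B n) {..0} Q) \<and>
      diff_symbol (B n) {0..} P \<and> diff_symbol (B n) {..0} Q" for g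
    unfolding Gamma_n_def a_kernel_def' RDirProd_carrier X.q_diff_ops_symop Y.q_diff_ops_symop by auto
  then show ?thesis using key unfolding global_symbol_def by blast
qed

end

section \<open>Reduction of operators along a surjection of coefficient rings\<close>

lemma descend_eq:
  assumes "a \<in> S" "p a = b" "\<And>a. a \<in> S \<Longrightarrow> p a = b \<Longrightarrow> h a = c"
  shows "descend p S h b = c"
proof -
  have "h ` {a \<in> S. p a = b} = {c}" using assms by (auto intro!: image_eqI[of c h a])
  then show ?thesis by (simp add: descend_def)
qed

lemma hom_symop:
  assumes R: "laurent_ops R I" and R': "laurent_ops R' I" and h: "h \<in> ring_hom R R'"
    and P: "\<And>d m. P d m \<in> carrier R" and f: "f \<in> carrier (laurent R I)"
  shows "(\<lambda>j. h (f j)) \<in> carrier (laurent R' I)"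
    and "h (symop R I P f j) = symop R' I (\<lambda>d m. h (P d m)) (\<lambda>j. h (f j)) j"
proof -
  interpret R: laurent_ops R I by fact
  interpret R': laurent_ops R' I by fact
  interpret h: ring_hom_cring R R' h
    by (intro ring_hom_cringI ring_hom_ringI2 R.is_cring R'.is_cring R.ring_axioms R'.ring_axioms h)
  have sub: "{m. h (f m) \<noteq> \<zero>\<^bsub>R'\<^esub>} \<subseteq> {m. f m \<noteq> \<zero>\<^bsub>R\<^esub>}" by auto
  have fin: "finite {m. f m \<noteq> \<zero>\<^bsub>R\<^esub>}" using f by (simp add: R.S_carrier)
  show hf: "(\<lambda>j. h (f j)) \<in> carrier (laurent R' I)"
    using f fin finite_subset[OF sub] by (simp add: R'.S_carrier R.S_carrier)
  have "h (symop R I P f j) = h (\<Oplus>\<^bsub>R\<^esub>m\<in>{m. f m \<noteq> \<zero>\<^bsub>R\<^esub>}. f m \<otimes>\<^bsub>R\<^esub> P (j - m) m)"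
    by (subst R.symop_app[OF P f fin]) simp_all
  also have "\<dots> = (\<Oplus>\<^bsub>R'\<^esub>m\<in>{m. f m \<noteq> \<zero>\<^bsub>R\<^esub>}. (h \<circ> (\<lambda>m. f m \<otimes>\<^bsub>R\<^esub> P (j - m) m)) m)"
    using P R.S_coeff[OF f] by (subst h.hom_finsum) (auto simp: comp_def)
  also have "\<dots> = (\<Oplus>\<^bsub>R'\<^esub>m\<in>{m. f m \<noteq> \<zero>\<^bsub>R\<^esub>}. h (f m) \<otimes>\<^bsub>R'\<^esub> h (P (j - m) m))"
    using P R.S_coeff[OF f] by simp
  also have "\<dots> = symop R' I (\<lambda>d m. h (P d m)) (\<lambda>j. h (f j)) j"
    by (rule R'.symop_app[symmetric, OF _ hf fin sub]) (simp add: P)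
  finally show "h (symop R I P f j) = symop R' I (\<lambda>d m. h (P d m)) (\<lambda>j. h (f j)) j" .
qed

text \<open>Both reductions, of operators over the local ring and of operators over \<open>B\<^sub>n\<^sub>+\<^sub>1\<close>, are of this
  form.\<close>

lemma descend_symop:
  assumes R: "laurent_ops R I" and R': "laurent_ops R' I" and h: "h \<in> ring_hom R R'"
    and surj: "h ` carrier R = carrier R'"
    and P: "\<And>d m. P d m \<in> carrier R"
    and \<phi>: "\<And>f. f \<in> carrier (laurent R I) \<Longrightarrow> \<phi> f = symop R I P f"
  shows "(\<lambda>g\<in>carrier (laurent R' I). descend (\<lambda>f j. h (f j)) (carrier (laurent R I)) (\<lambda>f j. h (\<phi> f j)) g)
    = symop R' I (\<lambda>d m. h (P d m))"
proof -
  interpret R: laurent_ops R I by fact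
  interpret R': laurent_ops R' I by fact
  have "descend (\<lambda>f j. h (f j)) (carrier (laurent R I)) (\<lambda>f j. h (\<phi> f j)) g = symop R' I (\<lambda>d m. h (P d m)) g"
    if g: "g \<in> carrier (laurent R' I)" for g
  proof -
    have hz: "h \<zero>\<^bsub>R\<^esub> = \<zero>\<^bsub>R'\<^esub>" using h R.ring_axioms R'.ring_axioms by (intro ring_hom_zero)
    have "\<forall>j. \<exists>a\<in>carrier R. h a = g j" using surj R'.S_coeff[OF g] by (metis imageE)
    then obtain c where c: "\<And>j. c j \<in> carrier R" "\<And>j. h (c j) = g j" by metis
    define f where "f j = (if g j = \<zero>\<^bsub>R'\<^esub> then \<zero>\<^bsub>R\<^esub> else c j)" for j
    have "{j. f j \<noteq> \<zero>\<^bsub>R\<^esub>} \<subseteq> {j. g j \<noteq> \<zero>\<^bsub>R'\<^esub>}" by (auto simp: f_def)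
    moreover have "finite {j. g j \<noteq> \<zero>\<^bsub>R'\<^esub>}" "\<And>j. j \<notin> I \<Longrightarrow> g j = \<zero>\<^bsub>R'\<^esub>" using g by (auto simp: R'.S_carrier)
    ultimately have fS: "f \<in> carrier (laurent R I)"
      using c finite_subset by (fastforce simp: R.S_carrier f_def)
    have hf: "(\<lambda>j. h (f j)) = g" using c hz by (auto simp: f_def)
    show ?thesis
    proof (rule descend_eq[where p = "\<lambda>f j. h (f j)" and h = "\<lambda>f j. h (\<phi> f j)", OF fS hf])
      fix f assume f: "f \<in> carrier (laurent R I)" and "(\<lambda>j. h (f j)) = g"
      then show "(\<lambda>j. h (\<phi> f j)) = symop R' I (\<lambda>d m. h (P d m)) g"
        using hom_symop(2)[OF R R' h P f] \<phi>[OF f] by auto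
    qed
  qed
  then show ?thesis by (auto simp: symop_def fun_eq_iff restrict_def)
qed

lemma (in ring) set_add_rcos:
  assumes I: "ideal I R" and J: "ideal J R" and sub: "J \<subseteq> I" and a: "a \<in> carrier R"
  shows "I <+>\<^bsub>R\<^esub> (J +> a) = I +> a"
proof -
  interpret I: ideal I R by fact
  interpret J: ideal J R by fact
  show ?thesis
  proof
    show "I <+>\<^bsub>R\<^esub> (J +> a) \<subseteq> I +> a"
    proof
      fix z assume "z \<in> I <+>\<^bsub>R\<^esub> (J +> a)"
      then obtain i j where ij: "i \<in> I" "j \<in> J" "z = i \<oplus> (j \<oplus> a)" by (auto simp: set_add_def' a_r_coset_def')
      then have "z = (i \<oplus> j) \<oplus> a" using I.Icarr J.Icarr a by (simp add: a_assoc)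
      moreover have "i \<oplus> j \<in> I" using ij sub by auto
      ultimately show "z \<in> I +> a" by (auto simp: a_r_coset_def')
    qed
    show "I +> a \<subseteq> I <+>\<^bsub>R\<^esub> (J +> a)"
    proof
      fix z assume "z \<in> I +> a"
      then obtain i where i: "i \<in> I" "z = i \<oplus> a" by (auto simp: a_r_coset_def')
      moreover have "a \<in> J +> a" using J.a_rcos_self[OF a] .
      ultimately show "z \<in> I <+>\<^bsub>R\<^esub> (J +> a)" by (auto simp: set_add_def')
    qed
  qed
qed

context transcendental
begin

lemma loc_ideal_antimono: "loc_ideal q (Suc n) \<subseteq> loc_ideal q n"
proof
  fix z assume "z \<in> loc_ideal q (Suc n)"
  then obtain a where "a \<in> A" "z = a * (q - 1) ^ Suc n" by (auto simp: loc_ideal_eq)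
  then have "z = (a * (q - 1)) * (q - 1) ^ n" "a * (q - 1) \<in> A"
    using A_closed(4) A_minus[OF A_q(1) A_closed(2)] by auto
  then show "z \<in> loc_ideal q n" by (auto simp: loc_ideal_eq)
qed

abbreviation "red n \<equiv> set_add (loc_ring q) (loc_ideal q n)"

lemma red_res: "a \<in> A \<Longrightarrow> red n (res q (Suc n) a) = res q n a"
  unfolding res_def by (rule A.set_add_rcos[OF loc_ideal_ideal loc_ideal_ideal loc_ideal_antimono])

lemma red_hom: "red n \<in> ring_hom (loc_quot q (Suc n)) (loc_quot q n)"
proof (rule ring_hom_memI)
  fix X Y assume "X \<in> carrier (loc_quot q (Suc n))" "Y \<in> carrier (loc_quot q (Suc n))"
  then obtain a b where "a \<in> A" "b \<in> A" "X = res q (Suc n) a" "Y = res q (Suc n) b" by (auto simp: B_carrier)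
  then show "red n X \<in> carrier (loc_quot q n)"
    "red n (X \<otimes>\<^bsub>loc_quot q (Suc n)\<^esub> Y) = red n X \<otimes>\<^bsub>loc_quot q n\<^esub> red n Y"
    "red n (X \<oplus>\<^bsub>loc_quot q (Suc n)\<^esub> Y) = red n X \<oplus>\<^bsub>loc_quot q n\<^esub> red n Y"
    by (simp_all add: res_ops red_res A_closed res_closed)
next
  show "red n \<one>\<^bsub>loc_quot q (Suc n)\<^esub> = \<one>\<^bsub>loc_quot q n\<^esub>"
    using red_res[OF A_closed(2)] res_ops(5)[OF A_closed(1,1)] by simp
qed

lemma red_surj: "red n ` carrier (loc_quot q (Suc n)) = carrier (loc_quot q n)"
  by (auto simp: B_carrier red_res image_iff)

lemma A_laurent_ops: "I = {0..} \<or> I = {..0} \<or> I = UNIV \<Longrightarrow> laurent_ops (loc_ring q) I"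
  by (intro laurent_ops.intro laurent_ops_axioms.intro A.is_cring)

lemma B_laurent_ops: "I = {0..} \<or> I = {..0} \<or> I = UNIV \<Longrightarrow> laurent_ops (loc_quot q n) I"
  by (intro laurent_ops.intro laurent_ops_axioms.intro B_cring)

lemma red_op_symop:
  assumes I: "I = {0..} \<or> I = {..0} \<or> I = UNIV" and P: "\<And>d m. P d m \<in> carrier (loc_quot q (Suc n))"
  shows "red_op q n I (symop (loc_quot q (Suc n)) I P) = symop (loc_quot q n) I (\<lambda>d m. red n (P d m))"
  unfolding red_op_def red_poly_def
  by (rule descend_symop[OF B_laurent_ops[OF I] B_laurent_ops[OF I] red_hom red_surj P refl])

lemma op_mod_symop:
  assumes I: "I = {0..} \<or> I = {..0} \<or> I = UNIV" and P: "\<And>d m. P d m \<in> A"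
    and \<phi>: "\<And>f. f \<in> carrier (laurent (loc_ring q) I) \<Longrightarrow> \<phi> f = symop (loc_ring q) I P f"
  shows "op_mod q n I \<phi> = symop (loc_quot q n) I (\<lambda>d m. res q n (P d m))"
  unfolding op_mod_def poly_mod_def res_def[symmetric]
  by (rule descend_symop[OF A_laurent_ops[OF I] B_laurent_ops[OF I] res_hom B_carrier[symmetric] P \<phi>])

end

section \<open>The action of the free algebra by diagonal operators\<close>

fun gdeg :: "gen \<Rightarrow> int"
  where "gdeg Gen_E = 1" | "gdeg Gen_F = -1" | "gdeg Gen_K = 0" | "gdeg Gen_Kinv = 0"

text \<open>The formulas for \<open>\<alpha>\<close> and \<open>\<gamma>\<close> by \<open>q\<close>-derivatives look different, but in both cases a generator
  multiplies \<open>x\<^sup>m\<close> by this coefficient and shifts the exponent by its degree.\<close>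

fun gcoef :: "'k::field \<Rightarrow> gen \<Rightarrow> int \<Rightarrow> 'k"
  where
    "gcoef q Gen_E m = - q * (q powi (2 * m) - 1) / (q - inverse q)"
  | "gcoef q Gen_F m = (1 - q powi (- 2 * m)) / (q - inverse q)"
  | "gcoef q Gen_K m = q powi (2 * m)"
  | "gcoef q Gen_Kinv m = q powi (- 2 * m)"

primrec wdeg :: "gen list \<Rightarrow> int"
  where "wdeg [] = 0" | "wdeg (g # w) = gdeg g + wdeg w"

primrec wcoef :: "'k::field \<Rightarrow> gen list \<Rightarrow> int \<Rightarrow> 'k"
  where "wcoef q [] m = 1" | "wcoef q (g # w) m = gcoef q g (m + wdeg w) * wcoef q w m"

lemma wdeg_append: "wdeg (u @ v) = wdeg u + wdeg v"
  by (induction u) simp_all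

lemma wcoef_append: "wcoef q (u @ v) m = wcoef q u (m + wdeg v) * wcoef q v m"
  by (induction u) (simp_all add: wdeg_append algebra_simps)

definition free_lin :: "(gen list \<Rightarrow> 'k) \<Rightarrow> (gen list \<Rightarrow> 'k) \<Rightarrow> 'k::field"
  where "free_lin X f = (\<Sum>w\<in>{w. f w \<noteq> 0}. f w * X w)"

text \<open>The symbol of the operator by which an element of the free algebra acts on Laurent polynomials.\<close>

definition fsym :: "'k::field \<Rightarrow> (gen list \<Rightarrow> 'k) \<Rightarrow> int \<Rightarrow> int \<Rightarrow> 'k"
  where "fsym q f d m = free_lin (\<lambda>w. if wdeg w = d then wcoef q w m else 0) f"

interpretation free: ring "free_alg :: (gen list \<Rightarrow> 'k::field) ring"
  by (rule free_alg_ring)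

lemma free_carrier: "f \<in> carrier free_alg \<longleftrightarrow> finite {w. f w \<noteq> 0}"
  by (simp add: free_alg_def)

lemma free_ops: "(f \<oplus>\<^bsub>free_alg\<^esub> g) w = f w + g w" "\<zero>\<^bsub>free_alg\<^esub> w = 0"
  "\<one>\<^bsub>free_alg\<^esub> = fscal 1"
  by (simp_all add: free_alg_def fscal_def)

lemma free_uminus:
  assumes "f \<in> carrier free_alg" shows "(\<ominus>\<^bsub>free_alg\<^esub> f) w = - f w"
proof -
  have "f w + (\<ominus>\<^bsub>free_alg\<^esub> f) w = 0"
    using fun_cong[OF free.r_neg[OF assms], of w] unfolding free_ops .
  then show ?thesis by (simp add: add_eq_0_iff)
qed

lemma fscal_closed: "fscal c \<in> carrier free_alg"
  unfolding free_carrier by (rule finite_subset[of _ "{[]}"]) (auto simp: fscal_def)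

lemma fgen_closed: "fgen g \<in> carrier free_alg"
  unfolding free_carrier by (rule finite_subset[of _ "{[g]}"]) (auto simp: fgen_def)

lemma free_lin_superset:
  assumes "finite F" "{w. f w \<noteq> 0} \<subseteq> F" shows "free_lin X f = (\<Sum>w\<in>F. f w * X w)"
  unfolding free_lin_def using assms by (intro sum.mono_neutral_left) auto

lemma free_lin_add:
  assumes "f \<in> carrier free_alg" "g \<in> carrier free_alg"
  shows "free_lin X (f \<oplus>\<^bsub>free_alg\<^esub> g) = free_lin X f + free_lin X g"
proof -
  let ?F = "{w. f w \<noteq> 0} \<union> {w. g w \<noteq> 0}"
  have F: "finite ?F" using assms by (simp add: free_carrier)
  have "free_lin X (f \<oplus>\<^bsub>free_alg\<^esub> g) = (\<Sum>w\<in>?F. (f \<oplus>\<^bsub>free_alg\<^esub> g) w * X w)"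
    by (rule free_lin_superset[OF F]) (auto simp: free_ops)
  also have "\<dots> = (\<Sum>w\<in>?F. f w * X w) + (\<Sum>w\<in>?F. g w * X w)"
    by (simp add: free_ops algebra_simps sum.distrib)
  finally show ?thesis using free_lin_superset[OF F, of f X] free_lin_superset[OF F, of g X] by simp
qed

lemma free_lin_uminus:
  assumes "f \<in> carrier free_alg" shows "free_lin X (\<ominus>\<^bsub>free_alg\<^esub> f) = - free_lin X f"
  unfolding free_lin_def using free_uminus[OF assms] by (simp add: sum_negf)

lemma free_lin_mult:
  assumes f: "f \<in> carrier free_alg" and g: "g \<in> carrier free_alg"
  shows "free_lin X (f \<otimes>\<^bsub>free_alg\<^esub> g) = free_lin (\<lambda>v. free_lin (\<lambda>u. X (u @ v)) f) g"
proof -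
  let ?A = "{w. f w \<noteq> 0}" and ?B = "{w. g w \<noteq> 0}"
  let ?W = "(\<lambda>(u, v). u @ v) ` (?A \<times> ?B)"
  have fin: "finite ?A" "finite ?B" "finite ?W" using f g by (auto simp: free_carrier)
  have app: "(f \<otimes>\<^bsub>free_alg\<^esub> g) w = (\<Sum>i\<le>length w. f (take i w) * g (drop i w))" for w
    by (simp add: free_alg_def)
  have sub: "{w. (f \<otimes>\<^bsub>free_alg\<^esub> g) w \<noteq> 0} \<subseteq> ?W"
  proof
    fix w assume "w \<in> {w. (f \<otimes>\<^bsub>free_alg\<^esub> g) w \<noteq> 0}"
    then obtain i where "f (take i w) * g (drop i w) \<noteq> 0"
      unfolding app by (metis (mono_tags, lifting) mem_Collect_eq sum.neutral)
    then show "w \<in> ?W" by (intro image_eqI[of _ _ "(take i w, drop i w)"]) auto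
  qed
  let ?t = "\<lambda>(w, i). f (take i w) * g (drop i w) * X w"
  have "free_lin X (f \<otimes>\<^bsub>free_alg\<^esub> g) = (\<Sum>w\<in>?W. \<Sum>i\<le>length w. ?t (w, i))"
    by (simp add: free_lin_superset[OF fin(3) sub] app sum_distrib_right)
  also have "\<dots> = (\<Sum>z\<in>(SIGMA w:?W. {..length w}). ?t z)"
    using fin(3) by (subst sum.Sigma) (auto simp: case_prod_unfold)
  also have "\<dots> = (\<Sum>z\<in>(\<lambda>(u, v). (u @ v, length u)) ` (?A \<times> ?B). ?t z)"
  proof (rule sum.mono_neutral_right)
    show "finite (SIGMA w:?W. {..length w})" using fin(3) by simp
    show "(\<lambda>(u, v). (u @ v, length u)) ` (?A \<times> ?B) \<subseteq> (SIGMA w:?W. {..length w})" by auto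
    show "\<forall>z\<in>(SIGMA w:?W. {..length w}) - (\<lambda>(u, v). (u @ v, length u)) ` (?A \<times> ?B). ?t z = 0"
    proof
      fix z assume z: "z \<in> (SIGMA w:?W. {..length w}) - (\<lambda>(u, v). (u @ v, length u)) ` (?A \<times> ?B)"
      obtain w i where wi: "z = (w, i)" "i \<le> length w" using z by auto
      have "\<not> (take i w \<in> ?A \<and> drop i w \<in> ?B)"
      proof
        assume "take i w \<in> ?A \<and> drop i w \<in> ?B"
        then have "z \<in> (\<lambda>(u, v). (u @ v, length u)) ` (?A \<times> ?B)"
          using wi by (intro image_eqI[of _ _ "(take i w, drop i w)"]) auto
        with z show False by blast
      qed
      then show "?t z = 0" using wi(1) by auto
    qed
  qed
  also have "\<dots> = (\<Sum>(u, v)\<in>?A \<times> ?B. f u * g v * X (u @ v))"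
    by (subst sum.reindex) (auto simp: inj_on_def case_prod_unfold intro!: sum.cong)
  also have "\<dots> = (\<Sum>u\<in>?A. \<Sum>v\<in>?B. f u * g v * X (u @ v))"
    by (rule sum.cartesian_product[symmetric])
  also have "\<dots> = (\<Sum>v\<in>?B. \<Sum>u\<in>?A. f u * g v * X (u @ v))"
    by (rule sum.swap)
  also have "\<dots> = free_lin (\<lambda>v. free_lin (\<lambda>u. X (u @ v)) f) g"
    by (simp add: free_lin_def sum_distrib_left mult.assoc mult.left_commute)
  finally show ?thesis .
qed

lemma free_lin_fgen: "free_lin X (fgen g) = X [g]"
proof -
  have "free_lin X (fgen g) = (\<Sum>w\<in>{[g]}. fgen g w * X w)"
    by (rule free_lin_superset) (auto simp: fgen_def)
  then show ?thesis by (simp add: fgen_def)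
qed

lemma free_lin_fscal: "free_lin X (fscal c) = c * X []"
proof -
  have "free_lin X (fscal c) = (\<Sum>w\<in>{[]}. fscal c w * X w)"
    by (rule free_lin_superset) (auto simp: fscal_def)
  then show ?thesis by (simp add: fscal_def)
qed

lemma fsym_add:
  "f \<in> carrier free_alg \<Longrightarrow> g \<in> carrier free_alg \<Longrightarrow> fsym q (f \<oplus>\<^bsub>free_alg\<^esub> g) d m = fsym q f d m + fsym q g d m"
  by (simp add: fsym_def free_lin_add)

lemma fsym_uminus: "f \<in> carrier free_alg \<Longrightarrow> fsym q (\<ominus>\<^bsub>free_alg\<^esub> f) d m = - fsym q f d m"
  by (simp add: fsym_def free_lin_uminus)

lemma fsym_minus:
  "f \<in> carrier free_alg \<Longrightarrow> g \<in> carrier free_alg \<Longrightarrow> fsym q (f \<ominus>\<^bsub>free_alg\<^esub> g) d m = fsym q f d m - fsym q g d m"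
  by (simp add: a_minus_def fsym_add fsym_uminus)

lemma fsym_fgen: "fsym q (fgen g) d m = (if d = gdeg g then gcoef q g m else 0)"
  by (simp add: fsym_def free_lin_fgen)

lemma fsym_fscal: "fsym q (fscal c) d m = (if d = 0 then c else 0)"
  by (simp add: fsym_def free_lin_fscal)

lemma fsym_mult_lin:
  assumes "f \<in> carrier free_alg" "g \<in> carrier free_alg"
  shows "fsym q (f \<otimes>\<^bsub>free_alg\<^esub> g) d m =
    free_lin (\<lambda>v. wcoef q v m * fsym q f (d - wdeg v) (m + wdeg v)) g"
proof -
  have "free_lin (\<lambda>u. if wdeg (u @ v) = d then wcoef q (u @ v) m else 0) f =
      wcoef q v m * fsym q f (d - wdeg v) (m + wdeg v)" for v
    unfolding fsym_def free_lin_def sum_distrib_left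
    by (intro sum.cong refl) (auto simp: wdeg_append wcoef_append)
  then show ?thesis by (simp add: fsym_def[of q "f \<otimes>\<^bsub>free_alg\<^esub> g"] free_lin_mult[OF assms])
qed

lemma fsym_mult_fgen:
  "f \<in> carrier free_alg \<Longrightarrow> fsym q (f \<otimes>\<^bsub>free_alg\<^esub> fgen g) d m = gcoef q g m * fsym q f (d - gdeg g) (m + gdeg g)"
  by (simp add: fsym_mult_lin fgen_closed free_lin_fgen)

lemma fsym_mult:
  assumes f: "f \<in> carrier free_alg" and g: "g \<in> carrier free_alg"
    and D: "finite D" "wdeg ` {w. g w \<noteq> 0} \<subseteq> D"
  shows "fsym q (f \<otimes>\<^bsub>free_alg\<^esub> g) d m = (\<Sum>e\<in>D. fsym q f (d - e) (m + e) * fsym q g e m)"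
proof -
  let ?B = "{w. g w \<noteq> 0}"
  have fin: "finite ?B" using g by (simp add: free_carrier)
  have "fsym q (f \<otimes>\<^bsub>free_alg\<^esub> g) d m =
      (\<Sum>v\<in>?B. g v * (wcoef q v m * fsym q f (d - wdeg v) (m + wdeg v)))"
    by (simp add: fsym_mult_lin[OF f g] free_lin_def)
  also have "\<dots> = (\<Sum>v\<in>?B. \<Sum>e\<in>D. if e = wdeg v then g v * (wcoef q v m * fsym q f (d - e) (m + e)) else 0)"
    using D by (intro sum.cong refl) (auto simp: sum.delta')
  also have "\<dots> = (\<Sum>e\<in>D. \<Sum>v\<in>?B. if e = wdeg v then g v * (wcoef q v m * fsym q f (d - e) (m + e)) else 0)"
    by (rule sum.swap)
  also have "\<dots> = (\<Sum>e\<in>D. fsym q f (d - e) (m + e) * fsym q g e m)"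
    unfolding fsym_def[of q g] free_lin_def sum_distrib_left
    by (intro sum.cong refl) auto
  finally show ?thesis .
qed

lemma fsym_fscal_mult:
  assumes "g \<in> carrier free_alg" shows "fsym q (fscal c \<otimes>\<^bsub>free_alg\<^esub> g) d m = c * fsym q g d m"
proof -
  have "fsym q (fscal c \<otimes>\<^bsub>free_alg\<^esub> g) d m = free_lin (\<lambda>v. wcoef q v m * (if d - wdeg v = 0 then c else 0)) g"
    by (simp add: fsym_mult_lin[OF fscal_closed assms] fsym_fscal)
  also have "\<dots> = c * fsym q g d m"
    unfolding fsym_def free_lin_def sum_distrib_left by (intro sum.cong refl) auto
  finally show ?thesis .
qed

lemma fsym_finite_degrees:
  assumes "f \<in> carrier free_alg" shows "finite {d. \<exists>m. fsym q f d m \<noteq> 0}"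
proof (rule finite_subset)
  show "finite (wdeg ` {w. f w \<noteq> 0})" using assms by (simp add: free_carrier)
  show "{d. \<exists>m. fsym q f d m \<noteq> 0} \<subseteq> wdeg ` {w. f w \<noteq> 0}"
  proof
    fix d assume "d \<in> {d. \<exists>m. fsym q f d m \<noteq> 0}"
    then obtain m where "fsym q f d m \<noteq> 0" by blast
    moreover have "fsym q f d m = 0" if "d \<notin> wdeg ` {w. f w \<noteq> 0}"
      unfolding fsym_def free_lin_def using that by (intro sum.neutral) auto
    ultimately show "d \<in> wdeg ` {w. f w \<noteq> 0}" by blast
  qed
qed

text \<open>Generators shift exponents by at most one, so a word can pass from one half-line of exponents to
  the other only by applying \<open>E\<close> or \<open>F\<close> to the exponent \<open>0\<close>, where their coefficients vanish.\<close>

lemma wcoef_crossing: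
  "(m \<ge> 0 \<and> m + wdeg w < 0) \<or> (m \<le> 0 \<and> m + wdeg w > 0) \<Longrightarrow> wcoef q w m = 0"
proof (induction w)
  case (Cons g w)
  show ?case
  proof (cases "(m \<ge> 0 \<and> m + wdeg w < 0) \<or> (m \<le> 0 \<and> m + wdeg w > 0)")
    case False
    then have "m + wdeg w = 0" "gdeg g \<noteq> 0" using Cons.prems by (cases g; auto)+
    then show ?thesis by (cases g) auto
  qed (use Cons.IH in simp)
qed auto

lemma fsym_crossing:
  "(m \<ge> 0 \<and> m + d < 0) \<or> (m \<le> 0 \<and> m + d > 0) \<Longrightarrow> fsym q f d m = 0"
  unfolding fsym_def free_lin_def by (intro sum.neutral) (auto simp: wcoef_crossing)

subsection \<open>The relations of \<open>U\<^sub>q\<close>\<close>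

context transcendental
begin

lemma q_minus_inverse_nz: "q - inverse q \<noteq> 0"
proof -
  have "q ^ 2 \<noteq> 1"
  proof
    assume "q ^ 2 = 1"
    then have "poly [:-1, 0, 1:] q = 0" by (simp add: power2_eq_square)
    moreover have "rat_poly [:-1, 0, 1:]" by (auto simp: coeff_pCons split: nat.split)
    ultimately show False using transcendental_poly_zero[OF trans] by fastforce
  qed
  then show ?thesis using q_nz by (simp add: power2_eq_square field_simps)
qed

definition fsym_kernel :: "(gen list \<Rightarrow> 'k) set"
  where "fsym_kernel = {f \<in> carrier free_alg. \<forall>d m. fsym q f d m = 0}"

lemma fsym_kernel_ideal: "ideal fsym_kernel free_alg"
proof (rule idealI)
  show "ring (free_alg :: (gen list \<Rightarrow> 'k) ring)" by (rule free_alg_ring)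
  show "subgroup fsym_kernel (add_monoid free_alg)"
  proof (rule subgroup.intro)
    show "fsym_kernel \<subseteq> carrier (add_monoid free_alg)" by (auto simp: fsym_kernel_def)
    show "\<one>\<^bsub>add_monoid free_alg\<^esub> \<in> fsym_kernel"
      using free.zero_closed by (simp add: fsym_kernel_def) (simp add: fsym_def free_lin_def free_ops)
    show "inv\<^bsub>add_monoid free_alg\<^esub> f \<in> fsym_kernel" if "f \<in> fsym_kernel" for f
    proof -
      have "\<ominus>\<^bsub>free_alg\<^esub> f \<in> fsym_kernel"
        using that free.a_inv_closed[of f] fsym_uminus[of f] by (simp add: fsym_kernel_def)
      then show ?thesis unfolding a_inv_def .
    qed
    show "f \<otimes>\<^bsub>add_monoid free_alg\<^esub> g \<in> fsym_kernel" if "f \<in> fsym_kernel" "g \<in> fsym_kernel" for f g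
      using that by (simp add: fsym_kernel_def fsym_add)
  qed
  fix f g :: "gen list \<Rightarrow> 'k" assume f: "f \<in> fsym_kernel" and g: "g \<in> carrier free_alg"
  have fc: "f \<in> carrier free_alg" and f0: "\<And>d m. fsym q f d m = 0" using f by (auto simp: fsym_kernel_def)
  have fin: "finite (wdeg ` {w. h w \<noteq> 0})" if "h \<in> carrier free_alg" for h :: "gen list \<Rightarrow> 'k"
    using that by (simp add: free_carrier)
  show "g \<otimes>\<^bsub>free_alg\<^esub> f \<in> fsym_kernel" "f \<otimes>\<^bsub>free_alg\<^esub> g \<in> fsym_kernel"
    using fsym_mult[OF g fc fin[OF fc] subset_refl] fsym_mult[OF fc g fin[OF g] subset_refl] f0 fc g
    by (auto simp: fsym_kernel_def)
qed

lemma q_powi_add: "q powi (a + b) = q powi a * q powi b"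
  using q_nz by (simp add: power_int_add)

lemma Uq_rels_subset: "Uq_rels q \<subseteq> fsym_kernel"
proof -
  let ?E = "fgen Gen_E" and ?F = "fgen Gen_F" and ?K = "fgen Gen_K" and ?Ki = "fgen Gen_Kinv"
  note cl = fgen_closed fscal_closed free.m_closed free.minus_closed
  note calc = fsym_minus fsym_mult_fgen fsym_fgen fsym_fscal fsym_fscal_mult cl free_ops(3)
  have KKi: "q powi (2 * m) * q powi (- 2 * m) = 1" for m
    using q_powi_add[of "2 * m" "- 2 * m"] by simp
  have 1: "fsym q (?K \<otimes>\<^bsub>free_alg\<^esub> ?Ki \<ominus>\<^bsub>free_alg\<^esub> \<one>\<^bsub>free_alg\<^esub>) d m = 0" for d m
    using KKi[of m] by (simp add: calc mult.commute)
  have 2: "fsym q (?Ki \<otimes>\<^bsub>free_alg\<^esub> ?K \<ominus>\<^bsub>free_alg\<^esub> \<one>\<^bsub>free_alg\<^esub>) d m = 0" for d m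
    using KKi[of m] by (simp add: calc mult.commute)
  have 3: "fsym q (?K \<otimes>\<^bsub>free_alg\<^esub> ?E \<otimes>\<^bsub>free_alg\<^esub> ?Ki \<ominus>\<^bsub>free_alg\<^esub> fscal (q ^ 2) \<otimes>\<^bsub>free_alg\<^esub> ?E) d m = 0" for d m
  proof -
    have "q powi (2 * (m + 1)) = q powi (2 * m) * q ^ 2" using q_powi_add[of "2 * m" 2] by (simp add: algebra_simps)
    then show ?thesis using KKi[of m] by (simp add: calc del: gcoef.simps(1)) (simp add: algebra_simps)
  qed
  have 4: "fsym q (?K \<otimes>\<^bsub>free_alg\<^esub> ?F \<otimes>\<^bsub>free_alg\<^esub> ?Ki \<ominus>\<^bsub>free_alg\<^esub> fscal (q powi (-2)) \<otimes>\<^bsub>free_alg\<^esub> ?F) d m = 0" for d m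
  proof -
    have "q powi (2 * (m - 1)) = q powi (2 * m) * q powi (-2)" using q_powi_add[of "2 * m" "-2"] by (simp add: algebra_simps)
    then show ?thesis using KKi[of m] by (simp add: calc del: gcoef.simps(2)) (simp add: algebra_simps)
  qed
  have 5: "fsym q ((?E \<otimes>\<^bsub>free_alg\<^esub> ?F \<ominus>\<^bsub>free_alg\<^esub> ?F \<otimes>\<^bsub>free_alg\<^esub> ?E)
        \<ominus>\<^bsub>free_alg\<^esub> fscal (1 / (q - inverse q)) \<otimes>\<^bsub>free_alg\<^esub> (?K \<ominus>\<^bsub>free_alg\<^esub> ?Ki)) d m = 0" for d m
  proof (cases "d = 0")
    case True
    define u v where "u = q powi (2 * m)" and "v = q powi (- (2 * m))"
    have e: "q powi (2 * (m - 1)) = u * inverse q ^ 2" "q powi (- 2 * (m + 1)) = v * inverse q ^ 2"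
      using q_powi_add[of "2 * m" "-2"] q_powi_add[of "- 2 * m" "-2"] unfolding u_def v_def
      by (simp_all add: algebra_simps power_int_minus power_inverse)
    let ?c = "q - inverse q"
    have qq: "q * inverse q = 1" using q_nz by simp
    have "(1 - v) / ?c * (- q * (u * inverse q ^ 2 - 1) / ?c) - (- q * (u - 1) / ?c) * ((1 - v * inverse q ^ 2) / ?c)
        = (u - v) / ?c"
    proof -
      have "(1 - v) * (- q * (u * inverse q ^ 2 - 1)) - (- q * (u - 1)) * (1 - v * inverse q ^ 2) = (u - v) * ?c"
      proof -
        have "(1 - v) * (- q * (u * inverse q ^ 2 - 1)) - (- q * (u - 1)) * (1 - v * inverse q ^ 2) =
            (u - v) * (q - (q * inverse q) * inverse q)"
          by (simp add: algebra_simps power2_eq_square)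
        then show ?thesis unfolding qq by simp
      qed
      then have "((1 - v) * (- q * (u * inverse q ^ 2 - 1)) - (- q * (u - 1)) * (1 - v * inverse q ^ 2)) / (?c * ?c) = (u - v) / ?c"
        using q_minus_inverse_nz by simp
      then show ?thesis by (simp only: times_divide_times_eq diff_divide_distrib[symmetric])
    qed
    then show ?thesis
      using True e by (simp add: calc u_def[symmetric] v_def[symmetric])
  qed (simp add: calc)
  show ?thesis
    unfolding Uq_rels_def Let_def using 1 2 3 4 5 by (simp add: fsym_kernel_def cl)
qed

lemma Uq_ideal_ideal: "ideal (Uq_ideal q) free_alg"
  unfolding Uq_ideal_def
  by (rule free.genideal_ideal) (auto simp: Uq_rels_def Let_def fgen_closed fscal_closed)

lemma Uq_ideal_subset: "Uq_ideal q \<subseteq> fsym_kernel"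
  unfolding Uq_ideal_def by (rule free.genideal_minimal[OF fsym_kernel_ideal Uq_rels_subset])

lemma Uq_proj_sym:
  assumes "f \<in> carrier free_alg" "g \<in> carrier free_alg" "Uq_proj q f = Uq_proj q g"
  shows "fsym q f = fsym q g"
proof -
  interpret I: ideal "Uq_ideal q" free_alg by (rule Uq_ideal_ideal)
  have "f \<ominus>\<^bsub>free_alg\<^esub> g \<in> Uq_ideal q" using I.rcos_eq_iff[OF assms(1,2)] assms(3) by (simp add: Uq_proj_def)
  then have "fsym q f d m - fsym q g d m = 0" for d m
    using Uq_ideal_subset fsym_minus[OF assms(1,2)] by (auto simp: fsym_kernel_def)
  then show ?thesis by (simp add: fun_eq_iff)
qed

end

section \<open>The actions on \<open>k[x]\<close> and \<open>k[y]\<close> have the same symbol\<close>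

text \<open>In terms of monomials this is \<open>x\<^sup>m \<mapsto> c m x\<^sup>m\<^sup>+\<^sup>d\<close>.\<close>

definition diag_op :: "int set \<Rightarrow> int \<Rightarrow> (int \<Rightarrow> 'k::field) \<Rightarrow> (int \<Rightarrow> 'k) \<Rightarrow> int \<Rightarrow> 'k"
  where "diag_op I d c = (\<lambda>f\<in>carrier (laurent field_ring I). \<lambda>j. c (j - d) * f (j - d))"

lemma field_ops: "\<zero>\<^bsub>field_ring\<^esub> = 0" "\<one>\<^bsub>field_ring\<^esub> = 1" "a \<oplus>\<^bsub>field_ring\<^esub> b = a + b"
  "a \<otimes>\<^bsub>field_ring\<^esub> b = a * b" "a \<in> carrier field_ring"
  by (simp_all add: field_ring_def)

lemma field_finsum:
  fixes f :: "'b \<Rightarrow> 'k::field"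
  assumes "finite F" shows "finsum field_ring f F = sum f F"
proof -
  interpret cring "field_ring :: 'k ring" by (rule field_ring_cring)
  show ?thesis
    using assms by (induction F rule: finite_induct) (simp_all add: field_ops Pi_def)
qed

text \<open>The argument \<open>K\<close> serves to fix the field of coefficients.\<close>

locale field_laurent_ops =
  fixes I :: "int set" and K :: "'k::field itself"
  assumes field_ray: "I = {0..} \<or> I = {..0} \<or> I = UNIV"
begin

sublocale laurent_ops "field_ring :: 'k ring" I
  by (intro laurent_ops.intro laurent_ops_axioms.intro field_ring_cring field_ray)

lemma lin_ext_diag:
  "lin_ext (laurent field_ring I) (\<lambda>m. mon field_ring (c m) (m + d)) = diag_op I d (c :: int \<Rightarrow> 'k)"
  unfolding lin_ext_def diag_op_def
proof (intro restrict_ext ext)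
  fix f :: "int \<Rightarrow> 'k" and j assume "f \<in> carrier S"
  then have fin: "finite {m. f m \<noteq> 0}" by (simp add: S_carrier field_ops)
  have "(\<Sum>m\<in>{m. f m \<noteq> 0}. f m * mon field_ring (c m) (m + d) j) = (\<Sum>m\<in>{m. f m \<noteq> 0}. if m = j - d then c m * f m else 0)"
    by (intro sum.cong) (auto simp: mon_def field_ops)
  also have "\<dots> = c (j - d) * f (j - d)" using fin by (simp add: sum.delta)
  finally show "(\<Sum>m\<in>{m. f m \<noteq> 0}. f m * mon field_ring (c m) (m + d) j) = c (j - d) * f (j - d)" .
qed

lemma diag_app: "f \<in> carrier S \<Longrightarrow> diag_op I d c f j = c (j - d) * (f (j - d) :: 'k)"
  by (simp add: diag_op_def)

lemma diag_closed:
  assumes "\<And>m. m \<in> I \<Longrightarrow> m + d \<notin> I \<Longrightarrow> c m = (0 :: 'k)" shows "diag_op I d c \<in> carrier E"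
proof -
  have "diag_op I d c f \<in> carrier S" if f: "f \<in> carrier S" for f
  proof -
    have fin: "finite {j. f j \<noteq> 0}" and out: "\<And>j. j \<notin> I \<Longrightarrow> f j = 0" using f by (auto simp: S_carrier field_ops)
    have "{j. c (j - d) * f (j - d) \<noteq> 0} \<subseteq> (\<lambda>j. j + d) ` {j. f j \<noteq> 0}"
    proof
      fix j assume "j \<in> {j. c (j - d) * f (j - d) \<noteq> 0}"
      then show "j \<in> (\<lambda>j. j + d) ` {j. f j \<noteq> 0}" by (intro image_eqI[of _ _ "j - d"]) auto
    qed
    then have "finite {j. c (j - d) * f (j - d) \<noteq> 0}" using fin finite_surj by blast
    moreover have "c (j - d) * f (j - d) = 0" if "j \<notin> I" for j
      using that out[of "j - d"] assms[of "j - d"] by (cases "j - d \<in> I") auto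
    ultimately show ?thesis using diag_app[OF f, of d c] by (simp add: S_carrier field_ops)
  qed
  then show ?thesis
    by (auto simp: E_carrier diag_op_def fun_eq_iff S_app field_ops algebra_simps)
qed

lemma diag_mult:
  assumes "diag_op I e b \<in> carrier E"
  shows "diag_op I d c \<otimes>\<^bsub>E\<^esub> diag_op I e b = diag_op I (d + e) (\<lambda>m. c (m + e) * (b m :: 'k))"
proof (rule extensionalityI[of _ "carrier S"])
  show "diag_op I d c \<otimes>\<^bsub>E\<^esub> diag_op I e b \<in> extensional (carrier S)" by (simp add: lin_end_def compose_def)
  show "diag_op I (d + e) (\<lambda>m. c (m + e) * b m) \<in> extensional (carrier S)" by (simp add: diag_op_def)
  fix f assume f: "f \<in> carrier S"
  have bf: "diag_op I e b f \<in> carrier S" by (rule E_maps[OF assms f])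
  show "(diag_op I d c \<otimes>\<^bsub>E\<^esub> diag_op I e b) f = diag_op I (d + e) (\<lambda>m. c (m + e) * b m) f"
    by (intro ext) (simp add: E_app f diag_app bf algebra_simps)
qed

lemma diag_one: "\<one>\<^bsub>E\<^esub> = diag_op I 0 (\<lambda>_. 1 :: 'k)"
  by (simp add: lin_end_def diag_op_def)

lemma diag_smult: "a \<odot>\<^bsub>E\<^esub> diag_op I d c = diag_op I d (\<lambda>m. a * (c m :: 'k))"
  by (auto simp: lin_end_def diag_op_def laurent_def field_ops restrict_def fun_eq_iff algebra_simps)

lemma mult_op_diag:
  assumes "i \<in> I" shows "mult_op S (mon field_ring 1 i) = diag_op I i (\<lambda>_. 1 :: 'k)"
  unfolding mult_op_def diag_op_def
proof (intro restrict_ext ext)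
  fix f :: "int \<Rightarrow> 'k" and j assume "f \<in> carrier S"
  then show "(mon field_ring 1 i \<otimes>\<^bsub>S\<^esub> f) j = 1 * f (j - i)"
    using mon_mult_app[OF one_closed assms, of f j] by (simp add: field_ops)
qed

lemma diag_sigma_pow:
  assumes q: "(q :: 'k) \<noteq> 0" and \<sigma>: "\<sigma> = diag_op I 0 (\<lambda>m. q powi m)"
  shows "\<sigma> [^]\<^bsub>E\<^esub> (2::int) = diag_op I 0 (\<lambda>m. q powi (2 * m))"
    "\<sigma> [^]\<^bsub>E\<^esub> (-2::int) = diag_op I 0 (\<lambda>m. q powi (- 2 * m))"
proof -
  have cl: "diag_op I 0 c \<in> carrier E" for c :: "int \<Rightarrow> 'k" by (rule diag_closed) simp
  have pw: "q powi m * q powi m = q powi (2 * m)" for m using q by (simp add: power_int_add[symmetric])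
  have nat2: "\<sigma> [^]\<^bsub>E\<^esub> (2::nat) = diag_op I 0 (\<lambda>m. q powi (2 * m))"
    unfolding \<sigma> numeral_2_eq_2 using cl diag_mult[OF cl] pw by simp
  then show "\<sigma> [^]\<^bsub>E\<^esub> (2::int) = diag_op I 0 (\<lambda>m. q powi (2 * m))"
    by (simp add: int_pow_def2)
  have one: "q powi (2 * m) * q powi (- 2 * m) = 1" for m
    using q power_int_add[of q "2 * m" "- 2 * m"] by simp
  have "inv\<^bsub>E\<^esub> diag_op I 0 (\<lambda>m. q powi (2 * m)) = diag_op I 0 (\<lambda>m. q powi (- 2 * m))"
    by (rule E.inv_char[OF cl cl]) (use one diag_mult[OF cl] in \<open>simp_all add: diag_one mult.commute\<close>)
  then show "\<sigma> [^]\<^bsub>E\<^esub> (-2::int) = diag_op I 0 (\<lambda>m. q powi (- 2 * m))"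
    using nat2 by (simp add: int_pow_def2 del: pow_nat)
qed

lemma free_lift_eq_symop:
  assumes \<rho>: "\<And>g. \<rho> g = diag_op I (gdeg g) (gcoef (q::'k) g)"
    and cl: "\<And>g. diag_op I (gdeg g) (gcoef q g) \<in> carrier E"
    and f: "f \<in> carrier free_alg"
  shows "free_lift E \<rho> f = symop field_ring I (fsym q f)"
proof (rule extensionalityI[of _ "carrier S"])
  have word: "foldr (\<lambda>g u. \<rho> g \<otimes>\<^bsub>E\<^esub> u) w \<one>\<^bsub>E\<^esub> = diag_op I (wdeg w) (wcoef q w) \<and>
      diag_op I (wdeg w) (wcoef q w) \<in> carrier E" for w
  proof (induction w)
    case Nil
    show ?case using E.one_closed unfolding diag_one by simp
  next
    case (Cons g w)
    have c1: "foldr (\<lambda>g u. \<rho> g \<otimes>\<^bsub>E\<^esub> u) (g # w) \<one>\<^bsub>E\<^esub> = \<rho> g \<otimes>\<^bsub>E\<^esub> diag_op I (wdeg w) (wcoef q w)"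
      using Cons.IH by simp
    also have "\<dots> = diag_op I (wdeg (g # w)) (wcoef q (g # w))"
      unfolding \<rho> diag_mult[OF conjunct2[OF Cons.IH]] by (rule arg_cong2[of _ _ _ _ "diag_op I"]) (auto simp: fun_eq_iff)
    finally have eq: "foldr (\<lambda>g u. \<rho> g \<otimes>\<^bsub>E\<^esub> u) (g # w) \<one>\<^bsub>E\<^esub> = diag_op I (wdeg (g # w)) (wcoef q (g # w))" .
    have mem: "\<rho> g \<otimes>\<^bsub>E\<^esub> diag_op I (wdeg w) (wcoef q w) \<in> carrier E"
      unfolding \<rho> using cl Cons.IH by (intro E.m_closed) auto
    show ?case using mem unfolding c1[symmetric] unfolding eq by (intro conjI refl)
  qed
  let ?W = "{w. f w \<noteq> 0}"
  have fin: "finite ?W" using f by (simp add: free_carrier)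
  have lift: "free_lift E \<rho> f = (\<Oplus>\<^bsub>E\<^esub>w\<in>?W. f w \<odot>\<^bsub>E\<^esub> diag_op I (wdeg w) (wcoef q w))"
    unfolding free_lift_def using word by simp
  have term_cl: "f w \<odot>\<^bsub>E\<^esub> diag_op I (wdeg w) (wcoef q w) \<in> carrier E" for w
    using word by (intro E_smult_closed) (auto simp: field_ops)
  have "free_lift E \<rho> f \<in> carrier E" unfolding lift using term_cl by (intro E.finsum_closed) auto
  then show "free_lift E \<rho> f \<in> extensional (carrier S)" by (simp add: E_carrier PiE_def)
  show "symop field_ring I (fsym q f) \<in> extensional (carrier S)" by (simp add: symop_def)
  fix g :: "int \<Rightarrow> 'k" assume g: "g \<in> carrier S"
  have fing: "finite {m. g m \<noteq> 0}" using g by (simp add: S_carrier field_ops)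
  show "free_lift E \<rho> f g = symop field_ring I (fsym q f) g"
  proof
    fix j
    have "free_lift E \<rho> f g j = (\<Sum>w\<in>?W. (f w \<odot>\<^bsub>E\<^esub> diag_op I (wdeg w) (wcoef q w)) g j)"
      unfolding lift using E_finsum_app[OF fin term_cl g] field_finsum[OF fin] by simp
    also have "\<dots> = (\<Sum>w\<in>?W. f w * (wcoef q w (j - wdeg w) * g (j - wdeg w)))"
      using g by (simp add: E_app diag_app field_ops)
    also have "\<dots> = (\<Sum>w\<in>?W. \<Sum>m\<in>{m. g m \<noteq> 0}. if m = j - wdeg w then f w * (wcoef q w m * g m) else 0)"
      using fing by (intro sum.cong refl) (simp add: sum.delta)
    also have "\<dots> = (\<Sum>m\<in>{m. g m \<noteq> 0}. \<Sum>w\<in>?W. if m = j - wdeg w then f w * (wcoef q w m * g m) else 0)"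
      by (rule sum.swap)
    also have "\<dots> = (\<Sum>m\<in>{m. g m \<noteq> 0}. g m * fsym q f (j - m) m)"
      unfolding fsym_def free_lin_def sum_distrib_left by (intro sum.cong refl) auto
    also have "\<dots> = symop field_ring I (fsym q f) g j"
      using g fing by (simp add: symop_def field_finsum field_ops)
    finally show "free_lift E \<rho> f g j = symop field_ring I (fsym q f) g j" .
  qed
qed

end

context transcendental
begin

interpretation X: field_laurent_ops "{0..}" "TYPE('k)" by unfold_locales simp
interpretation Y: field_laurent_ops "{..0}" "TYPE('k)" by unfold_locales simp

text \<open>The coefficients in the shape in which the formula for \<open>\<gamma>\<close> produces them.\<close>

lemma gcoef_F_alt: "gcoef q Gen_F m = q powi (-1 - 2 * m) * ((q powi (2 * m) - 1) / (1 - q powi (-2)))"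
  and gcoef_E_alt: "gcoef q Gen_E m = (1 - q powi (2 * m)) / (1 - q powi (-2))"
proof -
  have d: "1 - q powi (-2) = inverse q * (q - inverse q)"
    using q_nz by (simp add: power_int_minus power2_eq_square field_simps)
  have k: "q powi (2 * m) * q powi (- 2 * m) = 1" using q_powi_add[of "2 * m" "- 2 * m"] by simp
  have s: "q powi (-1 - 2 * m) = inverse q * q powi (- 2 * m)"
    using q_powi_add[of "-1" "- 2 * m"] by (simp add: power_int_minus)
  show "gcoef q Gen_E m = (1 - q powi (2 * m)) / (1 - q powi (-2))"
    unfolding d using q_nz q_minus_inverse_nz by (simp add: field_simps)
  have "q powi (-1 - 2 * m) * (q powi (2 * m) - 1) = inverse q * (1 - q powi (- 2 * m))"
    unfolding s using k by (simp add: algebra_simps)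
  then have "q powi (-1 - 2 * m) * ((q powi (2 * m) - 1) / (1 - q powi (-2))) =
      inverse q * (1 - q powi (- 2 * m)) / (inverse q * (q - inverse q))"
    unfolding d by simp
  also have "\<dots> = gcoef q Gen_F m" using q_nz by simp
  finally show "gcoef q Gen_F m = q powi (-1 - 2 * m) * ((q powi (2 * m) - 1) / (1 - q powi (-2)))" by simp
qed

lemma gcoef_K: "gcoef q Gen_K = (\<lambda>m. q powi (2 * m))" "gcoef q Gen_Kinv = (\<lambda>m. q powi (- 2 * m))"
  by (simp_all add: fun_eq_iff)

lemma gcoef_closed:
  assumes "I = {0..} \<or> I = {..0}" shows "diag_op I (gdeg g) (gcoef q g) \<in> carrier (lin_end field_ring (laurent field_ring I))"
proof -
  interpret L: field_laurent_ops I "TYPE('k)" by unfold_locales (use assms in auto)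
  show ?thesis
  proof (rule L.diag_closed)
    fix m assume m: "m \<in> I" "m + gdeg g \<notin> I"
    then show "gcoef q g m = 0" using wcoef_crossing[of m "[g]" q] assms by auto
  qed
qed

lemma alpha_gen_diag: "alpha_gen q g = diag_op {0..} (gdeg g) (gcoef q g)"
proof -
  have sigma: "sigma_x q = diag_op {0..} 0 (\<lambda>m. q powi m)"
    unfolding sigma_x_def using X.lin_ext_diag[of "\<lambda>m. q powi m" 0] by simp
  have del: "del_x q = diag_op {0..} (-1) (\<lambda>m. (q powi (2 * m) - 1) / (q ^ 2 - 1))"
    unfolding del_x_def using X.lin_ext_diag[of "\<lambda>m. (q powi (2 * m) - 1) / (q ^ 2 - 1)" "-1"] by simp
  have del_cl: "diag_op {0..} (-1) (\<lambda>m. (q powi (2 * m) - 1) / (q ^ 2 - 1)) \<in> carrier End_kx"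
  proof (rule X.diag_closed)
    fix m :: int assume "m \<in> {0..}" "m + - 1 \<notin> {0..}"
    then have "m = 0" by auto
    then show "(q powi (2 * m) - 1) / (q ^ 2 - 1) = 0" by simp
  qed
  have q2: "q powi (-2) * q ^ 2 = 1" using q_nz by (simp add: power_int_minus)
  have den: "1 - q powi (-2) = q powi (-2) * (q ^ 2 - 1)" using q2 by (simp add: algebra_simps)
  show ?thesis
  proof (cases g)
    case Gen_E
    have "- (q ^ 2) * (1 * ((q powi (2 * m) - 1) / (q ^ 2 - 1))) = gcoef q Gen_E m" for m
    proof -
      have "(1 - q powi (2 * m)) / (q powi (-2) * (q ^ 2 - 1)) = q ^ 2 * ((1 - q powi (2 * m)) / (q ^ 2 - 1))"
        using q_nz by (simp add: power_int_minus field_simps)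
      then show ?thesis unfolding gcoef_E_alt den by (simp add: algebra_simps diff_divide_distrib)
    qed
    then have "(\<lambda>m. - (q ^ 2) * (1 * ((q powi (2 * m) - 1) / (q ^ 2 - 1)))) = gcoef q Gen_E" by (rule ext)
    moreover have "2 \<in> {0::int..}" by simp
    ultimately show ?thesis
      unfolding Gen_E alpha_gen.simps del X.mult_op_diag[OF \<open>2 \<in> {0::int..}\<close>] X.diag_mult[OF del_cl] X.diag_smult
      by (simp del: gcoef.simps)
  next
    case Gen_F
    have "inverse q * (q powi (- 2 * (m + - 1)) * ((q powi (2 * m) - 1) / (q ^ 2 - 1))) = gcoef q Gen_F m" for m
    proof -
      have "q powi (- 2 * (m + - 1)) = q ^ 2 * q powi (- 2 * m)"
        using q_powi_add[of 2 "- 2 * m"] by (simp add: algebra_simps)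
      moreover have "q powi (-1 - 2 * m) = inverse q * q powi (- 2 * m)"
        using q_powi_add[of "-1" "- 2 * m"] by (simp add: power_int_minus)
      moreover have "(q powi (2 * m) - 1) / (q powi (-2) * (q ^ 2 - 1)) = q ^ 2 * ((q powi (2 * m) - 1) / (q ^ 2 - 1))"
        using q_nz by (simp add: power_int_minus field_simps)
      ultimately show ?thesis unfolding gcoef_F_alt den by simp
    qed
    then have "(\<lambda>m. inverse q * (q powi (- 2 * (m + - 1)) * ((q powi (2 * m) - 1) / (q ^ 2 - 1)))) = gcoef q Gen_F"
      by (rule ext)
    then show ?thesis
      unfolding Gen_F alpha_gen.simps del X.diag_sigma_pow[OF q_nz sigma] X.diag_mult[OF del_cl] X.diag_smult
      by (simp del: gcoef.simps)
  qed (simp_all add: X.diag_sigma_pow[OF q_nz sigma] gcoef_K del: gcoef.simps)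
qed

lemma gamma_gen_diag: "gamma_gen q g = diag_op {..0} (gdeg g) (gcoef q g)"
proof -
  have sigma: "sigma_y q = diag_op {..0} 0 (\<lambda>m. q powi m)"
    unfolding sigma_y_def using Y.lin_ext_diag[of "\<lambda>m. q powi m" 0] by (simp add: Let_def ypow_def)
  have del: "del_y q = diag_op {..0} 1 (gcoef q Gen_E)"
    unfolding del_y_def using Y.lin_ext_diag[of "gcoef q Gen_E" 1] unfolding gcoef_E_alt by (simp add: Let_def ypow_def add.commute)
  have del_cl: "diag_op {..0} 1 (gcoef q Gen_E) \<in> carrier End_ky"
    using gcoef_closed[of "{..0}" Gen_E] by simp
  have y2: "mult_op ky (ypow 1 2) = diag_op {..0} (-2) (\<lambda>_. 1 :: 'k)"
    unfolding ypow_def by (rule Y.mult_op_diag) simp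
  have one_cl: "diag_op {..0} (-2) (\<lambda>_. 1 :: 'k) \<in> carrier End_ky" by (rule Y.diag_closed) auto
  show ?thesis
  proof (cases g)
    case Gen_F
    have "- (q powi (-3)) * (q powi (- 2 * (m + 1 + -2)) * 1 * gcoef q Gen_E m) = gcoef q Gen_F m" for m
    proof -
      have "q powi (-3) * q powi (- 2 * (m + 1 + -2)) = q powi (-1 - 2 * m)"
        using q_powi_add[of "-3" "- 2 * (m + 1 + -2)"] by (simp add: algebra_simps)
      moreover have "- a * (b * 1 * ((1 - c) / e)) = (a * b) * ((c - 1) / e)" for a b c e :: 'k
        by (simp add: diff_divide_distrib algebra_simps)
      ultimately show ?thesis unfolding gcoef_F_alt gcoef_E_alt by metis
    qed
    then have "(\<lambda>m. - (q powi (-3)) * (q powi (- 2 * (m + 1 + -2)) * 1 * gcoef q Gen_E m)) = gcoef q Gen_F"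
      by (rule ext)
    then show ?thesis
      unfolding Gen_F gamma_gen.simps del Y.diag_sigma_pow[OF q_nz sigma] y2 Y.diag_mult[OF one_cl]
        Y.diag_mult[OF del_cl] Y.diag_smult
      by (simp del: gcoef.simps)
  qed (simp_all add: Y.diag_sigma_pow[OF q_nz sigma] gcoef_K del del: gcoef.simps)
qed

lemma alpha_symop:
  assumes "f \<in> carrier free_alg" shows "alpha q (Uq_proj q f) = symop field_ring {0..} (fsym q f)"
  unfolding alpha_def
proof (rule descend_eq[OF assms refl])
  fix f' :: "gen list \<Rightarrow> 'k" assume f': "f' \<in> carrier free_alg" "Uq_proj q f' = Uq_proj q f"
  show "free_lift End_kx (alpha_gen q) f' = symop field_ring {0..} (fsym q f)"
    using X.free_lift_eq_symop[OF alpha_gen_diag gcoef_closed f'(1)] Uq_proj_sym[OF f'(1) assms f'(2)] by simp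
qed

lemma gamma_symop:
  assumes "f \<in> carrier free_alg" shows "gamma q (Uq_proj q f) = symop field_ring {..0} (fsym q f)"
  unfolding gamma_def
proof (rule descend_eq[OF assms refl])
  fix f' :: "gen list \<Rightarrow> 'k" assume f': "f' \<in> carrier free_alg" "Uq_proj q f' = Uq_proj q f"
  show "free_lift End_ky (gamma_gen q) f' = symop field_ring {..0} (fsym q f)"
    using Y.free_lift_eq_symop[OF gamma_gen_diag gcoef_closed f'(1)] Uq_proj_sym[OF f'(1) assms f'(2)] by simp
qed

end

section \<open>Symbols of elements of the integral form\<close>

context transcendental
begin

lemma loc_finsum: "finite F \<Longrightarrow> (\<And>i. i \<in> F \<Longrightarrow> f i \<in> A) \<Longrightarrow> finsum (loc_ring q) f F = sum f F"
  by (induction F rule: finite_induct) (simp_all add: loc_ops Pi_def)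

lemma res_eqI: "a \<in> A \<Longrightarrow> b \<in> A \<Longrightarrow> c \<in> A \<Longrightarrow> a - b = (q - 1) ^ n * c \<Longrightarrow> res q n a = res q n b"
  using res_eq_iff by blast

text \<open>The function \<open>m \<mapsto> q\<^sup>m\<close> is not polynomial, but it becomes so modulo each power of \<open>q - 1\<close>, with
  a degree that grows with the power.\<close>

definition adic_poly :: "(int \<Rightarrow> 'k) \<Rightarrow> bool"
  where "adic_poly p \<longleftrightarrow> (\<forall>m. p m \<in> A) \<and> (\<forall>n. \<exists>k. poly_fun (B n) k (\<lambda>m. res q n (p m)))"

lemma adic_polyD: "adic_poly p \<Longrightarrow> p m \<in> A"
  by (simp add: adic_poly_def)

lemma adic_poly_add:
  assumes "adic_poly p" "adic_poly r" shows "adic_poly (\<lambda>m. p m + r m)"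
proof -
  have cl: "\<And>m. p m \<in> A" "\<And>m. r m \<in> A" using assms by (auto simp: adic_poly_def)
  have "\<exists>k. poly_fun (B n) k (\<lambda>m. res q n (p m + r m))" for n
  proof -
    interpret B: cring "B n" by (rule B_cring)
    obtain k l where k: "poly_fun (B n) k (\<lambda>m. res q n (p m))" and l: "poly_fun (B n) l (\<lambda>m. res q n (r m))"
      using assms unfolding adic_poly_def by blast
    have "poly_fun (B n) (max k l) (\<lambda>m. res q n (p m) \<oplus>\<^bsub>B n\<^esub> res q n (r m))"
      by (intro B.poly_fun_add B.poly_fun_mono[OF k] B.poly_fun_mono[OF l] res_closed cl) simp_all
    then show ?thesis using res_ops(1)[OF cl] by auto
  qed
  then show ?thesis using cl A_closed by (simp add: adic_poly_def)
qed

lemma adic_poly_mult: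
  assumes "adic_poly p" "adic_poly r" shows "adic_poly (\<lambda>m. p m * r m)"
proof -
  have cl: "\<And>m. p m \<in> A" "\<And>m. r m \<in> A" using assms by (auto simp: adic_poly_def)
  have "\<exists>k. poly_fun (B n) k (\<lambda>m. res q n (p m * r m))" for n
  proof -
    interpret B: cring "B n" by (rule B_cring)
    obtain k l where k: "poly_fun (B n) k (\<lambda>m. res q n (p m))" and l: "poly_fun (B n) l (\<lambda>m. res q n (r m))"
      using assms unfolding adic_poly_def by blast
    have "poly_fun (B n) (k + l) (\<lambda>m. res q n (p m) \<otimes>\<^bsub>B n\<^esub> res q n (r m))"
      by (intro B.poly_fun_mult k l res_closed cl)
    then show ?thesis using res_ops(2)[OF cl] by auto
  qed
  then show ?thesis using cl A_closed by (simp add: adic_poly_def)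
qed

lemma adic_poly_const: "c \<in> A \<Longrightarrow> adic_poly (\<lambda>_. c)"
proof -
  assume c: "c \<in> A"
  have "poly_fun (B n) 1 (\<lambda>m. res q n c)" for n
    using res_ops(3,4)[OF c c, of n] by simp
  then show ?thesis using c unfolding adic_poly_def by blast
qed

lemma adic_poly_sum: "finite D \<Longrightarrow> (\<And>e. e \<in> D \<Longrightarrow> adic_poly (p e)) \<Longrightarrow> adic_poly (\<lambda>m. \<Sum>e\<in>D. p e m)"
  by (induction D rule: finite_induct) (simp_all add: adic_poly_const A_closed adic_poly_add)

lemma adic_poly_shift: "adic_poly p \<Longrightarrow> adic_poly (\<lambda>m. p (m + c))"
proof -
  assume p: "adic_poly p"
  have "\<exists>k. poly_fun (B n) k (\<lambda>m. res q n (p (m + c)))" for n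
  proof -
    interpret B: cring "B n" by (rule B_cring)
    obtain k where k: "poly_fun (B n) k (\<lambda>m. res q n (p m))" using p unfolding adic_poly_def by blast
    show ?thesis using B.poly_fun_shift[OF k, of c] by blast
  qed
  then show ?thesis using p by (simp add: adic_poly_def)
qed

text \<open>The coefficients of \<open>E\<close> and \<open>F\<close> have the denominator \<open>q - q\<inverse>\<close>, but their differences are,
  up to sign, powers of \<open>q\<close>.  Integrality, polynomiality and the value at
  \<open>q = 1\<close> are all read off from the differences.\<close>

lemma A_by_differences:
  assumes "p 0 \<in> A" "\<And>m. p (m + 1) - p m \<in> A" shows "p (m::int) \<in> A"
proof (induction m rule: int_induct[of _ 0])
  case base
  show ?case by (rule assms)
next
  case (step1 i)
  have "p (i + 1) = (p (i + 1) - p i) + p i" by simp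
  then show ?case using A_closed(3)[OF assms(2) step1(2), of i] by simp
next
  case (step2 i)
  have "p (i - 1) = p i - (p (i - 1 + 1) - p (i - 1))" by simp
  then show ?case using A_minus[OF step2(2) assms(2)[of "i - 1"]] by simp
qed

lemma adic_poly_by_differences:
  assumes "p 0 \<in> A" "adic_poly (\<lambda>m. p (m + 1) - p m)" shows "adic_poly p"
proof -
  have cl: "p m \<in> A" for m
    using A_by_differences[of p m] assms adic_polyD[OF assms(2)] by blast
  have "\<exists>k. poly_fun (B n) k (\<lambda>m. res q n (p m))" for n
  proof -
    obtain k where "poly_fun (B n) k (\<lambda>m. res q n (p (m + 1) - p m))"
      using assms(2) unfolding adic_poly_def by blast
    then have "poly_fun (B n) (Suc k) (\<lambda>m. res q n (p m))" using res_ops(3)[OF cl cl] by simp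
    then show ?thesis by blast
  qed
  then show ?thesis using cl by (simp add: adic_poly_def)
qed

lemma adic_poly_geometric:
  assumes "c \<in> A" "\<And>m. p m \<in> A" "\<And>m. p (m + 1) - p m = (q - 1) * c * p m"
  shows "adic_poly p"
proof -
  have b: "(q - 1) * c \<in> A" using A_closed(4) assms(1) A_minus[OF A_q(1) A_closed(2)] by blast
  have "poly_fun (B n) n (\<lambda>m. res q n (p m))" for n
  proof -
    interpret B: cring "B n" by (rule B_cring)
    show ?thesis
    proof (rule B.poly_fun_geometric[of "res q n ((q - 1) * c)"])
      fix m
      show "res q n (p (m + 1)) \<ominus>\<^bsub>B n\<^esub> res q n (p m) = res q n ((q - 1) * c) \<otimes>\<^bsub>B n\<^esub> res q n (p m)"
        using res_ops(3)[OF assms(2) assms(2)] res_ops(2)[OF b assms(2)] assms(3) by simp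
      have "res q n ((q - 1) * c) [^]\<^bsub>B n\<^esub> n \<otimes>\<^bsub>B n\<^esub> res q n (p m) = res q n (((q - 1) * c) ^ n * p m)"
        using res_nat_pow[OF b] res_ops(2)[OF A_power[OF b] assms(2)] by simp
      also have "\<dots> = res q n 0"
        by (rule res_eqI[OF A_closed(4)[OF A_power[OF b] assms(2)] A_closed(1)
              A_closed(4)[OF A_power[OF assms(1), of n] assms(2)[of m]]])
          (simp add: power_mult_distrib mult.assoc)
      finally show "res q n ((q - 1) * c) [^]\<^bsub>B n\<^esub> n \<otimes>\<^bsub>B n\<^esub> res q n (p m) = \<zero>\<^bsub>B n\<^esub>"
        using res_ops(4)[OF A_closed(1,1)] by simp
    qed (use res_closed assms(2) b in auto)
  qed
  then show ?thesis using assms(2) unfolding adic_poly_def by blast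
qed

lemma adic_poly_q_powi: "adic_poly (\<lambda>m. q powi (2 * m))" "adic_poly (\<lambda>m. q powi (- 2 * m))"
proof -
  show "adic_poly (\<lambda>m. q powi (2 * m))"
  proof (rule adic_poly_geometric[of "q + 1"])
    show "q + 1 \<in> A" by (intro A_closed A_q)
    show "q powi (2 * m) \<in> A" for m by (rule A_q_powi)
    show "q powi (2 * (m + 1)) - q powi (2 * m) = (q - 1) * (q + 1) * q powi (2 * m)" for m
      using q_powi_add[of "2 * m" 2] by (simp add: algebra_simps power2_eq_square)
  qed
  show "adic_poly (\<lambda>m. q powi (- 2 * m))"
  proof (rule adic_poly_geometric[of "- (q + 1) * q powi (-2)"])
    show "- (q + 1) * q powi (-2) \<in> A" by (intro A_closed A_uminus A_q A_q_powi)
    show "q powi (- 2 * m) \<in> A" for m by (rule A_q_powi)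
    have "q powi (-2) * q ^ 2 = 1" using q_nz by (simp add: power_int_minus)
    then have e: "q powi (-2) - 1 = (q - 1) * (- (q + 1) * q powi (-2))" by (simp add: algebra_simps power2_eq_square)
    show "q powi (- 2 * (m + 1)) - q powi (- 2 * m) = (q - 1) * (- (q + 1) * q powi (-2)) * q powi (- 2 * m)" for m
      unfolding e[symmetric] using q_powi_add[of "- 2 * m" "-2"] by (simp add: algebra_simps)
  qed
qed

lemma gcoef_diff:
  "gcoef q Gen_E (m + 1) - gcoef q Gen_E m = - (q ^ 2) * q powi (2 * m)"
  "gcoef q Gen_F (m + 1) - gcoef q Gen_F m = inverse q * q powi (- 2 * m)"
proof -
  let ?c = "q - inverse q"
  have qq: "q * inverse q = 1" using q_nz by simp
  have E1: "q powi (2 * (m + 1)) = q powi (2 * m) * q ^ 2" using q_powi_add[of "2 * m" 2] by (simp add: algebra_simps)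
  have F1: "q powi (- 2 * (m + 1)) = q powi (- 2 * m) * inverse q ^ 2"
    using q_powi_add[of "- 2 * m" "-2"] by (simp add: algebra_simps power_int_minus power_inverse)
  have "- q * (q powi (2 * m) * q ^ 2 - 1) - (- q * (q powi (2 * m) - 1)) = - (q ^ 2) * q powi (2 * m) * (q - (q * inverse q) * inverse q)"
    unfolding qq using qq by (simp add: algebra_simps power2_eq_square)
  then have "- q * (q powi (2 * m) * q ^ 2 - 1) - (- q * (q powi (2 * m) - 1)) = - (q ^ 2) * q powi (2 * m) * ?c"
    unfolding qq by simp
  then show "gcoef q Gen_E (m + 1) - gcoef q Gen_E m = - (q ^ 2) * q powi (2 * m)"
    unfolding gcoef.simps E1 diff_divide_distrib[symmetric] using q_minus_inverse_nz by (simp add: divide_eq_eq)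
  have "(1 - q powi (- 2 * m) * inverse q ^ 2) - (1 - q powi (- 2 * m)) = inverse q * q powi (- 2 * m) * ?c"
    using qq by (simp add: algebra_simps power2_eq_square)
  then show "gcoef q Gen_F (m + 1) - gcoef q Gen_F m = inverse q * q powi (- 2 * m)"
    unfolding gcoef.simps F1 diff_divide_distrib[symmetric] using q_minus_inverse_nz by (simp add: divide_eq_eq)
qed

lemma adic_poly_gcoef: "adic_poly (gcoef q g)"
proof (cases g)
  case Gen_E
  have "adic_poly (\<lambda>m. - (q ^ 2) * q powi (2 * m))"
    by (intro adic_poly_mult adic_poly_const adic_poly_q_powi A_uminus A_power A_q)
  then show ?thesis unfolding Gen_E gcoef_diff(1)[symmetric]
    by (rule adic_poly_by_differences[rotated]) (simp add: A_closed)
next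
  case Gen_F
  have "adic_poly (\<lambda>m. inverse q * q powi (- 2 * m))"
    by (intro adic_poly_mult adic_poly_const adic_poly_q_powi A_q)
  then show ?thesis unfolding Gen_F gcoef_diff(2)[symmetric]
    by (rule adic_poly_by_differences[rotated]) (simp add: A_closed)
qed (use adic_poly_q_powi in \<open>simp_all add: gcoef_K del: gcoef.simps\<close>)

definition integral_symbol :: "(int \<Rightarrow> int \<Rightarrow> 'k) \<Rightarrow> bool"
  where "integral_symbol P \<longleftrightarrow> (\<forall>d. adic_poly (P d))"

lemma integral_symbol_fgen: "integral_symbol (fsym q (fgen g))"
proof -
  have "fsym q (fgen g) d = (if d = gdeg g then gcoef q g else (\<lambda>_. 0))" for d
    by (auto simp: fsym_fgen fun_eq_iff)
  then show ?thesis using adic_poly_gcoef adic_poly_const[OF A_closed(1)] by (simp add: integral_symbol_def)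
qed

lemma integral_symbol_fscal: "c \<in> A \<Longrightarrow> integral_symbol (fsym q (fscal c))"
proof -
  assume "c \<in> A"
  moreover have "fsym q (fscal c) d = (\<lambda>_. if d = 0 then c else 0)" for d
    by (simp add: fsym_fscal fun_eq_iff)
  ultimately show ?thesis using adic_poly_const A_closed(1) by (simp add: integral_symbol_def)
qed

lemma integral_symbol_add:
  assumes "f \<in> carrier free_alg" "g \<in> carrier free_alg" "integral_symbol (fsym q f)" "integral_symbol (fsym q g)"
  shows "integral_symbol (fsym q (f \<oplus>\<^bsub>free_alg\<^esub> g))"
proof -
  have "fsym q (f \<oplus>\<^bsub>free_alg\<^esub> g) d = (\<lambda>m. fsym q f d m + fsym q g d m)" for d
    by (simp add: fsym_add assms fun_eq_iff)
  then show ?thesis using assms(3,4) adic_poly_add by (simp add: integral_symbol_def)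
qed

lemma integral_symbol_mult:
  assumes "f \<in> carrier free_alg" "g \<in> carrier free_alg" "integral_symbol (fsym q f)" "integral_symbol (fsym q g)"
  shows "integral_symbol (fsym q (f \<otimes>\<^bsub>free_alg\<^esub> g))"
proof -
  let ?D = "wdeg ` {w. g w \<noteq> 0}"
  have fin: "finite ?D" using assms(2) by (simp add: free_carrier)
  have "fsym q (f \<otimes>\<^bsub>free_alg\<^esub> g) d = (\<lambda>m. \<Sum>e\<in>?D. fsym q f (d - e) (m + e) * fsym q g e m)" for d
    by (intro ext fsym_mult[OF assms(1,2) fin subset_refl])
  moreover have "adic_poly (\<lambda>m. \<Sum>e\<in>?D. fsym q f (d - e) (m + e) * fsym q g e m)" for d
    using assms(3,4) unfolding integral_symbol_def
    by (intro adic_poly_sum[OF fin] adic_poly_mult adic_poly_shift[where p = "fsym q f (d - e)" for e]) auto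
  ultimately show ?thesis by (simp add: integral_symbol_def)
qed

lemma integral_symbol_uminus:
  assumes "f \<in> carrier free_alg" "integral_symbol (fsym q f)"
  shows "integral_symbol (fsym q (\<ominus>\<^bsub>free_alg\<^esub> f))"
proof -
  have "fsym q (\<ominus>\<^bsub>free_alg\<^esub> f) d = (\<lambda>m. -1 * fsym q f d m)" for d
    by (simp add: fsym_uminus assms fun_eq_iff)
  moreover have "adic_poly (\<lambda>m. -1 * fsym q f d m)" for d
    using assms(2) A_uminus[OF A_closed(2)] unfolding integral_symbol_def
    by (intro adic_poly_mult adic_poly_const) auto
  ultimately show ?thesis by (simp add: integral_symbol_def)
qed

subsection \<open>The integral form\<close>

sublocale UI: ideal "Uq_ideal q" free_alg by (rule Uq_ideal_ideal)

lemma Uq_ring: "ring (Uq q)"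
  unfolding Uq_def by (rule UI.quotient_is_ring)

lemma Uq_proj_hom: "Uq_proj q \<in> ring_hom free_alg (Uq q)"
  using UI.rcos_ring_hom unfolding Uq_proj_def Uq_def by simp

sublocale P: ring_hom_ring free_alg "Uq q" "Uq_proj q"
  by (intro ring_hom_ringI2 free_alg_ring Uq_ring Uq_proj_hom)

text \<open>The value of \<open>[i]\<close> at \<open>q = 1\<close> is \<open>i \<noteq> 0\<close>, so \<open>[i]\<close> is a unit of the local ring.\<close>

lemma q_fact_inverse: "1 / q_fact q m \<in> A"
proof -
  have inv_int: "1 / q_int q i \<in> A" if i: "i \<ge> 1" for i
  proof -
    let ?s = "\<Sum>j<i. monom (1::'k) (2 * j)"
    have s: "rat_poly ?s" by (auto simp: coeff_sum intro!: sum_in_Rats)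
    have s1: "poly ?s 1 \<noteq> 0" using i by (simp add: poly_sum poly_monom)
    have val: "poly ?s q = (\<Sum>j<i. (q ^ 2) ^ j)" by (simp add: poly_sum poly_monom power_mult)
    have geo: "(q ^ 2 - 1) * poly ?s q = (q ^ 2) ^ i - 1"
      unfolding val using power_diff_1_eq[of "q ^ 2" i] by (simp add: mult.commute)
    have qi: "q ^ i * inverse q ^ i = 1" using q_nz by (simp add: power_mult_distrib[symmetric])
    have "(q ^ i - inverse q ^ i) * q ^ i = (q ^ 2) ^ i - 1"
      using qi by (simp add: algebra_simps power_mult[symmetric] power_add[symmetric] mult_2_right)
    moreover have "(q - inverse q) * q = q ^ 2 - 1" using q_nz by (simp add: algebra_simps power2_eq_square)
    ultimately have "(q ^ i - inverse q ^ i) * q ^ i = (q - inverse q) * (q * poly ?s q)"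
      using geo by (simp only: mult.assoc[symmetric])
    then have "q_int q i * q ^ i = q * poly ?s q"
      unfolding q_int_def times_divide_eq_left using q_minus_inverse_nz by (simp del: right_diff_distrib)
    moreover from this have "q_int q i \<noteq> 0" using rat_poly_nz[OF s s1] q_nz by auto
    ultimately have "1 / q_int q i = q ^ i * inverse q * inverse (poly ?s q)"
      using rat_poly_nz[OF s s1] q_nz by (simp add: field_simps)
    moreover have "q ^ i * inverse q * inverse (poly ?s q) \<in> A"
      by (intro A_closed A_power A_q A_inverse_poly[OF s s1])
    ultimately show ?thesis by simp
  qed
  have "(\<Prod>i\<in>F. 1 / q_int q i) \<in> A" if "finite F" "\<And>i. i \<in> F \<Longrightarrow> i \<ge> 1" for F
    using that
  proof (induction F rule: finite_induct)
    case (insert x F)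
    have "1 / q_int q x \<in> A" "(\<Prod>i\<in>F. 1 / q_int q i) \<in> A" using insert inv_int by simp_all
    then show ?case unfolding prod.insert[OF insert.hyps] by (rule A_closed(4))
  qed (simp add: A_closed)
  from this[of "{1..m}"] show ?thesis unfolding q_fact_def by (simp add: prod_dividef)
qed

lemma fgen_pow_closed: "fgen g [^]\<^bsub>free_alg\<^esub> (k::nat) \<in> carrier free_alg"
  by (rule free.nat_pow_closed[OF fgen_closed])

lemma div_pow_proj:
  "div_pow q g k = Uq_proj q (fscal (1 / q_fact q k) \<otimes>\<^bsub>free_alg\<^esub> (fgen g [^]\<^bsub>free_alg\<^esub> k))"
  unfolding div_pow_def P.hom_mult[OF fscal_closed fgen_pow_closed] P.hom_nat_pow[OF fgen_closed] ..

abbreviation "UA_gens \<equiv> Uq_proj q ` fscal ` A \<union>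
     {Uq_proj q (fgen Gen_K), Uq_proj q (fgen Gen_Kinv)} \<union>
     range (div_pow q Gen_E) \<union> range (div_pow q Gen_F)"

lemma UA_carrier: "carrier (UA q) = generate_ring (Uq q) UA_gens"
  by (simp add: UA_def)

lemma UA_gens_closed: "UA_gens \<subseteq> carrier (Uq q)"
  using P.hom_closed fscal_closed fgen_closed fgen_pow_closed free.m_closed
  unfolding div_pow_proj by blast

lemma UA_ring: "ring (UA q)"
  unfolding UA_def using P.S.generate_ring_is_ring[OF UA_gens_closed] .

lemma UA_ops: "u \<oplus>\<^bsub>UA q\<^esub> v = u \<oplus>\<^bsub>Uq q\<^esub> v" "u \<otimes>\<^bsub>UA q\<^esub> v = u \<otimes>\<^bsub>Uq q\<^esub> v" "\<zero>\<^bsub>UA q\<^esub> = \<zero>\<^bsub>Uq q\<^esub>"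
  by (simp_all add: UA_def)

lemma UA_representative:
  assumes "u \<in> carrier (UA q)"
  shows "\<exists>f\<in>carrier free_alg. u = Uq_proj q f \<and> integral_symbol (fsym q f)"
  using assms unfolding UA_carrier
proof (induction u rule: generate_ring.induct)
  case one
  have "\<one>\<^bsub>Uq q\<^esub> = Uq_proj q (fscal 1)" using P.hom_one by (simp add: free_ops)
  then show ?case using fscal_closed integral_symbol_fscal[OF A_closed(2)] by blast
next
  case (incl h)
  have pow: "integral_symbol (fsym q (fgen g [^]\<^bsub>free_alg\<^esub> k))" for g and k :: nat
  proof (induction k)
    case 0
    show ?case using integral_symbol_fscal[OF A_closed(2)] by (simp add: free_ops)
  next
    case (Suc k)
    then show ?case using integral_symbol_mult[OF fgen_pow_closed fgen_closed _ integral_symbol_fgen] by simp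
  qed
  have "\<exists>f\<in>carrier free_alg. div_pow q g k = Uq_proj q f \<and> integral_symbol (fsym q f)" for g k
    unfolding div_pow_proj
    by (intro bexI[of _ "fscal (1 / q_fact q k) \<otimes>\<^bsub>free_alg\<^esub> (fgen g [^]\<^bsub>free_alg\<^esub> k)"] conjI refl
        integral_symbol_mult fscal_closed fgen_pow_closed integral_symbol_fscal q_fact_inverse pow free.m_closed)
  then show ?case
    using incl fscal_closed integral_symbol_fscal fgen_closed integral_symbol_fgen by blast
next
  case (a_inv h)
  then obtain f where f: "f \<in> carrier free_alg" "h = Uq_proj q f" "integral_symbol (fsym q f)" by blast
  then show ?case using P.hom_a_inv[OF f(1)] integral_symbol_uminus[OF f(1,3)] by (intro bexI[of _ "\<ominus>\<^bsub>free_alg\<^esub> f"]) auto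
next
  case (eng_add h1 h2)
  then obtain f g where f: "f \<in> carrier free_alg" "h1 = Uq_proj q f" "integral_symbol (fsym q f)"
    and g: "g \<in> carrier free_alg" "h2 = Uq_proj q g" "integral_symbol (fsym q g)" by blast
  then show ?case using P.hom_add[OF f(1) g(1)] integral_symbol_add[OF f(1) g(1) f(3) g(3)]
    by (intro bexI[of _ "f \<oplus>\<^bsub>free_alg\<^esub> g"]) auto
next
  case (eng_mult h1 h2)
  then obtain f g where f: "f \<in> carrier free_alg" "h1 = Uq_proj q f" "integral_symbol (fsym q f)"
    and g: "g \<in> carrier free_alg" "h2 = Uq_proj q g" "integral_symbol (fsym q g)" by blast
  then show ?case using P.hom_mult[OF f(1) g(1)] integral_symbol_mult[OF f(1) g(1) f(3) g(3)]
    by (intro bexI[of _ "f \<otimes>\<^bsub>free_alg\<^esub> g"]) auto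
qed

end

context transcendental
begin

text \<open>The choice of the representative is immaterial because the symbol vanishes on the defining ideal.\<close>

definition usym :: "(gen list \<Rightarrow> 'k) set \<Rightarrow> int \<Rightarrow> int \<Rightarrow> 'k"
  where "usym u = fsym q (SOME f. f \<in> carrier free_alg \<and> Uq_proj q f = u)"

lemma usym_proj:
  assumes "f \<in> carrier free_alg" shows "usym (Uq_proj q f) = fsym q f"
proof -
  have "(SOME g. g \<in> carrier free_alg \<and> Uq_proj q g = Uq_proj q f) \<in> carrier free_alg \<and>
      Uq_proj q (SOME g. g \<in> carrier free_alg \<and> Uq_proj q g = Uq_proj q f) = Uq_proj q f"
    using assms by (intro someI[of "\<lambda>g. g \<in> carrier free_alg \<and> Uq_proj q g = Uq_proj q f"]) simp
  then show ?thesis unfolding usym_def using Uq_proj_sym assms by blast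
qed

lemma UA_rep:
  assumes "u \<in> carrier (UA q)" obtains f where "f \<in> carrier free_alg" "u = Uq_proj q f" "usym u = fsym q f"
  using UA_representative[OF assms] usym_proj by blast

lemma UA_integral: "u \<in> carrier (UA q) \<Longrightarrow> integral_symbol (usym u)"
  using UA_representative usym_proj by metis

lemma usym_A: "u \<in> carrier (UA q) \<Longrightarrow> usym u d m \<in> A"
  using UA_integral adic_polyD unfolding integral_symbol_def by blast

lemma usym_add:
  assumes "u \<in> carrier (UA q)" "v \<in> carrier (UA q)"
  shows "usym (u \<oplus>\<^bsub>UA q\<^esub> v) d m = usym u d m + usym v d m"
proof -
  obtain f g where f: "f \<in> carrier free_alg" "u = Uq_proj q f" and g: "g \<in> carrier free_alg" "v = Uq_proj q g"
    using UA_rep assms by metis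
  have "usym (u \<oplus>\<^bsub>UA q\<^esub> v) = fsym q (f \<oplus>\<^bsub>free_alg\<^esub> g)"
    unfolding UA_ops f(2) g(2) P.hom_add[OF f(1) g(1), symmetric]
    by (rule usym_proj[OF free.a_closed[OF f(1) g(1)]])
  then show ?thesis using f g by (simp add: fsym_add usym_proj)
qed

definition scalar :: "'k \<Rightarrow> (gen list \<Rightarrow> 'k) set"
  where "scalar c = Uq_proj q (fscal c)"

lemma scalar_UA: "c \<in> A \<Longrightarrow> scalar c \<in> carrier (UA q)"
  unfolding UA_carrier scalar_def by (rule generate_ring.incl) blast

lemma fscal_central:
  assumes "f \<in> carrier free_alg" shows "f \<otimes>\<^bsub>free_alg\<^esub> fscal c = fscal c \<otimes>\<^bsub>free_alg\<^esub> f"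
proof
  fix w
  have "(\<Sum>i\<le>length w. f (take i w) * fscal c (drop i w)) = (\<Sum>i\<in>{length w}. f (take i w) * fscal c (drop i w))"
    by (rule sum.mono_neutral_right) (auto simp: fscal_def)
  moreover have "(\<Sum>i\<le>length w. fscal c (take i w) * f (drop i w)) = (\<Sum>i\<in>{0}. fscal c (take i w) * f (drop i w))"
    by (rule sum.mono_neutral_right) (auto simp: fscal_def)
  ultimately show "(f \<otimes>\<^bsub>free_alg\<^esub> fscal c) w = (fscal c \<otimes>\<^bsub>free_alg\<^esub> f) w"
    by (simp add: free_alg_def fscal_def mult.commute)
qed

lemma scalar_central:
  assumes "u \<in> carrier (UA q)" shows "u \<otimes>\<^bsub>UA q\<^esub> scalar c = scalar c \<otimes>\<^bsub>UA q\<^esub> u"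
proof -
  obtain f where f: "f \<in> carrier free_alg" "u = Uq_proj q f" using UA_rep[OF assms] by metis
  show ?thesis
    unfolding UA_ops scalar_def f(2) P.hom_mult[OF f(1) fscal_closed, symmetric]
      P.hom_mult[OF fscal_closed f(1), symmetric] fscal_central[OF f(1)] ..
qed

lemma usym_scalar_mult:
  assumes "u \<in> carrier (UA q)" shows "usym (u \<otimes>\<^bsub>UA q\<^esub> scalar c) d m = c * usym u d m"
proof -
  obtain f where f: "f \<in> carrier free_alg" "u = Uq_proj q f" using UA_rep[OF assms] by metis
  have "usym (u \<otimes>\<^bsub>UA q\<^esub> scalar c) = fsym q (fscal c \<otimes>\<^bsub>free_alg\<^esub> f)"
    unfolding scalar_central[OF assms] unfolding UA_ops scalar_def f(2) P.hom_mult[OF fscal_closed f(1), symmetric]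
    by (rule usym_proj[OF free.m_closed[OF fscal_closed f(1)]])
  then show ?thesis using f by (simp add: fsym_fscal_mult usym_proj)
qed

sublocale UA: ring "UA q" by (rule UA_ring)

lemma U_ideal_eq: "U_ideal q n = {w \<otimes>\<^bsub>UA q\<^esub> scalar ((q - 1) ^ n) | w. w \<in> carrier (UA q)}"
  by (simp add: U_ideal_def cgenideal_def scalar_def)

lemma U_ideal_ideal: "ideal (U_ideal q n) (UA q)"
proof (rule idealI[OF UA_ring])
  let ?t = "scalar ((q - 1) ^ n)"
  have t: "?t \<in> carrier (UA q)" by (rule scalar_UA[OF A_qm1])
  show "subgroup (U_ideal q n) (add_monoid (UA q))"
  proof (rule subgroup.intro)
    show "U_ideal q n \<subseteq> carrier (add_monoid (UA q))" using t by (auto simp: U_ideal_eq)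
    show "\<one>\<^bsub>add_monoid (UA q)\<^esub> \<in> U_ideal q n"
      using UA.l_null[OF t] UA.zero_closed by (force simp: U_ideal_eq)
    show "u \<otimes>\<^bsub>add_monoid (UA q)\<^esub> v \<in> U_ideal q n" if "u \<in> U_ideal q n" "v \<in> U_ideal q n" for u v
    proof -
      obtain a b where ab: "a \<in> carrier (UA q)" "b \<in> carrier (UA q)" "u = a \<otimes>\<^bsub>UA q\<^esub> ?t" "v = b \<otimes>\<^bsub>UA q\<^esub> ?t"
        using \<open>u \<in> U_ideal q n\<close> \<open>v \<in> U_ideal q n\<close> by (auto simp: U_ideal_eq)
      then have "u \<oplus>\<^bsub>UA q\<^esub> v = (a \<oplus>\<^bsub>UA q\<^esub> b) \<otimes>\<^bsub>UA q\<^esub> ?t" using UA.l_distr t by simp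
      then show ?thesis using ab UA.a_closed unfolding U_ideal_eq monoid.simps by blast
    qed
    show "inv\<^bsub>add_monoid (UA q)\<^esub> u \<in> U_ideal q n" if uI: "u \<in> U_ideal q n" for u
    proof -
      obtain a where a: "a \<in> carrier (UA q)" "u = a \<otimes>\<^bsub>UA q\<^esub> ?t" using uI by (auto simp: U_ideal_eq)
      then have "\<ominus>\<^bsub>UA q\<^esub> u = (\<ominus>\<^bsub>UA q\<^esub> a) \<otimes>\<^bsub>UA q\<^esub> ?t" using UA.l_minus t by simp
      then show ?thesis using a UA.a_inv_closed unfolding U_ideal_eq a_inv_def[symmetric] by blast
    qed
  qed
  fix u v assume u: "u \<in> U_ideal q n" and v: "v \<in> carrier (UA q)"
  obtain a where a: "a \<in> carrier (UA q)" "u = a \<otimes>\<^bsub>UA q\<^esub> ?t" using u by (auto simp: U_ideal_eq)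
  have "v \<otimes>\<^bsub>UA q\<^esub> u = (v \<otimes>\<^bsub>UA q\<^esub> a) \<otimes>\<^bsub>UA q\<^esub> ?t" using a v t by (simp add: UA.m_assoc)
  then show "v \<otimes>\<^bsub>UA q\<^esub> u \<in> U_ideal q n" using a v UA.m_closed unfolding U_ideal_eq by blast
  have "u \<otimes>\<^bsub>UA q\<^esub> v = a \<otimes>\<^bsub>UA q\<^esub> (v \<otimes>\<^bsub>UA q\<^esub> ?t)"
    using a v t scalar_central[OF v] by (simp add: UA.m_assoc)
  then have "u \<otimes>\<^bsub>UA q\<^esub> v = (a \<otimes>\<^bsub>UA q\<^esub> v) \<otimes>\<^bsub>UA q\<^esub> ?t" using a v t by (simp add: UA.m_assoc)
  then show "u \<otimes>\<^bsub>UA q\<^esub> v \<in> U_ideal q n" using a v UA.m_closed unfolding U_ideal_eq by blast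
qed

lemma scalar_mult: "scalar (a * b) = scalar a \<otimes>\<^bsub>UA q\<^esub> scalar b"
proof -
  have "fscal a \<otimes>\<^bsub>free_alg\<^esub> fscal b = fscal (a * b)"
  proof
    fix w
    have "(\<Sum>i\<le>length w. fscal a (take i w) * fscal b (drop i w)) = (\<Sum>i\<in>{0}. fscal a (take i w) * fscal b (drop i w))"
      by (rule sum.mono_neutral_right) (auto simp: fscal_def)
    then show "(fscal a \<otimes>\<^bsub>free_alg\<^esub> fscal b) w = fscal (a * b) w" by (simp add: free_alg_def fscal_def)
  qed
  then show ?thesis unfolding scalar_def UA_ops P.hom_mult[OF fscal_closed fscal_closed, symmetric] by simp
qed

lemma U_ideal_antimono: "U_ideal q (Suc n) \<subseteq> U_ideal q n"
proof
  fix u assume "u \<in> U_ideal q (Suc n)"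
  then obtain a where a: "a \<in> carrier (UA q)" "u = a \<otimes>\<^bsub>UA q\<^esub> scalar ((q - 1) * (q - 1) ^ n)" by (auto simp: U_ideal_eq)
  have s: "scalar (q - 1) \<in> carrier (UA q)" "scalar ((q - 1) ^ n) \<in> carrier (UA q)"
    using scalar_UA A_qm1[of 1] A_qm1[of n] by simp_all
  have "u = (a \<otimes>\<^bsub>UA q\<^esub> scalar (q - 1)) \<otimes>\<^bsub>UA q\<^esub> scalar ((q - 1) ^ n)"
    unfolding a(2) scalar_mult using a(1) s by (simp add: UA.m_assoc)
  then show "u \<in> U_ideal q n" using a(1) s(1) UA.m_closed unfolding U_ideal_eq by blast
qed

lemma U_n_carrier: "carrier (U_n q n) = U_mod q n ` carrier (UA q)"
  by (auto simp: U_n_def FactRing_def A_RCOSETS_def' U_mod_def)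

lemma U_transition:
  "u \<in> carrier (UA q) \<Longrightarrow> set_add (UA q) (U_ideal q n) (U_mod q (Suc n) u) = U_mod q n u"
  unfolding U_mod_def by (rule UA.set_add_rcos[OF U_ideal_ideal U_ideal_ideal U_ideal_antimono])

lemma U_mod_add:
  assumes "u \<in> carrier (UA q)" "w \<in> carrier (UA q)"
  shows "U_mod q n (u \<oplus>\<^bsub>UA q\<^esub> w \<otimes>\<^bsub>UA q\<^esub> scalar ((q - 1) ^ n)) = U_mod q n u"
proof -
  interpret I: ideal "U_ideal q n" "UA q" by (rule U_ideal_ideal)
  let ?h = "w \<otimes>\<^bsub>UA q\<^esub> scalar ((q - 1) ^ n)"
  have h: "?h \<in> U_ideal q n" unfolding U_ideal_eq using assms(2) by blast
  have hc: "?h \<in> carrier (UA q)" by (rule I.Icarr[OF h])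
  have "(u \<oplus>\<^bsub>UA q\<^esub> ?h) \<ominus>\<^bsub>UA q\<^esub> u = (?h \<oplus>\<^bsub>UA q\<^esub> u) \<oplus>\<^bsub>UA q\<^esub> \<ominus>\<^bsub>UA q\<^esub> u"
    unfolding a_minus_def UA.a_comm[OF assms(1) hc] ..
  also have "\<dots> = ?h" unfolding UA.a_assoc[OF hc assms(1) UA.a_inv_closed[OF assms(1)]] UA.r_neg[OF assms(1)]
    by (rule UA.r_zero[OF hc])
  finally have "(u \<oplus>\<^bsub>UA q\<^esub> ?h) \<ominus>\<^bsub>UA q\<^esub> u \<in> U_ideal q n" using h by argo
  then show ?thesis
    unfolding U_mod_def using I.rcos_eq_iff[OF UA.a_closed[OF assms(1) hc] assms(1)] by blast
qed

subsection \<open>The homomorphisms \<open>\<eta>\<^sub>n\<close> on symbols\<close>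

abbreviation "rsym n u \<equiv> (\<lambda>d m. res q n (usym u d m))"

lemma rsym_cong:
  assumes "u \<in> carrier (UA q)" "v \<in> carrier (UA q)" "U_mod q n u = U_mod q n v"
  shows "rsym n u = rsym n v"
proof -
  interpret I: ideal "U_ideal q n" "UA q" by (rule U_ideal_ideal)
  have "u \<ominus>\<^bsub>UA q\<^esub> v \<in> U_ideal q n" using I.rcos_eq_iff[OF assms(1,2)] assms(3) by (simp add: U_mod_def)
  then obtain w where w: "w \<in> carrier (UA q)" "u \<ominus>\<^bsub>UA q\<^esub> v = w \<otimes>\<^bsub>UA q\<^esub> scalar ((q - 1) ^ n)"
    unfolding U_ideal_eq by blast
  have "(u \<ominus>\<^bsub>UA q\<^esub> v) \<oplus>\<^bsub>UA q\<^esub> v = u"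
    unfolding a_minus_def UA.a_assoc[OF assms(1) UA.a_inv_closed[OF assms(2)] assms(2)] UA.l_neg[OF assms(2)]
    by (rule UA.r_zero[OF assms(1)])
  then have eq: "usym u d m = (q - 1) ^ n * usym w d m + usym v d m" for d m
    using usym_add[OF UA.minus_closed[OF assms(1,2)] assms(2), of d m]
    unfolding w(2) usym_scalar_mult[OF w(1)] by argo
  have "res q n (usym u d m) = res q n (usym v d m)" for d m
    by (rule res_eqI[OF usym_A[OF assms(1)] usym_A[OF assms(2)] usym_A[OF w(1), of d m]]) (simp add: eq[of d m])
  then show ?thesis by (intro ext)
qed

lemma rsym_global:
  assumes "u \<in> carrier (UA q)" shows "global_symbol (B n) (rsym n u)"
proof -
  obtain f where f: "f \<in> carrier free_alg" "usym u = fsym q f" using UA_rep[OF assms] by metis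
  have fin: "finite {d. \<exists>m. res q n (usym u d m) \<noteq> \<zero>\<^bsub>B n\<^esub>}"
  proof (rule finite_subset)
    show "finite {d. \<exists>m. fsym q f d m \<noteq> 0}" by (rule fsym_finite_degrees[OF f(1)])
    show "{d. \<exists>m. res q n (usym u d m) \<noteq> \<zero>\<^bsub>B n\<^esub>} \<subseteq> {d. \<exists>m. fsym q f d m \<noteq> 0}"
      unfolding f(2) res_ops(4)[OF A_closed(1,1)] by force
  qed
  have poly: "\<exists>k. poly_fun (B n) k (\<lambda>m. res q n (usym u d m))" for d
    using UA_integral[OF assms] unfolding integral_symbol_def adic_poly_def by blast
  have "res q n (usym u d m) = \<zero>\<^bsub>B n\<^esub>" if "(m \<ge> 0 \<and> m + d < 0) \<or> (m \<le> 0 \<and> m + d > 0)" for d m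
    using fsym_crossing[OF that, of q f] res_ops(4)[OF A_closed(1,1)] f(2) by simp
  then show ?thesis
    using fin poly res_closed usym_A[OF assms] by (auto simp: global_symbol_def diff_symbol_def)
qed

text \<open>On polynomials over the local ring the operator over the field is computed within the local ring.\<close>

lemma symop_field_loc:
  assumes P: "\<And>d m. P d m \<in> A" and f: "f \<in> carrier (laurent (loc_ring q) I)"
  shows "symop field_ring I P f = symop (loc_ring q) I P f"
proof -
  have fA: "\<And>j. f j \<in> A" and fin: "finite {m. f m \<noteq> 0}" using f by (auto simp: laurent_def loc_ops)
  have ff: "f \<in> carrier (laurent field_ring I)"
    using f by (auto simp: laurent_def loc_ops field_ops)
  show ?thesis
    unfolding symop_def restrict_apply using f ff fin P fA
    by (intro ext) (simp add: field_finsum loc_finsum field_ops loc_ops A_closed)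
qed

lemma eta_n_U_mod:
  assumes u: "u \<in> carrier (UA q)"
  shows "eta_n q n (U_mod q n u) = (symop (B n) {0..} (rsym n u), symop (B n) {..0} (rsym n u))"
proof -
  have al: "op_mod q n {0..} (alpha q v) = symop (B n) {0..} (rsym n v)" if v: "v \<in> carrier (UA q)" for v
  proof (rule op_mod_symop)
    fix f assume f: "f \<in> carrier (laurent (loc_ring q) {0..})"
    obtain g where g: "g \<in> carrier free_alg" "v = Uq_proj q g" "usym v = fsym q g" using UA_rep[OF v] .
    show "alpha q v f = symop (loc_ring q) {0..} (usym v) f"
      using alpha_symop[OF g(1)] symop_field_loc[OF usym_A[OF v] f] g(2,3) by simp
  qed (use usym_A[OF v] in auto)
  have ga: "op_mod q n {..0} (gamma q v) = symop (B n) {..0} (rsym n v)" if v: "v \<in> carrier (UA q)" for v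
  proof (rule op_mod_symop)
    fix f assume f: "f \<in> carrier (laurent (loc_ring q) {..0})"
    obtain g where g: "g \<in> carrier free_alg" "v = Uq_proj q g" "usym v = fsym q g" using UA_rep[OF v] .
    show "gamma q v f = symop (loc_ring q) {..0} (usym v) f"
      using gamma_symop[OF g(1)] symop_field_loc[OF usym_A[OF v] f] g(2,3) by simp
  qed (use usym_A[OF v] in auto)
  have "alpha_n q n (U_mod q n u) = symop (B n) {0..} (rsym n u)"
    unfolding alpha_n_def using al rsym_cong[OF _ u] by (intro descend_eq[OF u refl]) metis
  moreover have "gamma_n q n (U_mod q n u) = symop (B n) {..0} (rsym n u)"
    unfolding gamma_n_def using ga rsym_cong[OF _ u] by (intro descend_eq[OF u refl]) metis
  ultimately show ?thesis by (simp add: eta_n_def)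
qed

lemma red_rsym: "u \<in> carrier (UA q) \<Longrightarrow> (\<lambda>d m. red n (rsym (Suc n) u d m)) = rsym n u"
  by (simp add: red_res usym_A)

end

section \<open>Surjectivity at \<open>q = 1\<close>\<close>

text \<open>The \<open>i\<close>-th iterated forward difference of \<open>p\<close>, evaluated at \<open>0\<close>.\<close>

primrec newton :: "nat \<Rightarrow> (int \<Rightarrow> 'k::field_char_0) \<Rightarrow> 'k"
  where "newton 0 p = p 0" | "newton (Suc i) p = newton i (\<lambda>m. p (m + 1) - p m)"

lemma field_minus: "a \<ominus>\<^bsub>field_ring\<^esub> b = a - (b :: 'k::field)"
proof -
  interpret cring "field_ring :: 'k ring" by (rule field_ring_cring)
  have "b + \<ominus>\<^bsub>field_ring\<^esub> b = 0" using r_neg[of b] by (simp add: field_ops)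
  then have "\<ominus>\<^bsub>field_ring\<^esub> b = - b" by (simp add: add_eq_0_iff)
  then show ?thesis by (simp add: a_minus_def field_ops)
qed

lemma newton_expansion:
  fixes p :: "int \<Rightarrow> 'k::field_char_0"
  assumes "poly_fun field_ring k p"
  shows "p m = (\<Sum>i<k. newton i p * (of_int m gchoose i))"
  using assms
proof (induction k arbitrary: p m)
  case 0
  then show ?case by (simp add: field_ops)
next
  case (Suc k)
  let ?d = "\<lambda>m. p (m + 1) - p m"
  let ?N = "\<lambda>m. \<Sum>i<Suc k. newton i p * (of_int m gchoose i)"
  have "poly_fun field_ring k ?d" using Suc.prems by (simp add: field_minus)
  then have dp: "p (m + 1) - p m = (\<Sum>i<k. newton i ?d * (of_int m gchoose i))" for m
    by (rule Suc.IH)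
  have dN: "?N (m + 1) - ?N m = (\<Sum>i<k. newton i ?d * (of_int m gchoose i))" for m
  proof -
    have "?N (m + 1) - ?N m = (\<Sum>i<Suc k. newton i p * ((of_int m + 1 gchoose i) - (of_int m gchoose i)))"
      by (simp only: sum_subtractf[symmetric] right_diff_distrib of_int_add of_int_1)
    also have "\<dots> = (\<Sum>i<k. newton (Suc i) p * ((of_int m + 1 gchoose Suc i) - (of_int m gchoose Suc i)))"
      by (subst sum.lessThan_Suc_shift) simp
    also have "\<dots> = (\<Sum>i<k. newton i ?d * (of_int m gchoose i))"
      by (simp add: gbinomial_Suc_Suc)
    finally show ?thesis .
  qed
  have 0: "?N 0 = p 0"
    by (subst sum.lessThan_Suc_shift) simp
  have up: "a = c" if "a - b = c - d" "b = d" for a b c d :: 'k using that by simp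
  have down: "b = d" if "a - b = c - d" "a = c" for a b c d :: 'k using that by simp
  have "p m = ?N m"
  proof (induction m rule: int_induct[of _ 0])
    case base
    show ?case using 0 by simp
  next
    case (step1 i)
    have "p (i + 1) - p i = ?N (i + 1) - ?N i" by (rule trans[OF dp dN[symmetric]])
    then show ?case by (rule up) (rule step1(2))
  next
    case (step2 i)
    have "p (i - 1 + 1) - p (i - 1) = ?N (i - 1 + 1) - ?N (i - 1)" by (rule trans[OF dp dN[symmetric]])
    then have "p i - p (i - 1) = ?N i - ?N (i - 1)" by (simp only: diff_add_cancel)
    then show ?case by (rule down) (rule step2(2))
  qed
  then show ?case .
qed

lemma newton_rat: "(\<And>m. p m \<in> \<rat>) \<Longrightarrow> newton i p \<in> \<rat>"
  by (induction i arbitrary: p) simp_all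

lemma newton_zero: "(\<And>j. 0 \<le> j \<Longrightarrow> j \<le> int i \<Longrightarrow> p j = 0) \<Longrightarrow> newton i p = 0"
  by (induction i arbitrary: p) simp_all

context transcendental
begin

lemma res_add_cong:
  assumes "res q n a = res q n a'" "res q n b = res q n b'" "a \<in> A" "a' \<in> A" "b \<in> A" "b' \<in> A"
  shows "res q n (a + b) = res q n (a' + b')"
  using assms res_ops(1) by metis

lemma res_mult_cong:
  assumes "res q n a = res q n a'" "res q n b = res q n b'" "a \<in> A" "a' \<in> A" "b \<in> A" "b' \<in> A"
  shows "res q n (a * b) = res q n (a' * b')"
  using assms res_ops(2) by metis

lemma res_minus_cong:
  assumes "res q n a = res q n a'" "res q n b = res q n b'" "a \<in> A" "a' \<in> A" "b \<in> A" "b' \<in> A"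
  shows "res q n (a - b) = res q n (a' - b')"
  using assms res_ops(3) by metis

lemma A_sum: "finite D \<Longrightarrow> (\<And>e. e \<in> D \<Longrightarrow> a e \<in> A) \<Longrightarrow> sum a D \<in> A"
  by (induction D rule: finite_induct) (simp_all add: A_closed)

lemma res_sum_cong:
  assumes "finite D" "\<And>e. e \<in> D \<Longrightarrow> res q n (a e) = res q n (b e)"
    "\<And>e. e \<in> D \<Longrightarrow> a e \<in> A" "\<And>e. e \<in> D \<Longrightarrow> b e \<in> A"
  shows "res q n (sum a D) = res q n (sum b D)"
  using assms
proof (induction D rule: finite_induct)
  case (insert x F)
  have "res q n (a x + sum a F) = res q n (b x + sum b F)"
    by (rule res_add_cong) (use insert A_sum[OF insert.hyps(1)] in auto)
  then show ?case using insert.hyps by simp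
qed simp

lemma res_by_differences:
  assumes "\<And>m. a m \<in> A" "\<And>m. b m \<in> A" "res q n (a 0) = res q n (b 0)"
    and d: "\<And>m. res q n (a (m + 1) - a m) = res q n (b (m + 1) - b m)"
  shows "res q n (a (m::int)) = res q n (b m)"
proof (induction m rule: int_induct[of _ 0])
  case (step1 i)
  have "res q n (a i + (a (i + 1) - a i)) = res q n (b i + (b (i + 1) - b i))"
    by (intro res_add_cong step1 d A_minus assms)
  then show ?case by simp
next
  case (step2 i)
  have "res q n (a i - (a (i - 1 + 1) - a (i - 1))) = res q n (b i - (b (i - 1 + 1) - b (i - 1)))"
    by (intro res_minus_cong step2 d A_minus assms)
  then show ?case by simp
qed (rule assms)

lemma A_int: "of_int i \<in> A"
  by (rule A_rat) simp

lemma q_powi_mod: "res q 1 (q powi z) = res q 1 1"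
proof (rule res_by_differences[of "\<lambda>z. q powi z" "\<lambda>_. 1"])
  fix m
  have "q powi (m + 1) - q powi m - (1 - 1) = (q - 1) ^ 1 * q powi m"
    using q_powi_add[of m 1] by (simp add: algebra_simps)
  then show "res q 1 (q powi (m + 1) - q powi m) = res q 1 (1 - 1)"
    by (rule res_eqI[rotated -1]) (intro A_minus A_q_powi A_closed)+
qed (simp_all add: A_q_powi A_closed)

lemma gcoef_E_mod: "res q 1 (gcoef q Gen_E m) = res q 1 (of_int (- m))"
proof (rule res_by_differences[of "gcoef q Gen_E" "\<lambda>m. of_int (- m)"])
  show "gcoef q Gen_E m \<in> A" for m using adic_polyD[OF adic_poly_gcoef] .
  fix m
  have q2: "res q 1 (- (q ^ 2)) = res q 1 (-1)"
  proof (rule res_eqI[of _ _ "- (q + 1)"])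
    show "- (q\<^sup>2) - (- 1) = (q - 1) ^ 1 * - (q + 1)" by (simp add: algebra_simps power2_eq_square)
  qed (intro A_uminus A_power A_q A_closed)+
  have "res q 1 (- (q ^ 2) * q powi (2 * m)) = res q 1 (-1 * 1)"
    by (rule res_mult_cong[OF q2 q_powi_mod]) (intro A_uminus A_power A_q A_closed A_q_powi)+
  then show "res q 1 (gcoef q Gen_E (m + 1) - gcoef q Gen_E m) = res q 1 (of_int (- (m + 1)) - of_int (- m))"
    unfolding gcoef_diff by simp
qed (simp_all add: A_int, rule A_uminus, rule A_int)

lemma gcoef_F_mod: "res q 1 (gcoef q Gen_F m) = res q 1 (of_int m)"
proof (rule res_by_differences[of "gcoef q Gen_F" of_int])
  show "gcoef q Gen_F m \<in> A" for m using adic_polyD[OF adic_poly_gcoef] .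
  fix m
  have iq: "res q 1 (inverse q) = res q 1 1" using q_powi_mod[of "-1"] by (simp add: power_int_minus)
  have "res q 1 (inverse q * q powi (- 2 * m)) = res q 1 (1 * 1)"
    by (rule res_mult_cong[OF iq q_powi_mod A_q(2) A_closed(2) A_q_powi A_closed(2)])
  then show "res q 1 (gcoef q Gen_F (m + 1) - gcoef q Gen_F m) = res q 1 (of_int (m + 1) - of_int m)"
    unfolding gcoef_diff by simp
qed (simp_all add: A_int)

text \<open>At \<open>q = 1\<close> the element \<open>f\<close>, which lies over the integral form, acts by \<open>x\<^sup>m \<mapsto> p m x\<^sup>m\<^sup>+\<^sup>d\<close>.\<close>

definition realizes :: "(gen list \<Rightarrow> 'k) \<Rightarrow> int \<Rightarrow> (int \<Rightarrow> 'k) \<Rightarrow> bool"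
  where "realizes f d p \<longleftrightarrow> f \<in> carrier free_alg \<and> Uq_proj q f \<in> carrier (UA q) \<and> (\<forall>m. p m \<in> A) \<and>
    (\<forall>e m. res q 1 (fsym q f e m) = res q 1 (if e = d then p m else 0))"

lemma realizesD:
  assumes "realizes f d p"
  shows "f \<in> carrier free_alg" "Uq_proj q f \<in> carrier (UA q)" "p m \<in> A" "fsym q f e m \<in> A"
    "res q 1 (fsym q f e m) = res q 1 (if e = d then p m else 0)"
  using assms usym_A[of "Uq_proj q f" e m] usym_proj[of f] by (auto simp: realizes_def)

lemma realizes_add:
  assumes f: "realizes f d p" and g: "realizes g d r"
  shows "realizes (f \<oplus>\<^bsub>free_alg\<^esub> g) d (\<lambda>m. p m + r m)"
proof -
  note fD = realizesD[OF f] and gD = realizesD[OF g]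
  have "res q 1 (fsym q f e m + fsym q g e m) = res q 1 ((if e = d then p m else 0) + (if e = d then r m else 0))" for e m
    by (rule res_add_cong[OF fD(5) gD(5)]) (use fD gD A_closed in auto)
  then have "res q 1 (fsym q (f \<oplus>\<^bsub>free_alg\<^esub> g) e m) = res q 1 (if e = d then p m + r m else 0)" for e m
    using fsym_add[OF fD(1) gD(1), of q e m] by (cases "e = d") simp_all
  moreover have "Uq_proj q (f \<oplus>\<^bsub>free_alg\<^esub> g) \<in> carrier (UA q)"
    using UA.a_closed[OF fD(2) gD(2)] P.hom_add[OF fD(1) gD(1)] by (simp add: UA_ops)
  ultimately show ?thesis using fD gD A_closed(3) free.a_closed[OF fD(1) gD(1)] by (simp add: realizes_def)
qed

lemma realizes_mult:
  assumes f: "realizes f d p" and g: "realizes g e r"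
  shows "realizes (f \<otimes>\<^bsub>free_alg\<^esub> g) (d + e) (\<lambda>m. p (m + e) * r m)"
proof -
  note fD = realizesD[OF f] and gD = realizesD[OF g]
  let ?D = "insert e (wdeg ` {w. g w \<noteq> 0})"
  have fin: "finite ?D" using gD(1) by (simp add: free_carrier)
  have "res q 1 (fsym q (f \<otimes>\<^bsub>free_alg\<^esub> g) c m) = res q 1 (if c = d + e then p (m + e) * r m else 0)" for c m
  proof -
    let ?t = "\<lambda>b. (if c - b = d then p (m + b) else 0) * (if b = e then r m else 0)"
    have "fsym q (f \<otimes>\<^bsub>free_alg\<^esub> g) c m = (\<Sum>b\<in>?D. fsym q f (c - b) (m + b) * fsym q g b m)"
      by (rule fsym_mult[OF fD(1) gD(1) fin]) blast
    also have "res q 1 (\<Sum>b\<in>?D. fsym q f (c - b) (m + b) * fsym q g b m) = res q 1 (\<Sum>b\<in>?D. ?t b)"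
    proof (rule res_sum_cong[OF fin])
      fix b
      show "res q 1 (fsym q f (c - b) (m + b) * fsym q g b m) = res q 1 (?t b)"
        by (rule res_mult_cong[OF fD(5) gD(5)]) (use fD gD A_closed in auto)
      show "fsym q f (c - b) (m + b) * fsym q g b m \<in> A" by (intro A_closed(4) fD(4) gD(4))
      show "?t b \<in> A" using fD(3) gD(3) A_closed by auto
    qed
    also have "(\<Sum>b\<in>?D. ?t b) = (\<Sum>b\<in>?D. if b = e then (if c - e = d then p (m + e) else 0) * r m else 0)"
      by (intro sum.cong) auto
    also have "\<dots> = (if c = d + e then p (m + e) * r m else 0)"
      using fin by (subst sum.delta) auto
    finally show ?thesis .
  qed
  moreover have "Uq_proj q (f \<otimes>\<^bsub>free_alg\<^esub> g) \<in> carrier (UA q)"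
    using UA.m_closed[OF fD(2) gD(2)] P.hom_mult[OF fD(1) gD(1)] by (simp add: UA_ops)
  moreover have "p (m + e) * r m \<in> A" for m by (intro A_closed(4) fD(3) gD(3))
  ultimately show ?thesis using free.m_closed[OF fD(1) gD(1)] by (simp add: realizes_def)
qed

lemma realizes_fscal: "c \<in> A \<Longrightarrow> realizes (fscal c) 0 (\<lambda>_. c)"
  using scalar_UA[of c] by (simp add: realizes_def fscal_closed fsym_fscal scalar_def)

lemma fgen_UA: "Uq_proj q (fgen g) \<in> carrier (UA q)"
proof -
  have "q_fact q 1 = 1" using q_minus_inverse_nz by (simp add: q_fact_def q_int_def)
  then have "div_pow q g 1 = Uq_proj q (fscal 1 \<otimes>\<^bsub>free_alg\<^esub> (\<one>\<^bsub>free_alg\<^esub> \<otimes>\<^bsub>free_alg\<^esub> fgen g))"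
    by (simp add: div_pow_proj)
  then have "div_pow q g 1 = Uq_proj q (fgen g)"
    unfolding free_ops(3)[symmetric] by (simp add: fgen_closed)
  then have "Uq_proj q (fgen g) \<in> UA_gens" by (cases g) (auto intro: range_eqI[of _ _ 1])
  then show ?thesis unfolding UA_carrier by (rule generate_ring.incl)
qed

lemma realizes_E: "realizes (fgen Gen_E) 1 (\<lambda>m. of_int (- m))"
  and realizes_F: "realizes (fgen Gen_F) (-1) of_int"
proof -
  show "realizes (fgen Gen_E) 1 (\<lambda>m. of_int (- m))"
    unfolding realizes_def fsym_fgen using gcoef_E_mod A_int fgen_UA[of Gen_E] fgen_closed[of Gen_E]
    by (auto simp del: gcoef.simps of_int_minus)
  show "realizes (fgen Gen_F) (-1) of_int"
    unfolding realizes_def fsym_fgen using gcoef_F_mod A_int fgen_UA[of Gen_F] fgen_closed[of Gen_F]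
    by (auto simp del: gcoef.simps)
qed

text \<open>The operator is \<open>x d/dx\<close>.  At \<open>q = 1\<close> the action is that of the Lie algebra \<open>sl\<^sub>2\<close> by vector fields
  on the projective line, where the commutator of \<open>E\<close> and \<open>F\<close> is \<open>2 x d/dx\<close>.\<close>

lemma realizes_euler: obtains h where "realizes h 0 of_int"
proof -
  let ?E = "fgen Gen_E :: gen list \<Rightarrow> 'k" and ?F = "fgen Gen_F :: gen list \<Rightarrow> 'k"
  let ?h = "fscal (1/2) \<otimes>\<^bsub>free_alg\<^esub> (?E \<otimes>\<^bsub>free_alg\<^esub> ?F \<oplus>\<^bsub>free_alg\<^esub> fscal (-1) \<otimes>\<^bsub>free_alg\<^esub> (?F \<otimes>\<^bsub>free_alg\<^esub> ?E))"
  have half: "(1/2 :: 'k) \<in> A" "(-1 :: 'k) \<in> A" by (rule A_rat, simp)+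
  have EF: "realizes (?E \<otimes>\<^bsub>free_alg\<^esub> ?F) 0 (\<lambda>m. of_int (- (m + -1)) * of_int m)"
    using realizes_mult[OF realizes_E realizes_F] by simp
  have FE: "realizes (?F \<otimes>\<^bsub>free_alg\<^esub> ?E) 0 (\<lambda>m. of_int (m + 1) * of_int (- m))"
    using realizes_mult[OF realizes_F realizes_E] by simp
  have mFE: "realizes (fscal (-1) \<otimes>\<^bsub>free_alg\<^esub> (?F \<otimes>\<^bsub>free_alg\<^esub> ?E)) 0 (\<lambda>m. -1 * (of_int (m + 1) * of_int (- m)))"
    using realizes_mult[OF realizes_fscal[OF half(2)] FE] by simp
  have "realizes ?h 0 (\<lambda>m. 1/2 * (of_int (- (m + -1)) * of_int m + -1 * (of_int (m + 1) * of_int (- m))))"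
    using realizes_mult[OF realizes_fscal[OF half(1)] realizes_add[OF EF mFE]] by simp
  moreover have "1/2 * (of_int (- (m + -1)) * of_int m + -1 * (of_int (m + 1) * of_int (- m))) = (of_int m :: 'k)" for m
    by (simp add: algebra_simps)
  ultimately have "realizes ?h 0 of_int" by simp
  then show thesis by (rule that)
qed

text \<open>The sign \<open>\<epsilon>\<close> selects \<open>F\<close> or \<open>E\<close>, whose coefficient at \<open>q = 1\<close> is \<open>\<epsilon> m\<close>.  Its \<open>e\<close>-th power contributes
  the first \<open>e\<close> factors, and every further factor comes from the Euler operator in degree \<open>0\<close>.\<close>

lemma realizes_falling:
  assumes \<epsilon>: "\<epsilon> = 1 \<or> \<epsilon> = -1" and ie: "e \<le> i"
  shows "\<exists>f. realizes f (- \<epsilon> * int e) (\<lambda>m. \<Prod>j<i. of_int (\<epsilon> * m) - of_nat j)"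
  using ie
proof (induction i rule: dec_induct)
  case base
  obtain g where g: "realizes g (- \<epsilon>) (\<lambda>m. of_int (\<epsilon> * m))"
    using \<epsilon> realizes_E realizes_F by fastforce
  show ?case
  proof (induction e)
    case 0
    show ?case using realizes_fscal[OF A_closed(2)] by auto
  next
    case (Suc e)
    then obtain f where f: "realizes f (- \<epsilon> * int e) (\<lambda>m. \<Prod>j<e. of_int (\<epsilon> * m) - of_nat j)" by blast
    have "realizes (g \<otimes>\<^bsub>free_alg\<^esub> f) (- \<epsilon> + - \<epsilon> * int e)
        (\<lambda>m. of_int (\<epsilon> * (m + - \<epsilon> * int e)) * (\<Prod>j<e. of_int (\<epsilon> * m) - of_nat j))"
      by (rule realizes_mult[OF g f])
    moreover have "- \<epsilon> + - \<epsilon> * int e = - \<epsilon> * int (Suc e)" by (simp add: algebra_simps)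
    moreover have "of_int (\<epsilon> * (m + - \<epsilon> * int e)) = (of_int (\<epsilon> * m) - of_nat e :: 'k)" for m
      using \<epsilon> by auto
    ultimately show ?case by (auto simp: mult.commute)
  qed
next
  case (step i)
  then obtain f where f: "realizes f (- \<epsilon> * int e) (\<lambda>m. \<Prod>j<i. of_int (\<epsilon> * m) - of_nat j)" by blast
  obtain h where h: "realizes h 0 of_int" using realizes_euler .
  have c: "of_int \<epsilon> \<in> A" "- of_nat i \<in> A" using A_int A_rat by simp_all
  have "realizes (fscal (of_int \<epsilon>) \<otimes>\<^bsub>free_alg\<^esub> h \<oplus>\<^bsub>free_alg\<^esub> fscal (- of_nat i)) 0 (\<lambda>m. of_int \<epsilon> * of_int m + - of_nat i)"
    using realizes_add[OF realizes_mult[OF realizes_fscal[OF c(1)] h, simplified] realizes_fscal[OF c(2)]] by simp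
  from realizes_mult[OF f this] show ?case by auto
qed

lemma realizes_sum:
  assumes "finite J" "\<And>i. i \<in> J \<Longrightarrow> \<exists>f. realizes f d (p i)"
  shows "\<exists>f. realizes f d (\<lambda>m. \<Sum>i\<in>J. p i m)"
  using assms
proof (induction J rule: finite_induct)
  case empty
  have "realizes (fscal 0) d (\<lambda>_. 0)"
    using realizes_fscal[OF A_closed(1)] by (simp add: realizes_def)
  then show ?case by auto
next
  case (insert x F)
  then obtain f g where "realizes f d (p x)" "realizes g d (\<lambda>m. \<Sum>i\<in>F. p i m)" by blast
  then show ?case using realizes_add insert.hyps by fastforce
qed

text \<open>The zeros of \<open>p\<close> kill the Newton coefficients below \<open>e\<close>; the remaining binomial coefficients are
  falling factorials of length at least \<open>e\<close>, up to rational factors.\<close>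

lemma realizes_rational_poly:
  assumes \<epsilon>: "\<epsilon> = 1 \<or> \<epsilon> = -1"
    and p: "poly_fun field_ring k p" "\<And>m. p m \<in> \<rat>"
    and z: "\<And>j. 0 \<le> j \<Longrightarrow> j < int e \<Longrightarrow> p (\<epsilon> * j) = 0"
  shows "\<exists>f. realizes f (- \<epsilon> * int e) p"
proof -
  interpret F: cring "field_ring :: 'k ring" by (rule field_ring_cring)
  let ?p = "\<lambda>m. p (\<epsilon> * m)"
  have "poly_fun field_ring k ?p"
    using \<epsilon> F.poly_fun_reflect[OF p(1), of 0] p(1) by (auto simp: field_ops)
  then have exp: "p m = (\<Sum>i<k. newton i ?p * (of_int (\<epsilon> * m) gchoose i))" for m
    using newton_expansion[of k ?p "\<epsilon> * m"] \<epsilon> by auto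
  have "\<exists>f. realizes f (- \<epsilon> * int e) (\<lambda>m. newton i ?p * (of_int (\<epsilon> * m) gchoose i))" for i
  proof (cases "e \<le> i")
    case True
    obtain f where f: "realizes f (- \<epsilon> * int e) (\<lambda>m. \<Prod>j<i. of_int (\<epsilon> * m) - of_nat j)"
      using realizes_falling[OF \<epsilon> True] by blast
    have "(fact i :: 'k) \<in> \<rat>" by (metis Rats_of_nat of_nat_fact)
    then have c: "newton i ?p / fact i \<in> A" using p(2) by (intro A_rat Rats_divide newton_rat) auto
    have "newton i ?p / fact i * (\<Prod>j<i. of_int (\<epsilon> * m) - of_nat j) = newton i ?p * (of_int (\<epsilon> * m) gchoose i)" for m
      by (simp add: gbinomial_prod_rev atLeast0LessThan)
    then show ?thesis using realizes_mult[OF realizes_fscal[OF c] f] by auto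
  next
    case False
    then have "newton i ?p = 0" using z by (intro newton_zero) auto
    moreover have "realizes (fscal 0) d (\<lambda>_. 0)" for d
      using realizes_fscal[OF A_closed(1)] by (simp add: realizes_def)
    ultimately show ?thesis by auto
  qed
  then have "\<exists>f. realizes f (- \<epsilon> * int e) (\<lambda>m. \<Sum>i<k. newton i ?p * (of_int (\<epsilon> * m) gchoose i))"
    by (intro realizes_sum) auto
  then show ?thesis unfolding exp[symmetric] .
qed

text \<open>In degree \<open>d\<close> the crossing condition puts zeros at the \<open>\<bar>d\<bar>\<close> exponents, starting with \<open>0\<close>,
  from which the shift by \<open>d\<close> leaves the half-line.\<close>

lemma rational_symbol_lift:
  assumes P: "\<And>d. \<exists>k. poly_fun field_ring k (P d)" "\<And>d m. P d m \<in> \<rat>"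
    and fin: "finite {d. \<exists>m. P d m \<noteq> 0}"
    and cross: "\<And>d m. (m \<ge> 0 \<and> m + d < 0) \<or> (m \<le> 0 \<and> m + d > 0) \<Longrightarrow> P d m = 0"
  shows "\<exists>w\<in>carrier (UA q). \<forall>d m. res q 1 (usym w d m) = res q 1 (P d m)"
proof -
  have single: "\<exists>f. realizes f d (P d)" for d
  proof -
    obtain k where k: "poly_fun field_ring k (P d)" using P(1) by blast
    define \<epsilon> :: int where "\<epsilon> = (if d \<le> 0 then 1 else -1)"
    have "\<exists>f. realizes f (- \<epsilon> * int (nat \<bar>d\<bar>)) (P d)"
      by (rule realizes_rational_poly[OF _ k P(2)]) (auto simp: \<epsilon>_def intro!: cross)
    moreover have "- \<epsilon> * int (nat \<bar>d\<bar>) = d" by (simp add: \<epsilon>_def)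
    ultimately show ?thesis by simp
  qed
  have "\<exists>w\<in>carrier (UA q). \<forall>d m. res q 1 (usym w d m) = res q 1 (if d \<in> D then P d m else 0)" if "finite D" for D
    using that
  proof (induction D rule: finite_induct)
    case empty
    have "usym (scalar 0) d m = 0" for d m
      unfolding scalar_def usym_proj[OF fscal_closed] by (simp add: fsym_fscal)
    then show ?case using scalar_UA[OF A_closed(1)] by (intro bexI[of _ "scalar 0"]) auto
  next
    case (insert e D)
    then obtain w where w: "w \<in> carrier (UA q)" "\<And>d m. res q 1 (usym w d m) = res q 1 (if d \<in> D then P d m else 0)" by blast
    obtain f where f: "realizes f e (P e)" using single by blast
    note fD = realizesD[OF f]
    let ?u = "w \<oplus>\<^bsub>UA q\<^esub> Uq_proj q f"
    have PA: "P d m \<in> A" for d m using P(2) A_rat by blast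
    have "res q 1 (usym ?u d m) = res q 1 (if d \<in> insert e D then P d m else 0)" for d m
    proof -
      have "res q 1 (usym w d m + fsym q f d m) = res q 1 ((if d \<in> D then P d m else 0) + (if d = e then P e m else 0))"
        by (rule res_add_cong[OF w(2) fD(5)]) (use usym_A[OF w(1)] fD(4) PA A_closed in auto)
      then show ?thesis
        unfolding usym_add[OF w(1) fD(2)] usym_proj[OF fD(1)] using insert.hyps(2) by (auto split: if_splits)
    qed
    then show ?case using UA.a_closed[OF w(1) fD(2)] by blast
  qed
  from this[OF fin] obtain w where w: "w \<in> carrier (UA q)"
    "\<And>d m. res q 1 (usym w d m) = res q 1 (if d \<in> {d. \<exists>m. P d m \<noteq> 0} then P d m else 0)" by blast
  have "res q 1 (usym w d m) = res q 1 (P d m)" for d m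
    using w(2)[of d m] by (auto split: if_splits)
  then show ?thesis using w(1) by blast
qed

end

section \<open>Passage to the inverse limit\<close>

lemma global_symbolD:
  assumes "global_symbol R P"
  shows "P d m \<in> carrier R" "\<exists>k. poly_fun R k (P d)" "finite {d. \<exists>m. P d m \<noteq> \<zero>\<^bsub>R\<^esub>}"
    "(m \<ge> 0 \<and> m + d < 0) \<or> (m \<le> 0 \<and> m + d > 0) \<Longrightarrow> P d m = \<zero>\<^bsub>R\<^esub>"
  using assms unfolding global_symbol_def diff_symbol_def by auto

context transcendental
begin

text \<open>The difference of the two symbols is divisible by \<open>(q-1)\<^sup>n\<close>, and only the value of the quotient at
  \<open>q = 1\<close> matters.  This value is a rational number, and as \<open>c \<mapsto> (q-1)\<^sup>n c\<close> is injective from the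
  rational numbers to \<open>B\<^sub>n\<^sub>+\<^sub>1\<close>, it inherits polynomiality and zeros from the difference.\<close>

lemma lift_step:
  assumes x: "x \<in> carrier (UA q)" and Q: "global_symbol (B (Suc n)) Q"
    and red: "\<And>d m. red n (Q d m) = rsym n x d m"
  shows "\<exists>w\<in>carrier (UA q). rsym (Suc n) (x \<oplus>\<^bsub>UA q\<^esub> w \<otimes>\<^bsub>UA q\<^esub> scalar ((q - 1) ^ n)) = Q"
proof -
  interpret B: cring "B (Suc n)" by (rule B_cring)
  let ?t = "q - 1"
  note QD = global_symbolD[OF Q] and xD = global_symbolD[OF rsym_global[OF x, of "Suc n"]]
  note Qc = QD(1)
  have "\<exists>c. c \<in> \<rat> \<and> Q d m = res q (Suc n) (usym x d m + ?t ^ n * c)" for d m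
  proof -
    obtain a where a: "a \<in> A" "Q d m = res q (Suc n) a" using Qc[of d m] by (auto simp: B_carrier)
    have "res q n a = res q n (usym x d m)" using red[of d m] red_res[OF a(1)] a(2) by simp
    then obtain b where b: "b \<in> A" "a - usym x d m = ?t ^ n * b"
      using res_eq_iff[OF a(1) usym_A[OF x]] by blast
    obtain c b' where c: "c \<in> \<rat>" "b' \<in> A" "b - c = ?t * b'" using rat_residue[OF b(1)] by blast
    have eq: "a - (usym x d m + ?t ^ n * c) = ?t ^ Suc n * b'"
    proof -
      have "a - (usym x d m + ?t ^ n * c) = ?t ^ n * b - ?t ^ n * c" using b(2) by (simp add: algebra_simps)
      also have "\<dots> = ?t ^ n * (?t * b')" unfolding c(3)[symmetric] by (simp only: right_diff_distrib)
      finally show ?thesis by (simp add: mult.assoc mult.left_commute)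
    qed
    have "usym x d m + ?t ^ n * c \<in> A" by (intro A_closed usym_A x A_qm1 A_rat c(1))
    then have "res q (Suc n) a = res q (Suc n) (usym x d m + ?t ^ n * c)"
      using res_eqI[OF a(1) _ c(2) eq] by blast
    then show ?thesis using c(1) a(2) by auto
  qed
  then obtain r where r: "\<And>d m. r d m \<in> \<rat>" "\<And>d m. Q d m = res q (Suc n) (usym x d m + ?t ^ n * r d m)"
    by metis
  define h where "h c = res q (Suc n) (?t ^ n * c)" for c
  have hA: "?t ^ n * c \<in> A" if "c \<in> \<rat>" for c by (intro A_closed A_qm1 A_rat that)
  have h_inj: "c = 0" if cr: "c \<in> \<rat>" and cz: "h c = \<zero>\<^bsub>B (Suc n)\<^esub>" for c
  proof -
    have "res q (Suc n) (?t ^ n * c) = res q (Suc n) 0"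
      using cz res_ops(4)[OF A_closed(1,1)] by (simp add: h_def)
    then obtain b where "b \<in> A" "?t ^ n * c - 0 = ?t ^ Suc n * b"
      using res_eq_iff[OF hA[OF cr] A_closed(1)] by blast
    then have "c = ?t * b" using q_ne_1 by (simp add: mult.left_commute[of _ "?t ^ n"])
    then show "c = 0" using rat_in_ideal_zero cr \<open>b \<in> A\<close> by blast
  qed
  have h_r: "h (r d m) = Q d m \<ominus>\<^bsub>B (Suc n)\<^esub> rsym (Suc n) x d m" for d m
    unfolding h_def r(2) using res_ops(3)[OF A_closed(3)[OF usym_A[OF x] hA[OF r(1)]] usym_A[OF x]] by simp
  have r_zero: "r d m = 0" if "Q d m = \<zero>\<^bsub>B (Suc n)\<^esub>" "rsym (Suc n) x d m = \<zero>\<^bsub>B (Suc n)\<^esub>" for d m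
    by (rule h_inj[OF r(1)]) (simp add: h_r that a_minus_def)
  have "\<exists>w\<in>carrier (UA q). \<forall>d m. res q 1 (usym w d m) = res q 1 (r d m)"
  proof (rule rational_symbol_lift)
    show "\<exists>k. poly_fun field_ring k (r d)" for d
    proof -
      obtain k l where kl: "poly_fun (B (Suc n)) k (Q d)" "poly_fun (B (Suc n)) l (rsym (Suc n) x d)"
        using QD(2)[of d] xD(2)[of d] by blast
      have rc: "rsym (Suc n) x d m \<in> carrier (B (Suc n))" for m by (rule res_closed[OF usym_A[OF x]])
      have "poly_fun (B (Suc n)) (max k l) (\<lambda>m. Q d m \<ominus>\<^bsub>B (Suc n)\<^esub> rsym (Suc n) x d m)"
        by (rule B.poly_fun_minus[OF B.poly_fun_mono[OF kl(1) _ Qc] B.poly_fun_mono[OF kl(2) _ rc] Qc rc]) simp_all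
      then have "poly_fun (B (Suc n)) (max k l) (\<lambda>m. h (r d m))" by (simp only: h_r)
      moreover have "a \<ominus>\<^bsub>field_ring\<^esub> b \<in> \<rat> \<and> h (a \<ominus>\<^bsub>field_ring\<^esub> b) = h a \<ominus>\<^bsub>B (Suc n)\<^esub> h b"
        if "a \<in> \<rat>" "b \<in> \<rat>" for a b
        using that res_ops(3)[OF hA[OF that(1)] hA[OF that(2)]]
        by (simp add: field_minus h_def right_diff_distrib)
      ultimately have "poly_fun field_ring (max k l) (r d)"
        using h_inj by (intro poly_fun_inj[where C = \<rat> and h = h and R' = "B (Suc n)"] r(1)) (simp_all add: field_ops)
      then show ?thesis by blast
    qed
    have "{d. \<exists>m. r d m \<noteq> 0} \<subseteq> {d. \<exists>m. Q d m \<noteq> \<zero>\<^bsub>B (Suc n)\<^esub>} \<union> {d. \<exists>m. rsym (Suc n) x d m \<noteq> \<zero>\<^bsub>B (Suc n)\<^esub>}"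
      using r_zero by blast
    then show "finite {d. \<exists>m. r d m \<noteq> 0}" by (rule finite_subset) (use QD(3) xD(3) in simp)
    show "r d m = 0" if "(m \<ge> 0 \<and> m + d < 0) \<or> (m \<le> 0 \<and> m + d > 0)" for d m
      by (rule r_zero[OF QD(4)[OF that] xD(4)[OF that]])
  qed (rule r(1))
  then obtain w where w: "w \<in> carrier (UA q)" "\<And>d m. res q 1 (usym w d m) = res q 1 (r d m)" by blast
  have "rsym (Suc n) (x \<oplus>\<^bsub>UA q\<^esub> w \<otimes>\<^bsub>UA q\<^esub> scalar (?t ^ n)) d m = Q d m" for d m
  proof -
    obtain b where b: "b \<in> A" "usym w d m - r d m = ?t ^ 1 * b"
      using res_eq_iff[OF usym_A[OF w(1)] A_rat[OF r(1)]] w(2) by blast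
    have eq: "usym x d m + ?t ^ n * usym w d m - (usym x d m + ?t ^ n * r d m) = ?t ^ Suc n * b"
    proof -
      have "?t ^ n * usym w d m - ?t ^ n * r d m = ?t ^ n * (?t * b)"
        using b(2) by (simp only: right_diff_distrib[symmetric] power_one_right)
      then show ?thesis by (simp add: mult.assoc mult.left_commute)
    qed
    have "usym (x \<oplus>\<^bsub>UA q\<^esub> w \<otimes>\<^bsub>UA q\<^esub> scalar (?t ^ n)) d m = usym x d m + ?t ^ n * usym w d m"
      using usym_add[OF x UA.m_closed[OF w(1) scalar_UA[OF A_qm1]]] usym_scalar_mult[OF w(1)] by simp
    then show ?thesis unfolding r(2)
      using res_eqI[OF A_closed(3)[OF usym_A[OF x] A_closed(4)[OF A_qm1 usym_A[OF w(1)]]]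
          A_closed(3)[OF usym_A[OF x] hA[OF r(1)]] b(1) eq] by simp
  qed
  then have "rsym (Suc n) (x \<oplus>\<^bsub>UA q\<^esub> w \<otimes>\<^bsub>UA q\<^esub> scalar (?t ^ n)) = Q" by (intro ext)
  then show ?thesis using w(1) by blast
qed

definition global_op :: "nat \<Rightarrow> (int \<Rightarrow> int \<Rightarrow> 'k set) \<Rightarrow>
    ((int \<Rightarrow> 'k set) \<Rightarrow> int \<Rightarrow> 'k set) \<times> ((int \<Rightarrow> 'k set) \<Rightarrow> int \<Rightarrow> 'k set)"
  where "global_op n P = (symop (B n) {0..} P, symop (B n) {..0} P)"

abbreviation "red_pair n \<equiv> (\<lambda>(\<phi>\<^sub>1, \<phi>\<^sub>2). (red_op q n {0..} \<phi>\<^sub>1, red_op q n {..0} \<phi>\<^sub>2))"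

lemma Gamma_n_global: "Gamma_n q n = global_op n ` {P. global_symbol (B n) P}"
  unfolding Gamma_n_eq global_op_def by blast

lemma global_op_inj:
  "global_symbol (B n) P \<Longrightarrow> global_symbol (B n) Q \<Longrightarrow> global_op n P = global_op n Q \<Longrightarrow> P = Q"
  using symop_eq_iff[of "{0..}" n P Q] by (simp add: global_op_def global_symbol_def)

lemma red_global:
  assumes P: "global_symbol (B (Suc n)) P"
  shows "red_pair n (global_op (Suc n) P) = global_op n (\<lambda>d m. red n (P d m))"
    and "global_symbol (B n) (\<lambda>d m. red n (P d m))"
proof -
  have Pc: "\<And>d m. P d m \<in> carrier (B (Suc n))" using global_symbolD(1)[OF P] .
  show "red_pair n (global_op (Suc n) P) = global_op n (\<lambda>d m. red n (P d m))"
    using red_op_symop[OF _ Pc] by (simp add: global_op_def)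
  interpret h: ring_hom_cring "B (Suc n)" "B n" "red n"
    by (intro ring_hom_cringI ring_hom_ringI2 B_cring cring.axioms(1)[OF B_cring] red_hom)
  have rc: "red n a \<in> carrier (B n)" if "a \<in> carrier (B (Suc n))" for a using that by simp
  have sub: "{d. \<exists>m. red n (P d m) \<noteq> \<zero>\<^bsub>B n\<^esub>} \<subseteq> {d. \<exists>m. P d m \<noteq> \<zero>\<^bsub>B (Suc n)\<^esub>}" by auto
  have poly: "\<exists>k. poly_fun (B n) k (\<lambda>m. red n (P d m))" for d
  proof -
    obtain k where k: "poly_fun (B (Suc n)) k (P d)" using P unfolding global_symbol_def diff_symbol_def by blast
    have "poly_fun (B n) k (\<lambda>m. red n (P d m))"
      by (rule poly_fun_hom[OF k Pc B_cring]) (simp_all add: a_minus_def)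
    then show ?thesis by blast
  qed
  show "global_symbol (B n) (\<lambda>d m. red n (P d m))"
    using P finite_subset[OF sub] poly rc Pc unfolding global_symbol_def diff_symbol_def by simp
qed

lemma eta_n_global: "u \<in> carrier (UA q) \<Longrightarrow> eta_n q n (U_mod q n u) = global_op n (rsym n u)"
  by (simp add: eta_n_U_mod global_op_def)

lemma eta_hat_in_Gamma_hat:
  assumes s: "s \<in> U_hat q" shows "eta_hat q s \<in> Gamma_hat q"
proof -
  have sP: "s \<in> (\<Pi>\<^sub>E n\<in>{1..}. carrier (U_n q n))" using s by (simp add: U_hat_def inv_lim_def)
  have sc: "s n \<in> U_mod q n ` carrier (UA q)" if "n \<ge> 1" for n
    using PiE_mem[OF sP, of n] that unfolding U_n_carrier by simp
  have st: "set_add (UA q) (U_ideal q n) (s (Suc n)) = s n" if "n \<ge> 1" for n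
    using s that by (simp add: U_hat_def inv_lim_def)
  have mem: "eta_n q n (s n) \<in> Gamma_n q n" if n: "n \<ge> 1" for n
  proof -
    obtain u where u: "u \<in> carrier (UA q)" "s n = U_mod q n u" using sc[OF n] by blast
    show ?thesis
      unfolding Gamma_n_global u(2) eta_n_global[OF u(1)] by (rule imageI) (simp add: rsym_global[OF u(1)])
  qed
  have compat: "red_pair n (eta_n q (Suc n) (s (Suc n))) = eta_n q n (s n)" if n: "n \<ge> 1" for n
  proof -
    obtain u where u: "u \<in> carrier (UA q)" "s (Suc n) = U_mod q (Suc n) u" using sc[of "Suc n"] by auto
    have "s n = U_mod q n u" using st[OF n] U_transition[OF u(1)] u(2) by simp
    then show ?thesis
      unfolding u(2) eta_n_global[OF u(1)] red_global(1)[OF rsym_global[OF u(1)]] red_rsym[OF u(1)]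
      by (simp add: eta_n_global[OF u(1)])
  qed
  show ?thesis
    unfolding Gamma_hat_def inv_lim_def
  proof (intro CollectI conjI allI impI)
    show "eta_hat q s \<in> (\<Pi>\<^sub>E n\<in>{1..}. Gamma_n q n)"
      unfolding eta_hat_def restrict_PiE_iff using mem by simp
    show "red_pair n (eta_hat q s (Suc n)) = eta_hat q s n" if "n \<ge> 1" for n
      using compat[OF that] that by (simp add: eta_hat_def)
  qed
qed

lemma Gamma_hat_lift:
  assumes g: "g \<in> Gamma_hat q" shows "\<exists>s\<in>U_hat q. eta_hat q s = g"
proof -
  have gP: "g \<in> (\<Pi>\<^sub>E n\<in>{1..}. Gamma_n q n)" and gt: "\<And>n. n \<ge> 1 \<Longrightarrow> red_pair n (g (Suc n)) = g n"
    using g by (auto simp: Gamma_hat_def inv_lim_def)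
  have "\<exists>Q. global_symbol (B (Suc n)) Q \<and> g (Suc n) = global_op (Suc n) Q" for n
    using PiE_mem[OF gP, of "Suc n"] unfolding Gamma_n_global by auto
  then obtain Q where Q: "\<And>n. global_symbol (B (Suc n)) (Q n)" "\<And>n. g (Suc n) = global_op (Suc n) (Q n)"
    by metis
  have Q_red: "(\<lambda>d m. red (Suc n) (Q (Suc n) d m)) = Q n" for n
  proof (rule global_op_inj[OF red_global(2)[OF Q(1)] Q(1)])
    show "global_op (Suc n) (\<lambda>d m. red (Suc n) (Q (Suc n) d m)) = global_op (Suc n) (Q n)"
      using gt[of "Suc n"] red_global(1)[OF Q(1)[of "Suc n"]] Q(2) by simp
  qed
  have "\<exists>u. \<forall>n. (u n \<in> carrier (UA q) \<and> rsym (Suc n) (u n) = Q n) \<and>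
      U_mod q (Suc n) (u (Suc n)) = U_mod q (Suc n) (u n)"
  proof (rule dependent_nat_choice)
    \<comment> \<open>The recursion can start with \<open>0\<close>, as modulo \<open>(q-1)\<^sup>0\<close> everything is congruent.\<close>
    have "red 0 (Q 0 d m) = rsym 0 \<zero>\<^bsub>UA q\<^esub> d m" for d m
    proof -
      have "Q 0 d m \<in> carrier (B (Suc 0))" using Q(1)[of 0] by (simp add: global_symbol_def diff_symbol_def)
      then obtain a where a: "a \<in> A" "Q 0 d m = res q (Suc 0) a" by (auto simp: B_carrier)
      have "res q 0 a = res q 0 (usym \<zero>\<^bsub>UA q\<^esub> d m)"
        by (rule res_eqI[of _ _ "a - usym \<zero>\<^bsub>UA q\<^esub> d m"])
           (simp_all add: a(1) usym_A A_minus)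
      then show ?thesis using a red_res by simp
    qed
    from lift_step[OF UA.zero_closed Q(1) this]
    obtain w where "w \<in> carrier (UA q)"
      "rsym (Suc 0) (\<zero>\<^bsub>UA q\<^esub> \<oplus>\<^bsub>UA q\<^esub> w \<otimes>\<^bsub>UA q\<^esub> scalar ((q - 1) ^ 0)) = Q 0" by blast
    moreover from this have "\<zero>\<^bsub>UA q\<^esub> \<oplus>\<^bsub>UA q\<^esub> w \<otimes>\<^bsub>UA q\<^esub> scalar ((q - 1) ^ 0) \<in> carrier (UA q)"
      by (intro UA.a_closed UA.zero_closed UA.m_closed scalar_UA A_qm1)
    ultimately show "\<exists>x. x \<in> carrier (UA q) \<and> rsym (Suc 0) x = Q 0" by (intro exI conjI)
  next
    fix x n assume x: "x \<in> carrier (UA q) \<and> rsym (Suc n) x = Q n"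
    have "red (Suc n) (Q (Suc n) d m) = rsym (Suc n) x d m" for d m
      using fun_cong[OF fun_cong[OF Q_red[of n]], of d m] fun_cong[OF fun_cong[OF conjunct2[OF x]], of d m] by simp
    from lift_step[OF conjunct1[OF x] Q(1) this]
    obtain w where w: "w \<in> carrier (UA q)"
      "rsym (Suc (Suc n)) (x \<oplus>\<^bsub>UA q\<^esub> w \<otimes>\<^bsub>UA q\<^esub> scalar ((q - 1) ^ Suc n)) = Q (Suc n)" by blast
    have "x \<oplus>\<^bsub>UA q\<^esub> w \<otimes>\<^bsub>UA q\<^esub> scalar ((q - 1) ^ Suc n) \<in> carrier (UA q)"
      by (intro UA.a_closed conjunct1[OF x] UA.m_closed w(1) scalar_UA A_qm1)
    then show "\<exists>y. (y \<in> carrier (UA q) \<and> rsym (Suc (Suc n)) y = Q (Suc n)) \<and> U_mod q (Suc n) y = U_mod q (Suc n) x"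
      using w(2) U_mod_add[OF conjunct1[OF x] w(1), of "Suc n"] by (intro exI conjI)
  qed
  then obtain u where u': "\<forall>n. (u n \<in> carrier (UA q) \<and> rsym (Suc n) (u n) = Q n) \<and>
      U_mod q (Suc n) (u (Suc n)) = U_mod q (Suc n) (u n)" by (elim exE)
  note u = conjunct1[OF conjunct1[OF spec[OF u']]] conjunct2[OF conjunct1[OF spec[OF u']]] conjunct2[OF spec[OF u']]
  define s where "s = (\<lambda>n\<in>{1..}. U_mod q n (u (n - 1)))"
  have sS: "s (Suc n) = U_mod q (Suc n) (u n)" for n by (simp add: s_def)
  have pos: "\<exists>k. n = Suc k" if "n \<ge> 1" for n :: nat using that by (cases n) auto
  have "s \<in> U_hat q"
    unfolding U_hat_def inv_lim_def
  proof (intro CollectI conjI allI impI PiE_I)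
    fix n :: nat assume "n \<in> {1..}"
    then obtain k where "n = Suc k" using pos by auto
    then show "s n \<in> carrier (U_n q n)" using sS u(1) U_n_carrier by auto
  next
    fix n :: nat assume "n \<ge> 1"
    then obtain k where k: "n = Suc k" using pos by auto
    show "set_add (UA q) (U_ideal q n) (s (Suc n)) = s n"
      unfolding k sS using U_transition[OF u(1)] u(3) by simp
  qed (simp add: s_def)
  moreover have "eta_hat q s = g"
  proof
    fix n
    show "eta_hat q s n = g n"
    proof (cases n)
      case 0
      then show ?thesis using gP by (simp add: eta_hat_def PiE_def extensional_def)
    next
      case (Suc k)
      then show ?thesis using sS eta_n_global[OF u(1)] u(2) Q(2) by (simp add: eta_hat_def)
    qed
  qed
  ultimately show ?thesis by blast
qed

end

theorem theorem5p4p1: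
  fixes q :: "'k::field_char_0"
  assumes "\<not> algebraic q"
  shows "eta_hat q ` U_hat q = Gamma_hat q"
proof -
  interpret transcendental q by unfold_locales (rule assms)
  show ?thesis using eta_hat_in_Gamma_hat Gamma_hat_lift by blast
qed

end
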